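(* Let $H$ be a Hilbert $C^*$-module and $Q\in\mathcal{L}(H)$ a non-projection idempotent such that the matched pair $(m(Q),Q)$ is harmonious. With $P=m(Q)$, let $H_1=\mathcal{R}(P)\cap\mathcal{R}(Q)$, $H_4=\mathcal{N}(P)\cap\mathcal{N}(Q)$, $H_5=\overline{\mathcal{R}(PQ(I-P))}$, $H_6=\overline{\mathcal{R}((I-P)QP)}$, and let $U_{m(Q),Q}:H\to H_1\oplus H_4\oplus H_5\oplus H_6$ be the unitary $x\mapsto(P_{H_1}x,P_{H_4}x,P_{H_5}x,P_{H_6}x)^T$. Then there exist a unitary operator $U\in\mathcal{L}(H_5,H_6)$ and $A\in\mathcal{L}(H_5)$ with $A\ge I_{H_5}$ and $\overline{\mathcal{R}(A-I_{H_5})}=H_5$ such that, with $B=A(2A-I_{H_5})^{-1}$ (a positive contraction), $$U_{m(Q),Q}P_{\mathcal{R}(Q)}U_{m(Q),Q}^*=I_{H_1}\oplus0_{H_4}\oplus\begin{pmatrix} B & B^{1/2}(I_{H_5}-B)^{1/2}U^*\\ UB^{1/2}(I_{H_5}-B)^{1/2} & U(I_{H_5}-B)U^*\end{pmatrix},$$ $$U_{m(Q),Q}P_{\mathcal{N}(Q)}U_{m(Q),Q}^*=0_{H_1}\oplus I_{H_4}\oplus\begin{pmatrix} I_{H_5}-B & B^{1/2}(I_{H_5}-B)^{1/2}U^*\\ UB^{1/2}(I_{H_5}-B)^{1/2} & UBU^*\end{pmatrix}.$$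
   Context: $H$ is a Hilbert module over a $C^*$-algebra, $\mathcal{L}(H)$ the adjointable operators; projections are self-adjoint idempotents; $P_{\mathcal{R}(Q)}$, $P_{\mathcal{N}(Q)}$ are the projections onto the (orthogonally complemented) range and null space of the idempotent $Q$. For $T\in\mathcal{L}(H)$, $|T|=(T^*T)^{1/2}$ and $T^\dagger$ is the Moore–Penrose inverse. The matched projection of $Q$ is $m(Q)=\tfrac12(|Q^*|+Q^* )|Q^*|^\dagger(|Q^*|+I)^{-1}(|Q^*|+Q)$; $(m(Q),Q)$ is a quasi-projection pair ($Q^*=(2m(Q)-I)Q(2m(Q)-I)$). A quasi-projection pair $(P,Q)$ is harmonious if $\overline{\mathcal{R}(PQ(I-P))}$ and $\overline{\mathcal{R}((I-P)QP)}$ are orthogonally complemented in $H$. For the harmonious matched pair, $H_1,H_4,H_5,H_6$ are mutually orthogonal orthogonally complemented submodules with $H=H_1+H_4+H_5+H_6$, so $U_{m(Q),Q}$ is unitary. *)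

theory Defs
  imports "HOL-Analysis.Analysis"
begin

definition cstar_algebra :: "(complex \<Rightarrow> 'a::{real_normed_algebra,banach} \<Rightarrow> 'a) \<Rightarrow> ('a \<Rightarrow> 'a) \<Rightarrow> bool" where
  "cstar_algebra sC st \<longleftrightarrow>
     (\<forall>r x. sC (complex_of_real r) x = scaleR r x) \<and>
     (\<forall>c d x. sC (c + d) x = sC c x + sC d x) \<and>
     (\<forall>c x y. sC c (x + y) = sC c x + sC c y) \<and>
     (\<forall>c d x. sC (c * d) x = sC c (sC d x)) \<and>
     (\<forall>c x y. sC c (x * y) = sC c x * y \<and> sC c (x * y) = x * sC c y) \<and>
     (\<forall>c x. norm (sC c x) = cmod c * norm x) \<and>
     (\<forall>x. st (st x) = x) \<and>
     (\<forall>x y. st (x + y) = st x + st y) \<and>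
     (\<forall>c x. st (sC c x) = sC (cnj c) (st x)) \<and>
     (\<forall>x y. st (x * y) = st y * st x) \<and>
     (\<forall>x. norm (st x * x) = (norm x)\<^sup>2)"

definition cpositive :: "('a::times \<Rightarrow> 'a) \<Rightarrow> 'a \<Rightarrow> bool" where
  "cpositive st a \<longleftrightarrow> (\<exists>b. a = st b * b)"

definition hilbert_cstar_module ::
  "(complex \<Rightarrow> 'a::{real_normed_algebra,banach} \<Rightarrow> 'a) \<Rightarrow> ('a \<Rightarrow> 'a) \<Rightarrow>
   (complex \<Rightarrow> 'h::banach \<Rightarrow> 'h) \<Rightarrow> ('h \<Rightarrow> 'a \<Rightarrow> 'h) \<Rightarrow> ('h \<Rightarrow> 'h \<Rightarrow> 'a) \<Rightarrow> bool" where
  "hilbert_cstar_module sC st sH act ip \<longleftrightarrow>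
     cstar_algebra sC st \<and>
     (\<forall>r x. sH (complex_of_real r) x = scaleR r x) \<and>
     (\<forall>c d x. sH (c + d) x = sH c x + sH d x) \<and>
     (\<forall>c x y. sH c (x + y) = sH c x + sH c y) \<and>
     (\<forall>c d x. sH (c * d) x = sH c (sH d x)) \<and>
     (\<forall>x y a. act (x + y) a = act x a + act y a) \<and>
     (\<forall>x a b. act x (a + b) = act x a + act x b) \<and>
     (\<forall>x a b. act x (a * b) = act (act x a) b) \<and>
     (\<forall>c x a. sH c (act x a) = act (sH c x) a \<and> sH c (act x a) = act x (sC c a)) \<and>
     (\<forall>x y z. ip x (y + z) = ip x y + ip x z) \<and>
     (\<forall>c x y. ip x (sH c y) = sC c (ip x y)) \<and>
     (\<forall>x y a. ip x (act y a) = ip x y * a) \<and>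
     (\<forall>x y. st (ip x y) = ip y x) \<and>
     (\<forall>x. cpositive st (ip x x)) \<and>
     (\<forall>x. ip x x = 0 \<longrightarrow> x = 0) \<and>
     (\<forall>x. norm x = sqrt (norm (ip x x)))"

definition adjointable :: "('h \<Rightarrow> 'h \<Rightarrow> 'a) \<Rightarrow> ('h \<Rightarrow> 'h) \<Rightarrow> bool" where
  "adjointable ip T \<longleftrightarrow> (\<exists>S. \<forall>x y. ip (T x) y = ip x (S y))"

definition adj :: "('h \<Rightarrow> 'h \<Rightarrow> 'a) \<Rightarrow> ('h \<Rightarrow> 'h) \<Rightarrow> ('h \<Rightarrow> 'h)" where
  "adj ip T = (SOME S. \<forall>x y. ip (T x) y = ip x (S y))"

definition idempotent_op :: "('h \<Rightarrow> 'h \<Rightarrow> 'a) \<Rightarrow> ('h \<Rightarrow> 'h) \<Rightarrow> bool" where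
  "idempotent_op ip Q \<longleftrightarrow> adjointable ip Q \<and> Q \<circ> Q = Q"

definition is_proj :: "('h \<Rightarrow> 'h \<Rightarrow> 'a) \<Rightarrow> ('h \<Rightarrow> 'h) \<Rightarrow> bool" where
  "is_proj ip P \<longleftrightarrow> idempotent_op ip P \<and> adj ip P = P"

definition ker_op :: "('h \<Rightarrow> 'h::zero) \<Rightarrow> 'h set" where
  "ker_op T = {x. T x = 0}"

definition proj_onto :: "('h \<Rightarrow> 'h \<Rightarrow> 'a) \<Rightarrow> 'h set \<Rightarrow> ('h \<Rightarrow> 'h)" where
  "proj_onto ip M = (THE P. is_proj ip P \<and> range P = M)"

definition ortho :: "('h \<Rightarrow> 'h \<Rightarrow> 'a::zero) \<Rightarrow> 'h set \<Rightarrow> 'h set" where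
  "ortho ip M = {y. \<forall>x\<in>M. ip x y = 0}"

definition orth_complemented :: "('h::plus \<Rightarrow> 'h \<Rightarrow> 'a::zero) \<Rightarrow> 'h set \<Rightarrow> bool" where
  "orth_complemented ip M \<longleftrightarrow> (\<forall>z. \<exists>x\<in>M. \<exists>y\<in>ortho ip M. z = x + y)"

definition op_pos :: "('h \<Rightarrow> 'h \<Rightarrow> 'a) \<Rightarrow> ('h \<Rightarrow> 'h) \<Rightarrow> bool" where
  "op_pos ip T \<longleftrightarrow> (\<exists>S. adjointable ip S \<and> T = adj ip S \<circ> S)"

definition op_sqrt :: "('h \<Rightarrow> 'h \<Rightarrow> 'a) \<Rightarrow> ('h \<Rightarrow> 'h) \<Rightarrow> ('h \<Rightarrow> 'h)" where
  "op_sqrt ip T = (THE S. adjointable ip S \<and> op_pos ip S \<and> S \<circ> S = T)"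

definition op_abs :: "('h \<Rightarrow> 'h \<Rightarrow> 'a) \<Rightarrow> ('h \<Rightarrow> 'h) \<Rightarrow> ('h \<Rightarrow> 'h)" where
  "op_abs ip T = op_sqrt ip (adj ip T \<circ> T)"

definition mp_inv :: "('h \<Rightarrow> 'h \<Rightarrow> 'a) \<Rightarrow> ('h \<Rightarrow> 'h) \<Rightarrow> ('h \<Rightarrow> 'h)" where
  "mp_inv ip T = (THE X. adjointable ip X \<and> T \<circ> X \<circ> T = T \<and> X \<circ> T \<circ> X = X \<and>
                         adj ip (T \<circ> X) = T \<circ> X \<and> adj ip (X \<circ> T) = X \<circ> T)"

definition op_inv :: "('h \<Rightarrow> 'h \<Rightarrow> 'a) \<Rightarrow> ('h \<Rightarrow> 'h) \<Rightarrow> ('h \<Rightarrow> 'h)" where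
  "op_inv ip T = (THE X. adjointable ip X \<and> X \<circ> T = id \<and> T \<circ> X = id)"

definition matched_proj :: "('h::real_vector \<Rightarrow> 'h \<Rightarrow> 'a) \<Rightarrow> ('h \<Rightarrow> 'h) \<Rightarrow> ('h \<Rightarrow> 'h)" where
  "matched_proj ip Q =
     (let R = op_abs ip (adj ip Q) in
       (\<lambda>x. scaleR (1/2) x) \<circ> (\<lambda>x. R x + adj ip Q x) \<circ> mp_inv ip R \<circ>
       op_inv ip (\<lambda>x. R x + x) \<circ> (\<lambda>x. R x + Q x))"

definition quasi_proj_pair :: "('h::real_vector \<Rightarrow> 'h \<Rightarrow> 'a) \<Rightarrow> ('h \<Rightarrow> 'h) \<Rightarrow> ('h \<Rightarrow> 'h) \<Rightarrow> bool" where
  "quasi_proj_pair ip P Q \<longleftrightarrow> is_proj ip P \<and> idempotent_op ip Q \<and>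
     adj ip Q = (\<lambda>x. 2 *\<^sub>R P x - x) \<circ> Q \<circ> (\<lambda>x. 2 *\<^sub>R P x - x)"

definition harmonious :: "('h::real_normed_vector \<Rightarrow> 'h \<Rightarrow> 'a::zero) \<Rightarrow> ('h \<Rightarrow> 'h) \<Rightarrow> ('h \<Rightarrow> 'h) \<Rightarrow> bool" where
  "harmonious ip P Q \<longleftrightarrow> quasi_proj_pair ip P Q \<and>
     orth_complemented ip (closure (range (P \<circ> Q \<circ> (\<lambda>x. x - P x)))) \<and>
     orth_complemented ip (closure (range ((\<lambda>x. x - P x) \<circ> Q \<circ> P)))"

section \<open>Operators on a complemented submodule, embedded as the corner E L(H) E\<close>

text \<open>Positivity in the corner algebra E L(H) E (= L(range E)).\<close>
definition corner_pos :: "('h \<Rightarrow> 'h \<Rightarrow> 'a) \<Rightarrow> ('h \<Rightarrow> 'h) \<Rightarrow> ('h \<Rightarrow> 'h) \<Rightarrow> bool" where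
  "corner_pos ip E T \<longleftrightarrow> (\<exists>S. adjointable ip S \<and> S = E \<circ> S \<circ> E \<and> T = adj ip S \<circ> S)"

definition corner_sqrt :: "('h \<Rightarrow> 'h \<Rightarrow> 'a) \<Rightarrow> ('h \<Rightarrow> 'h) \<Rightarrow> ('h \<Rightarrow> 'h) \<Rightarrow> ('h \<Rightarrow> 'h)" where
  "corner_sqrt ip E T = (THE S. adjointable ip S \<and> S = E \<circ> S \<circ> E \<and> corner_pos ip E S \<and> S \<circ> S = T)"

definition corner_inv :: "('h \<Rightarrow> 'h \<Rightarrow> 'a) \<Rightarrow> ('h \<Rightarrow> 'h) \<Rightarrow> ('h \<Rightarrow> 'h) \<Rightarrow> ('h \<Rightarrow> 'h)" where
  "corner_inv ip E T = (THE X. adjointable ip X \<and> X = E \<circ> X \<circ> E \<and> X \<circ> T = E \<and> T \<circ> X = E)"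

end

theory Submission
  imports Defs
begin

text \<open>
  Put \<open>d = Q - Q*\<close> and \<open>h = (1 - d\<^sup>2)\<^sup>1\<^sup>/\<^sup>2\<close>, a positive invertible operator commuting with \<open>Q\<close> and
  \<open>Q*\<close>. Then \<open>|Q*| = P\<^sub>R h\<close>, where \<open>P\<^sub>R = Q Q* h\<^sup>-\<^sup>2\<close> is the range projection, and the formula for the
  matched projection collapses to \<open>m(Q) = (1 + j) / 2\<close> with the symmetry \<open>j = h\<^sup>-\<^sup>1 (Q + Q* - 1)\<close>. Since
  \<open>d\<close> anticommutes with \<open>j\<close>, everything is a polynomial in \<open>h\<^sup>\<plusminus>\<^sup>1\<close>, \<open>j\<close>, \<open>d\<close>:
  \<open>Q = (1 + h j + d) / 2\<close>, \<open>P\<^sub>R = (1 + h\<^sup>-\<^sup>1 j + d j h\<^sup>-\<^sup>1) / 2\<close> and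
  \<open>P\<^sub>N = (1 - h\<^sup>-\<^sup>1 j + d j h\<^sup>-\<^sup>1) / 2\<close>. On \<open>H\<^sub>5\<close> this gives \<open>A = (h + 1) / 2\<close> and \<open>B = (1 + h\<^sup>-\<^sup>1) / 2\<close>, and
  \<open>U\<close> is the part on \<open>H\<^sub>5\<close> of the partial isometry \<open>u\<close> in the polar decomposition \<open>d = u |d|\<close>, which
  exists because \<open>H\<^sub>5\<close> and \<open>H\<^sub>6\<close>, spanning the closure of the range of \<open>d\<close>, are complemented.

  The square roots involved need the order structure of C*-algebras, including the positivity of
  \<open>x* x\<close>. It is obtained without spectral theory: a self-adjoint \<open>a\<close> is called positive if
  \<open>\<parallel>t 1 - a\<parallel> \<le> t\<close> for some real \<open>t\<close>, and the binomial series supplies square roots.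
\<close>

section \<open>The algebra of bounded operators\<close>

text \<open>The generators come from two relations that idempotency forces on the self-adjoint
  \<open>w = Q + Q* - 1\<close> and the skew \<open>d\<close>: they anticommute, and
  \<open>w^2 = 1 - d^2\<close>. Since \<open>-d^2 \<ge> 0\<close>, the root \<open>h \<ge> 1\<close>
  is invertible, so the symmetry \<open>j\<close> in \<open>w = h j\<close> costs nothing; for
  \<open>d\<close>, which may have a kernel, no such division is possible. Relative to
  \<open>m(Q)\<close>, \<open>h\<close> is diagonal and \<open>d\<close> off-diagonal. Hence the
  compression of \<open>Q\<close> to \<open>H5\<close> is \<open>(h + 1) / 2\<close>, which is where
  \<open>A\<close> comes from, and \<open>2 A - 1\<close> is simply \<open>h\<close>. A second
  obstacle is a circle: Cauchy-Schwarz in \<open>H\<close> needs positivity in the scalar algebra,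
  which may have no unit. That algebra acts on itself by left multiplication; there Cauchy-Schwarz
  is submultiplicativity of the norm, the adjointable operators form a unital C*-algebra, and its
  order then yields Cauchy-Schwarz in \<open>H\<close>. Finally, adjointable maps are bare
  functions, neither linear nor bounded by definition, and roots, inverses and projections are
  definite descriptions, so each one has to be shown unique before it can be computed.\<close>

typedef (overloaded) 'h endo = "UNIV :: ('h::real_normed_vector \<Rightarrow>\<^sub>L 'h) set"
  morphisms blinfun_of endo_of ..

setup_lifting type_definition_endo

text \<open>Only \<open>monoid_mult\<close> is claimed for the unit:
  \<open>real_normed_algebra_1\<close> would demand \<open>norm 1 = 1\<close>, which fails on the
  zero space.\<close>

instantiation endo :: (real_normed_vector) "{real_normed_algebra, monoid_mult}"
begin

lift_definition zero_endo :: "'a endo" is 0 .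
lift_definition one_endo :: "'a endo" is id_blinfun .
lift_definition plus_endo :: "'a endo \<Rightarrow> 'a endo \<Rightarrow> 'a endo" is "(+)" .
lift_definition minus_endo :: "'a endo \<Rightarrow> 'a endo \<Rightarrow> 'a endo" is "(-)" .
lift_definition uminus_endo :: "'a endo \<Rightarrow> 'a endo" is uminus .
lift_definition times_endo :: "'a endo \<Rightarrow> 'a endo \<Rightarrow> 'a endo" is "(o\<^sub>L)" .
lift_definition scaleR_endo :: "real \<Rightarrow> 'a endo \<Rightarrow> 'a endo" is scaleR .
lift_definition norm_endo :: "'a endo \<Rightarrow> real" is norm .

definition dist_endo :: "'a endo \<Rightarrow> 'a endo \<Rightarrow> real"
  where "dist_endo a b = norm (a - b)"

definition "(uniformity :: (('a endo) \<times> ('a endo)) filter) =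
    (INF e\<in>{0 <..}. principal {(x, y). dist x y < e})"

definition open_endo :: "'a endo set \<Rightarrow> bool"
  where "open_endo S = (\<forall>x\<in>S. \<forall>\<^sub>F (x', y) in uniformity. x' = x \<longrightarrow> y \<in> S)"

definition sgn_endo :: "'a endo \<Rightarrow> 'a endo"
  where "sgn_endo x = scaleR (inverse (norm x)) x"

instance
proof
  fix a b c :: "'a endo" and r s :: real
  show "a + b + c = a + (b + c)" by transfer (rule add.assoc)
  show "a + b = b + a" by transfer (rule add.commute)
  show "0 + a = a" by transfer simp
  show "- a + a = 0" by transfer simp
  show "a - b = a + - b" by transfer simp
  show "r *\<^sub>R (a + b) = r *\<^sub>R a + r *\<^sub>R b" by transfer (rule scaleR_add_right)
  show "(r + s) *\<^sub>R a = r *\<^sub>R a + s *\<^sub>R a" by transfer (rule scaleR_add_left)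
  show "r *\<^sub>R s *\<^sub>R a = (r * s) *\<^sub>R a" by transfer simp
  show "1 *\<^sub>R a = a" by transfer simp
  show "dist a b = norm (a - b)" by (rule dist_endo_def)
  show "sgn a = inverse (norm a) *\<^sub>R a" by (rule sgn_endo_def)
  show "(uniformity :: (('a endo) \<times> ('a endo)) filter) = (INF e\<in>{0 <..}. principal {(x, y). dist x y < e})"
    by (rule uniformity_endo_def)
  show "open U = (\<forall>x\<in>U. \<forall>\<^sub>F (x', y) in uniformity. x' = x \<longrightarrow> y \<in> U)" for U :: "'a endo set"
    by (rule open_endo_def)
  show "(norm a = 0) = (a = 0)" by transfer simp
  show "norm (a + b) \<le> norm a + norm b" by transfer (rule norm_triangle_ineq)
  show "norm (r *\<^sub>R a) = \<bar>r\<bar> * norm a" by transfer simp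
  show "a * b * c = a * (b * c)" by transfer (auto intro!: blinfun_eqI)
  show "1 * a = a" "a * 1 = a" by (transfer; auto intro!: blinfun_eqI)+
  show "(a + b) * c = a * c + b * c" "a * (b + c) = a * b + a * c"
    by (transfer; auto intro!: blinfun_eqI simp: blinfun.bilinear_simps)+
  show "r *\<^sub>R a * b = r *\<^sub>R (a * b)" "a * r *\<^sub>R b = r *\<^sub>R (a * b)"
    by (transfer; auto intro!: blinfun_eqI simp: blinfun.bilinear_simps)+
  show "norm (a * b) \<le> norm a * norm b" by transfer (rule norm_blinfun_compose)
qed

end

instance endo :: (banach) banach
proof
  fix X :: "nat \<Rightarrow> 'a endo"
  assume X: "Cauchy X"
  have "Cauchy (\<lambda>n. blinfun_of (X n))"
    using X unfolding Cauchy_def dist_norm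
    by (simp add: norm_endo.rep_eq minus_endo.rep_eq)
  then obtain L where L: "(\<lambda>n. blinfun_of (X n)) \<longlonglongrightarrow> L"
    by (auto simp: Cauchy_convergent_iff convergent_def)
  have "X \<longlonglongrightarrow> endo_of L"
    using L unfolding LIMSEQ_iff
    by (simp add: norm_endo.rep_eq minus_endo.rep_eq endo_of_inverse)
  then show "convergent X" by (auto simp: convergent_def)
qed

definition app :: "'h::real_normed_vector endo \<Rightarrow> 'h \<Rightarrow> 'h"
  where "app T x = blinfun_apply (blinfun_of T) x"

lemma app_simps [simp]:
  "app 0 x = 0" "app 1 x = x" "app (S + T) x = app S x + app T x"
  "app (S - T) x = app S x - app T x" "app (- T) x = - app T x"
  "app (S * T) x = app S (app T x)" "app (r *\<^sub>R T) x = r *\<^sub>R app T x"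
  by (simp_all add: app_def zero_endo.rep_eq one_endo.rep_eq plus_endo.rep_eq minus_endo.rep_eq
      uminus_endo.rep_eq times_endo.rep_eq scaleR_endo.rep_eq blinfun.bilinear_simps)

lemma bounded_bilinear_app: "bounded_bilinear app"
proof
  show "\<exists>K. \<forall>a (b::'a). norm (app a b) \<le> norm a * norm b * K"
    by (auto simp: app_def norm_endo.rep_eq intro!: exI[of _ 1] norm_blinfun)
qed (simp_all add: app_def plus_endo.rep_eq scaleR_endo.rep_eq blinfun.bilinear_simps)

interpretation app: bounded_bilinear app
  by (rule bounded_bilinear_app)

lemmas app_lin [simp] = app.zero_right app.add_right app.diff_right app.minus_right app.scaleR_right

lemma norm_app: "norm (app T x) \<le> norm T * norm x"
  by (simp add: app_def norm_endo.rep_eq norm_blinfun)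

lemma norm_endo_le: "0 \<le> b \<Longrightarrow> (\<And>x. norm (app T x) \<le> b * norm x) \<Longrightarrow> norm T \<le> b"
  by (simp add: app_def norm_endo.rep_eq norm_blinfun_bound)

lemma endo_eqI: "(\<And>x. app S x = app T x) \<Longrightarrow> S = T"
  by (metis app_def blinfun_eqI blinfun_of_inject)

lemma ex_endo: "bounded_linear f \<Longrightarrow> \<exists>T. app T = f"
  by (rule exI[of _ "endo_of (Blinfun f)"])
    (auto simp: app_def endo_of_inverse bounded_linear_Blinfun_apply)

section \<open>Positive elements of unital C*-algebras\<close>

definition sqrt_coeff :: "nat \<Rightarrow> real"
  where "sqrt_coeff n = (1/2 gchoose n) * (-1) ^ n"

lemma sqrt_coeff_0 [simp]: "sqrt_coeff 0 = 1"
  by (simp add: sqrt_coeff_def)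

text \<open>Equal signs turn a bound on partial sums into absolute summability, so that the series
  still converges on the boundary \<open>norm x = 1\<close>.\<close>

lemma sqrt_coeff_Suc_nonpos: "sqrt_coeff (Suc n) \<le> 0"
proof (induction n)
  case 0
  show ?case by (simp add: sqrt_coeff_def)
next
  case (Suc n)
  have "sqrt_coeff (Suc (Suc n)) = sqrt_coeff (Suc n) * ((real n + 1/2) / (real n + 2))"
  proof -
    have "(1/2 gchoose Suc (Suc n)) = - ((1/2 gchoose Suc n) * ((real n + 1/2) / (real n + 2)))"
      using gbinomial_mult_1[of "1/2::real" "Suc n"] by (simp add: field_simps)
    then show ?thesis unfolding sqrt_coeff_def by simp
  qed
  then show ?case using Suc by (simp add: mult_nonpos_nonneg divide_nonpos_pos)
qed

text \<open>Taking partial sums divides the generating function by \<open>1 - x\<close>. The sums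
  that include the leading 1 are therefore coefficients of \<open>(1 - x)^(-1/2)\<close>, which are
  nonnegative.\<close>

lemma sum_sqrt_coeff_Suc: "- 1 \<le> (\<Sum>n<N. sqrt_coeff (Suc n))"
proof -
  have pos: "0 \<le> (-1) ^ m * ((-1/2::real) gchoose m)" for m
  proof (induction m)
    case (Suc m)
    have "((-1/2::real) gchoose Suc m) = - (((-1/2) gchoose m) * ((real m + 1/2) / (real m + 1)))"
      using gbinomial_mult_1[of "-1/2::real" m] by (simp add: field_simps)
    then have "(-1) ^ Suc m * ((-1/2::real) gchoose Suc m)
        = ((-1) ^ m * ((-1/2) gchoose m)) * ((real m + 1/2) / (real m + 1))"
      by simp
    then show ?case using Suc by simp
  qed simp
  have "(\<Sum>n\<le>N. sqrt_coeff n) = (-1) ^ N * ((1/2 - 1) gchoose N)"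
    unfolding sqrt_coeff_def by (rule gbinomial_sum_lower_neg)
  moreover have "(\<Sum>n\<le>N. sqrt_coeff n) = 1 + (\<Sum>n<N. sqrt_coeff (Suc n))"
    using sum.lessThan_Suc_shift[of sqrt_coeff N] by (simp add: lessThan_Suc_atMost)
  ultimately show ?thesis using pos[of N] by simp
qed

text \<open>The bound 1 is exactly what makes the root \<open>r\<close> of \<open>1 - x\<close>
  satisfy \<open>norm (1 - r) \<le> 1\<close>, that is, makes it positive with witness 1.\<close>

lemma summable_abs_sqrt_coeff_Suc: "summable (\<lambda>n. \<bar>sqrt_coeff (Suc n)\<bar>)"
  and suminf_abs_sqrt_coeff_Suc: "(\<Sum>n. \<bar>sqrt_coeff (Suc n)\<bar>) \<le> 1"
proof -
  have *: "(\<Sum>n<N. \<bar>sqrt_coeff (Suc n)\<bar>) \<le> 1" for N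
  proof -
    have "(\<Sum>n<N. \<bar>sqrt_coeff (Suc n)\<bar>) = - (\<Sum>n<N. sqrt_coeff (Suc n))"
      using sqrt_coeff_Suc_nonpos by (simp add: sum_negf abs_of_nonpos)
    then show ?thesis using sum_sqrt_coeff_Suc[of N] by simp
  qed
  show s: "summable (\<lambda>n. \<bar>sqrt_coeff (Suc n)\<bar>)"
    by (rule bounded_imp_summable[where B=1]) (use * in \<open>auto simp: lessThan_Suc_atMost[symmetric] simp del: sum.lessThan_Suc\<close>)
  show "(\<Sum>n. \<bar>sqrt_coeff (Suc n)\<bar>) \<le> 1"
    by (rule suminf_le_const[OF s *])
qed

text \<open>By Vandermonde's identity the Cauchy square of the series is
  \<open>1 - x\<close>.\<close>

lemma sqrt_coeff_convolution:
  "(\<Sum>i\<le>n. sqrt_coeff i * sqrt_coeff (n - i)) = (if n = 0 then 1 else if n = 1 then -1 else 0)"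
proof -
  have "(\<Sum>i\<le>n. sqrt_coeff i * sqrt_coeff (n - i))
      = (\<Sum>i\<in>{0..n}. (1/2 gchoose i) * (1/2 gchoose (n - i))) * (-1) ^ n"
    unfolding sum_distrib_right atMost_atLeast0
    by (rule sum.cong) (auto simp: sqrt_coeff_def power_add[symmetric] mult.assoc mult.left_commute)
  also have "\<dots> = (1 gchoose n) * (-1) ^ n"
    by (simp add: gbinomial_Vandermonde)
  also have "\<dots> = (of_nat (1 choose n) :: real) * (-1) ^ n"
    by (metis binomial_gbinomial of_nat_1)
  also have "\<dots> = (if n = 0 then 1 else if n = 1 then -1 else 0)"
    by (cases n) auto
  finally show ?thesis .
qed

text \<open>The algebra is a closed subset \<open>B\<close> of its type because L(H) is only a part
  of all bounded operators. Scalars are real; the imaginary unit appears as the central skew element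
  \<open>ii\<close>, which serves to form unitaries and imaginary parts.\<close>

locale unital_cstar =
  fixes B :: "'b::{real_normed_algebra, monoid_mult, banach} set"
    and star :: "'b \<Rightarrow> 'b" and ii :: 'b
  assumes closed_B: "closed B"
    and one_B [simp]: "1 \<in> B"
    and add_B [simp]: "x \<in> B \<Longrightarrow> y \<in> B \<Longrightarrow> x + y \<in> B"
    and mult_B [simp]: "x \<in> B \<Longrightarrow> y \<in> B \<Longrightarrow> x * y \<in> B"
    and scaleR_B [simp]: "x \<in> B \<Longrightarrow> r *\<^sub>R x \<in> B"
    and star_B [simp]: "x \<in> B \<Longrightarrow> star x \<in> B"
    and star_star [simp]: "x \<in> B \<Longrightarrow> star (star x) = x"
    and star_add [simp]: "x \<in> B \<Longrightarrow> y \<in> B \<Longrightarrow> star (x + y) = star x + star y"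
    and star_mult [simp]: "x \<in> B \<Longrightarrow> y \<in> B \<Longrightarrow> star (x * y) = star y * star x"
    and star_scaleR [simp]: "x \<in> B \<Longrightarrow> star (r *\<^sub>R x) = r *\<^sub>R star x"
    and cstar_norm: "x \<in> B \<Longrightarrow> norm (star x * x) = (norm x)\<^sup>2"
    and ii_B [simp]: "ii \<in> B"
    and ii_sq: "ii * ii = - 1"
    and star_ii [simp]: "star ii = - ii"
    and ii_comm: "x \<in> B \<Longrightarrow> ii * x = x * ii"
begin

lemma minus_B [simp]: "x \<in> B \<Longrightarrow> - x \<in> B"
  using scaleR_B[of x "-1"] by simp

lemma diff_B [simp]: "x \<in> B \<Longrightarrow> y \<in> B \<Longrightarrow> x - y \<in> B"
  using add_B[of x "- y"] by simp

lemma zero_B [simp]: "0 \<in> B"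
  using scaleR_B[of 1 0] by simp

lemma star_minus [simp]: "x \<in> B \<Longrightarrow> star (- x) = - star x"
  using star_scaleR[of x "-1"] by simp

lemma star_diff [simp]: "x \<in> B \<Longrightarrow> y \<in> B \<Longrightarrow> star (x - y) = star x - star y"
  using star_add[of x "- y"] by simp

lemma star_0 [simp]: "star 0 = 0"
  using star_scaleR[of 1 0] by simp

lemma star_1 [simp]: "star 1 = 1"
  by (metis mult.left_neutral one_B star_B star_mult star_star)

lemma norm_one_le: "norm (1::'b) \<le> 1"
proof -
  have "norm (1::'b) = (norm (1::'b))\<^sup>2" using cstar_norm[of 1] by simp
  then have "norm (1::'b) * (norm (1::'b) - 1) = 0" by (simp add: power2_eq_square algebra_simps)
  then show ?thesis by auto
qed

lemma norm_scaleR_one_le: "norm (r *\<^sub>R (1::'b)) \<le> \<bar>r\<bar>"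
  using mult_left_mono[OF norm_one_le, of "\<bar>r\<bar>"] by simp

lemma norm_star: assumes "x \<in> B" shows "norm (star x) = norm x"
proof -
  have *: "norm y \<le> norm (star y)" if "y \<in> B" for y
  proof (cases "y = 0")
    case False
    have "norm y * norm y \<le> norm (star y) * norm y"
      using cstar_norm[OF that] norm_mult_ineq[of "star y" y] by (simp add: power2_eq_square)
    then show ?thesis using False by simp
  qed simp
  show ?thesis using *[OF assms] *[of "star x"] assms by (simp add: order_antisym)
qed

lemma tendsto_star:
  assumes "X \<longlonglongrightarrow> L" "\<And>n. X n \<in> B" "L \<in> B"
  shows "(\<lambda>n. star (X n)) \<longlonglongrightarrow> star L"
proof (rule Lim_transform_bound[where g="\<lambda>n. X n - L", THEN LIM_zero_cancel])
  show "\<forall>\<^sub>F n in sequentially. norm (star (X n) - star L) \<le> norm (X n - L)"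
    using assms norm_star by (metis (no_types, lifting) diff_B eventuallyI order_refl star_diff)
  show "(\<lambda>n. X n - L) \<longlonglongrightarrow> 0" using assms(1) by (rule LIM_zero)
qed

definition sa :: "'b \<Rightarrow> bool" where "sa x \<longleftrightarrow> x \<in> B \<and> star x = x"

lemma sa_B: "sa x \<Longrightarrow> x \<in> B" and sa_star: "sa x \<Longrightarrow> star x = x"
  by (auto simp: sa_def)

lemma sa_closed [simp]:
  "sa x \<Longrightarrow> sa y \<Longrightarrow> sa (x + y)" "sa x \<Longrightarrow> sa y \<Longrightarrow> sa (x - y)" "sa x \<Longrightarrow> sa (- x)"
  "sa x \<Longrightarrow> sa (r *\<^sub>R x)" "sa 1" "sa 0" "sa x \<Longrightarrow> sa (x * x)"
  by (auto simp: sa_def)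

lemma sa_mult: "sa x \<Longrightarrow> sa y \<Longrightarrow> x * y = y * x \<Longrightarrow> sa (x * y)"
  by (auto simp: sa_def)

lemma norm_sa_sq: "sa x \<Longrightarrow> norm (x * x) = (norm x)\<^sup>2"
  using cstar_norm[of x] by (simp add: sa_def)

lemma sa_square_eq_0: "sa x \<Longrightarrow> x * x = 0 \<Longrightarrow> x = 0"
  using norm_sa_sq[of x] by simp

lemma sa_cube_eq_0:
  assumes "sa x" "x * x * x = 0" shows "x = 0"
proof -
  have "(x * x) * (x * x) = 0" using assms(2) by (metis mult.assoc mult_zero_left)
  then show ?thesis using assms(1) by (metis sa_closed(7) sa_square_eq_0)
qed

lemma power_B: "x \<in> B \<Longrightarrow> x ^ n \<in> B"
  by (induction n) auto

lemma star_power: "x \<in> B \<Longrightarrow> star (x ^ n) = star x ^ n"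
  by (induction n) (auto simp: power_B power_commutes)

lemma norm_power_Suc_le: "norm (x ^ Suc n :: 'b) \<le> norm x ^ Suc n"
proof (induction n)
  case (Suc n)
  have "norm (x ^ Suc (Suc n)) \<le> norm x * norm (x ^ Suc n)"
    using norm_mult_ineq[of x "x ^ Suc n"] by simp
  also have "\<dots> \<le> norm x * norm x ^ Suc n" by (rule mult_left_mono[OF Suc]) simp
  finally show ?case by simp
qed simp

lemma norm_power_le: "norm (x ^ n :: 'b) \<le> norm x ^ n"
  using norm_power_Suc_le[of x] norm_one_le by (cases n) auto

text \<open>Commutation holds for every \<open>z\<close> that commutes with \<open>x\<close>. This
  bicommutant property is handed on to all roots and inverses and takes the place of a functional
  calculus.\<close>

lemma suminf_powers_props:
  assumes x: "sa x" and s: "summable (\<lambda>n. norm (c n *\<^sub>R x ^ n))"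
  defines "y \<equiv> (\<Sum>n. c n *\<^sub>R x ^ n)"
  shows "sa y" and "z * x = x * z \<Longrightarrow> z * y = y * z"
proof -
  have s': "summable (\<lambda>n. c n *\<^sub>R x ^ n)" using s by (rule summable_norm_cancel)
  define S where "S N = (\<Sum>n<N. c n *\<^sub>R x ^ n)" for N
  have SB: "S N \<in> B \<and> star (S N) = S N" for N
    unfolding S_def using x by (induction N) (auto simp: power_B star_power sa_def)
  have lim: "S \<longlonglongrightarrow> y"
    unfolding S_def y_def using summable_LIMSEQ[OF s'] .
  have yB: "y \<in> B"
    using closed_sequentially[OF closed_B, of S] SB lim by blast
  have "(\<lambda>n. star (S n)) \<longlonglongrightarrow> star y"
    by (rule tendsto_star[OF lim]) (use SB yB in auto)
  with lim SB have "star y = y" using LIMSEQ_unique by simp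
  with yB show "sa y" by (simp add: sa_def)
  assume z: "z * x = x * z"
  have pz: "z * x ^ n = x ^ n * z" for n
    by (induction n) (auto simp: z mult.assoc, metis z mult.assoc)
  have "z * y = (\<Sum>n. z * (c n *\<^sub>R x ^ n))" unfolding y_def by (rule suminf_mult[OF s', symmetric])
  also have "\<dots> = (\<Sum>n. (c n *\<^sub>R x ^ n) * z)" by (simp add: pz)
  also have "\<dots> = y * z" unfolding y_def by (rule suminf_mult2[OF s', symmetric])
  finally show "z * y = y * z" .
qed

lemma sqrt_one_minus:
  assumes x: "sa x" and nx: "norm x \<le> 1"
  obtains r where "sa r" "r * r = 1 - x" "norm (1 - r) \<le> 1" "\<And>z. z * x = x * z \<Longrightarrow> z * r = r * z"
proof -
  let ?a = "\<lambda>n. sqrt_coeff n *\<^sub>R x ^ n"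
  have le: "norm (?a (Suc n)) \<le> \<bar>sqrt_coeff (Suc n)\<bar>" for n
  proof -
    have "norm (x ^ Suc n) \<le> 1"
      using norm_power_Suc_le[of x n] power_le_one[OF norm_ge_zero nx, of "Suc n"] by linarith
    then show ?thesis by (simp add: mult_left_le del: power_Suc)
  qed
  have sS: "summable (\<lambda>n. norm (?a (Suc n)))"
    by (rule summable_comparison_test'[OF summable_abs_sqrt_coeff_Suc, of 0]) (use le in simp)
  then have s: "summable (\<lambda>n. norm (?a n))" using summable_Suc_iff[of "\<lambda>n. norm (?a n)"] by blast
  define r where "r = (\<Sum>n. ?a n)"
  have s': "summable ?a" using s by (rule summable_norm_cancel)
  have "1 - r = - (\<Sum>n. ?a (Suc n))"
    unfolding r_def using suminf_split_head[OF s'] by simp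
  then have "norm (1 - r) \<le> (\<Sum>n. norm (?a (Suc n)))"
    using summable_norm[OF sS] by simp
  also have "\<dots> \<le> (\<Sum>n. \<bar>sqrt_coeff (Suc n)\<bar>)"
    by (rule suminf_le[OF le sS summable_abs_sqrt_coeff_Suc])
  finally have n1: "norm (1 - r) \<le> 1" using suminf_abs_sqrt_coeff_Suc by linarith
  have "(\<lambda>k. \<Sum>i\<le>k. ?a i * ?a (k - i)) sums (r * r)"
    unfolding r_def by (rule Cauchy_product_sums[OF s s])
  moreover have "(\<Sum>i\<le>k. ?a i * ?a (k - i)) = (if k = 0 then 1 else if k = 1 then - x else 0)" for k
  proof -
    have "(\<Sum>i\<le>k. ?a i * ?a (k - i)) = (\<Sum>i\<le>k. (sqrt_coeff i * sqrt_coeff (k - i)) *\<^sub>R x ^ k)"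
      by (rule sum.cong) (auto simp: power_add[symmetric])
    also have "\<dots> = (\<Sum>i\<le>k. sqrt_coeff i * sqrt_coeff (k - i)) *\<^sub>R x ^ k"
      by (simp add: scaleR_sum_left)
    finally show ?thesis by (simp add: sqrt_coeff_convolution)
  qed
  ultimately have "(\<lambda>k. if k = 0 then 1 else if k = 1 then - x else 0) sums (r * r)" by simp
  moreover have "(\<lambda>k. if k = 0 then 1 else if k = 1 then - x else 0) sums (\<Sum>k\<in>{0,1::nat}. if k = 0 then 1 else if k = 1 then - x else 0)"
    by (rule sums_finite) auto
  ultimately have "r * r = 1 - x" using sums_unique2 by fastforce
  with suminf_powers_props[OF x s] n1 show ?thesis
    using that[of r] unfolding r_def by blast
qed

lemma inverse_one_minus:
  assumes x: "sa x" and nx: "norm x < 1"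
  obtains y where "sa y" "y * (1 - x) = 1" "(1 - x) * y = 1" "\<And>z. z * x = x * z \<Longrightarrow> z * y = y * z"
proof -
  have s: "summable (\<lambda>n. norm (1 *\<^sub>R x ^ n))"
    by (rule summable_comparison_test'[OF summable_geometric[of "norm x"], of 0])
      (use nx norm_power_le[of x] in auto)
  have s': "summable (\<lambda>n. x ^ n)" using summable_norm_cancel[OF s] by simp
  define y where "y = (\<Sum>n. 1 *\<^sub>R x ^ n)"
  have p: "sa y" "\<And>z. z * x = x * z \<Longrightarrow> z * y = y * z"
    using suminf_powers_props[OF x s] unfolding y_def by blast+
  have "y = 1 + (\<Sum>n. x * x ^ n)"
    unfolding y_def using suminf_split_head[OF s'] by simp
  also have "(\<Sum>n. x * x ^ n) = x * y"
    unfolding y_def using suminf_mult[OF s'] by simp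
  finally have e: "(1 - x) * y = 1" by (simp add: algebra_simps)
  moreover have "y * (1 - x) = 1" using e p(2)[of x] by (simp add: algebra_simps)
  ultimately show ?thesis using that p by blast
qed


text \<open>For self-adjoint elements this is equivalent to having a nonnegative spectrum; in this form
  positivity is obviously stable under sums.\<close>

definition pos :: "'b \<Rightarrow> bool"
  where "pos a \<longleftrightarrow> sa a \<and> (\<exists>t. norm (t *\<^sub>R 1 - a) \<le> t)"

section \<open>Order and norm of positive elements\<close>

lemma pos_sa: "pos a \<Longrightarrow> sa a" and pos_B: "pos a \<Longrightarrow> a \<in> B" and pos_star: "pos a \<Longrightarrow> star a = a"
  by (auto simp: pos_def sa_def)

lemma pos_add: assumes "pos a" "pos b" shows "pos (a + b)"
proof -
  obtain s t where st: "norm (s *\<^sub>R 1 - a) \<le> s" "norm (t *\<^sub>R 1 - b) \<le> t"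
    using assms by (auto simp: pos_def)
  have "(s + t) *\<^sub>R 1 - (a + b) = (s *\<^sub>R 1 - a) + (t *\<^sub>R 1 - b)" by (simp add: algebra_simps)
  then have "norm ((s + t) *\<^sub>R 1 - (a + b)) \<le> s + t"
    using st by (metis add_mono norm_triangle_le)
  then show ?thesis using assms unfolding pos_def by auto
qed

lemma pos_scaleR: assumes "pos a" "0 \<le> r" shows "pos (r *\<^sub>R a)"
proof -
  obtain t where t: "norm (t *\<^sub>R 1 - a) \<le> t" using assms by (auto simp: pos_def)
  have "(r * t) *\<^sub>R 1 - r *\<^sub>R a = r *\<^sub>R (t *\<^sub>R 1 - a)" by (simp add: algebra_simps)
  then have "norm ((r * t) *\<^sub>R 1 - r *\<^sub>R a) \<le> r * t"
    using t assms(2) by (simp add: mult_left_mono)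
  then show ?thesis using assms unfolding pos_def by auto
qed

lemma pos_diff_norm: assumes "sa a" "norm a \<le> t" shows "pos (t *\<^sub>R 1 - a)"
  using assms unfolding pos_def by (auto intro!: exI[of _ t])

lemma pos_1 [simp]: "pos 1" and pos_0 [simp]: "pos 0"
  using norm_one_le by (auto simp: pos_def intro: exI[of _ 1] exI[of _ 0])

lemma pos_scaleR_one: "0 \<le> r \<Longrightarrow> pos (r *\<^sub>R 1)"
  by (simp add: pos_scaleR)

lemma pos_sqrt_ex:
  assumes "pos a"
  obtains r where "pos r" "r * r = a" "\<And>z. z * a = a * z \<Longrightarrow> z * r = r * z"
proof -
  obtain t where t: "norm (t *\<^sub>R 1 - a) \<le> t" and a: "sa a" using assms by (auto simp: pos_def)
  have t0: "0 \<le> t" using t norm_ge_zero order_trans by blast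
  show ?thesis
  proof (cases "t = 0")
    case True
    then show ?thesis using t that[of 0] by simp
  next
    case False
    with t0 have tp: "0 < t" by simp
    \<comment> \<open>The witness \<open>t\<close> normalises \<open>a = t (1 - x)\<close> with
      \<open>norm x \<le> 1\<close>, the range of the binomial series.\<close>
    define x where "x = 1 - (1/t) *\<^sub>R a"
    have xe: "x = (1/t) *\<^sub>R (t *\<^sub>R 1 - a)" using tp by (simp add: x_def algebra_simps)
    have "norm x \<le> 1" unfolding xe using t tp by (simp add: divide_le_eq)
    moreover have "sa x" using a by (simp add: x_def)
    ultimately obtain r where r: "sa r" "r * r = 1 - x" "norm (1 - r) \<le> 1"
      "\<And>z. z * x = x * z \<Longrightarrow> z * r = r * z" using sqrt_one_minus by blast
    show ?thesis
    proof (rule that[of "sqrt t *\<^sub>R r"])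
      have "sqrt t *\<^sub>R 1 - sqrt t *\<^sub>R r = sqrt t *\<^sub>R (1 - r)" by (simp add: algebra_simps)
      then have "norm (sqrt t *\<^sub>R 1 - sqrt t *\<^sub>R r) \<le> sqrt t"
        using r(3) tp by (simp add: mult_left_le)
      then show "pos (sqrt t *\<^sub>R r)" using r(1) by (auto simp: pos_def)
      show "(sqrt t *\<^sub>R r) * (sqrt t *\<^sub>R r) = a" using r(2) tp by (simp add: x_def)
      show "z * (sqrt t *\<^sub>R r) = (sqrt t *\<^sub>R r) * z" if "z * a = a * z" for z
        using r(4)[of z] that by (simp add: x_def algebra_simps)
    qed
  qed
qed

text \<open>The element \<open>r + i s\<close> is unitary, and \<open>s\<close> is its imaginary part.\<close>

lemma norm_le_one_if_squares:
  assumes r: "sa r" and s: "sa s" and rs: "r * s = s * r" and one: "r * r + s * s = 1"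
  shows "norm s \<le> 1"
proof -
  note B = sa_B[OF r] sa_B[OF s]
  define v where "v = r + ii * s"
  have vB: "v \<in> B" using B by (simp add: v_def)
  have sv: "star v = r - ii * s"
    using B r s ii_comm[of s] by (simp add: v_def sa_star)
  have iis: "ii * s * (ii * s) = - (s * s)"
  proof -
    have "ii * s * (ii * s) = ii * ii * (s * s)" using ii_comm[of s] B by (metis mult.assoc)
    then show ?thesis by (simp add: ii_sq)
  qed
  have "star v * v = r * r + (r * (ii * s) - ii * s * r) + s * s"
    unfolding sv unfolding v_def using iis by (simp add: algebra_simps)
  also have "r * (ii * s) = ii * s * r"
    using ii_comm[of r] B rs by (metis mult.assoc)
  finally have "star v * v = 1" using one by simp
  then have "(norm v)\<^sup>2 \<le> 1" using cstar_norm[OF vB] norm_one_le by simp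
  then have nv: "norm v \<le> 1" by (simp add: power_le_one_iff)
  have "v - star v = 2 *\<^sub>R (ii * s)" unfolding sv unfolding v_def by (simp add: scaleR_2)
  then have "ii * (v - star v) = 2 *\<^sub>R (ii * ii * s)" by (simp add: mult.assoc)
  then have "2 *\<^sub>R s = - (ii * (v - star v))" by (simp add: ii_sq)
  then have "2 * norm s = norm (ii * (v - star v))" by (metis norm_minus_cancel norm_scaleR abs_numeral)
  also have "\<dots> \<le> norm ii * norm (v - star v)" by (rule norm_mult_ineq)
  also have "norm (v - star v) \<le> 2"
    using nv norm_star[OF vB] norm_triangle_ineq4[of v "star v"] by simp
  also have "norm ii \<le> 1"
  proof -
    have "(norm ii)\<^sup>2 \<le> 1" using cstar_norm[of ii] norm_one_le ii_sq by simp
    then show ?thesis by (simp add: power_le_one_iff)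
  qed
  finally show ?thesis by (simp add: mult_left_mono)
qed

text \<open>The root \<open>s\<close> of \<open>1 - r * r\<close> commutes with \<open>r\<close>, so
  \<open>norm_le_one_if_squares\<close> bounds it. Positivity of squares follows from this by
  scaling.\<close>

lemma norm_one_minus_square_le:
  assumes r: "sa r" and n: "norm r \<le> 1" shows "norm (1 - r * r) \<le> 1"
proof -
  have "norm (r * r) \<le> 1" using norm_sa_sq[OF r] n by (simp add: power_le_one)
  then obtain s where s: "sa s" "s * s = 1 - r * r" "\<And>z. z * (r * r) = (r * r) * z \<Longrightarrow> z * s = s * z"
    using sqrt_one_minus[OF sa_closed(7)[OF r]] by blast
  have "norm s \<le> 1"
  proof (rule norm_le_one_if_squares[OF r s(1)])
    show "r * s = s * r" by (rule s(3)) (simp add: mult.assoc)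
    show "r * r + s * s = 1" by (simp add: s(2))
  qed
  then show ?thesis using norm_sa_sq[OF s(1)] s(2) by (simp add: power_le_one)
qed

lemma norm_scaleR_one_minus_square_le:
  assumes r: "sa r" and n: "norm (r * r) \<le> t" shows "norm (t *\<^sub>R 1 - r * r) \<le> t"
proof (cases "t = 0")
  case True
  then show ?thesis using n by simp
next
  case False
  then have t: "0 < t" using n norm_ge_zero[of "r * r"] by linarith
  define x where "x = (1 / sqrt t) *\<^sub>R r"
  have "(norm r)\<^sup>2 \<le> t" using n norm_sa_sq[OF r] by simp
  then have "norm r \<le> sqrt t" by (rule real_le_rsqrt)
  then have "norm x \<le> 1" using t by (simp add: x_def divide_le_eq)
  then have "norm (1 - x * x) \<le> 1" using norm_one_minus_square_le[of x] r by (simp add: x_def)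
  moreover have "t *\<^sub>R 1 - r * r = t *\<^sub>R (1 - x * x)" using t by (simp add: x_def algebra_simps)
  ultimately show ?thesis using t by (simp add: mult_left_le)
qed

lemma pos_square: "sa r \<Longrightarrow> pos (r * r)"
  unfolding pos_def using norm_scaleR_one_minus_square_le by auto

text \<open>Replaces the unspecified witness in \<open>pos\<close> by any bound of the norm:
  \<open>a\<close> is a square, and squares satisfy the inequality for all such
  \<open>t\<close>.\<close>

lemma pos_norm_diff_le:
  assumes "pos a" "norm a \<le> t" shows "norm (t *\<^sub>R 1 - a) \<le> t"
  using assms by (metis pos_sqrt_ex pos_sa norm_scaleR_one_minus_square_le)

text \<open>The bicommutant property makes the roots of \<open>a\<close> and \<open>b\<close>
  commute, so \<open>a * b\<close> is the square of their product.\<close>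

lemma pos_mult:
  assumes a: "pos a" and b: "pos b" and ab: "a * b = b * a" shows "pos (a * b)"
proof -
  obtain r where r: "pos r" "r * r = a" "\<And>z. z * a = a * z \<Longrightarrow> z * r = r * z"
    using pos_sqrt_ex[OF a] by metis
  obtain s where s: "pos s" "s * s = b" "\<And>z. z * b = b * z \<Longrightarrow> z * s = s * z"
    using pos_sqrt_ex[OF b] by metis
  have "b * r = r * b" using r(3)[of b] ab by simp
  then have rs: "r * s = s * r" using s(3)[of r] by simp
  have "a * b = (r * s) * (r * s)" using rs r(2) s(2) by (metis mult.assoc)
  moreover have "sa (r * s)" using sa_mult[OF pos_sa pos_sa rs] r s by blast
  ultimately show ?thesis using pos_square by metis
qed

text \<open>After scaling, \<open>c\<close> and \<open>1 - c\<close> have commuting roots whose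
  squares add up to 1.\<close>

lemma pos_norm_le:
  assumes a: "pos a" and sa: "pos (s *\<^sub>R 1 - a)" and s: "0 \<le> s" shows "norm a \<le> s"
proof -
  \<comment> \<open>A strictly larger \<open>t\<close> permits division even if
    \<open>s = 0\<close>.\<close>
  have *: "norm a \<le> t" if t: "s < t" for t
  proof -
    have tp: "0 < t" using s t by simp
    have "pos ((t - s) *\<^sub>R 1 + (s *\<^sub>R 1 - a))" using pos_add[OF _ sa] pos_scaleR_one t by simp
    then have ta: "pos (t *\<^sub>R 1 - a)" by (simp add: algebra_simps)
    define c where "c = (1/t) *\<^sub>R a"
    have c: "pos c" using pos_scaleR[OF a] tp by (simp add: c_def)
    have "1 - c = (1/t) *\<^sub>R (t *\<^sub>R 1 - a)" using tp by (simp add: c_def algebra_simps)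
    then have c1: "pos (1 - c)" using pos_scaleR[OF ta] tp by simp
    obtain p where p: "pos p" "p * p = c" "\<And>z. z * c = c * z \<Longrightarrow> z * p = p * z"
      using pos_sqrt_ex[OF c] by metis
    obtain r where r: "pos r" "r * r = 1 - c" "\<And>z. z * (1 - c) = (1 - c) * z \<Longrightarrow> z * r = r * z"
      using pos_sqrt_ex[OF c1] by metis
    have "p * c = c * p" using p(2) by (metis mult.assoc)
    then have pr: "p * r = r * p" using r(3)[of p] by (simp add: algebra_simps)
    have "norm p \<le> 1"
      by (rule norm_le_one_if_squares[of r p]) (use p(1,2) r(1,2) pr pos_sa in auto)
    then have "norm c \<le> 1" using norm_sa_sq[OF pos_sa[OF p(1)]] p(2) by (simp add: power_le_one)
    then show ?thesis using tp by (simp add: c_def divide_le_eq)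
  qed
  show ?thesis
    by (rule field_le_epsilon) (rule *, simp)
qed

lemma pos_norm_mono:
  assumes "pos a" "pos b" "pos (b - a)" shows "norm a \<le> norm b"
proof (rule pos_norm_le[OF assms(1)])
  have "pos ((norm b *\<^sub>R 1 - b) + (b - a))"
    using pos_add[OF pos_diff_norm[OF pos_sa[OF assms(2)] order_refl] assms(3)] .
  then show "pos (norm b *\<^sub>R 1 - a)" by simp
qed simp

lemma pos_antisym: assumes "pos a" "pos (- a)" shows "a = 0"
  using pos_norm_le[of a 0] assms by simp

text \<open>\<open>r\<close> and \<open>s\<close> are not known to commute, so both are compared
  with the root \<open>t\<close> built by the series, which commutes with whatever commutes with
  \<open>s * s\<close>. For \<open>n = q - t\<close> the positive elements \<open>n * n * q\<close>
  and \<open>n * n * t\<close> add up to 0, hence both vanish and \<open>n\<close> cubed is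
  0.\<close>

lemma pos_sqrt_unique:
  assumes r: "pos r" and s: "pos s" and rs: "r * r = s * s" shows "r = s"
proof -
  have eq: "q = t" if q: "pos q" and t: "pos t" "q * q = t * t"
      "\<And>z. z * (t * t) = (t * t) * z \<Longrightarrow> z * t = t * z" for q t
  proof -
    have qt: "q * t = t * q" by (rule t(3)) (simp add: mult.assoc flip: t(2))
    define n where "n = q - t"
    have n: "sa n" using q t(1) pos_sa by (simp add: n_def)
    have nn: "pos (n * n)" by (rule pos_square[OF n])
    have nq: "n * q = q * n" and nt: "n * t = t * n" using qt by (auto simp: n_def algebra_simps)
    have "n * n * q = q * (n * n)" "n * n * t = t * (n * n)"
      using nq nt by (metis mult.assoc)+
    then have 1: "pos (n * n * q)" "pos (n * n * t)"
      using pos_mult[OF nn q] pos_mult[OF nn t(1)] by blast+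
    have "n * (q + t) = 0" using t(2) qt by (simp add: n_def algebra_simps)
    then have "n * n * q + n * n * t = 0" by (simp add: mult.assoc flip: distrib_left)
    then have 2: "n * n * t = - (n * n * q)" by (metis add.commute eq_neg_iff_add_eq_0)
    have 3: "n * n * q = 0" by (rule pos_antisym) (use 1 2 in auto)
    with 2 have "n * n * (q - t) = 0" unfolding right_diff_distrib by simp
    then have "n = 0" using sa_cube_eq_0[OF n] by (simp add: n_def)
    then show ?thesis by (simp add: n_def)
  qed
  obtain t where t: "pos t" "t * t = s * s" "\<And>z. z * (s * s) = (s * s) * z \<Longrightarrow> z * t = t * z"
    using pos_sqrt_ex[OF pos_square[OF pos_sa[OF s]]] by metis
  have tz: "z * t = t * z" if "z * (t * t) = (t * t) * z" for z
    using t(3)[of z] that by (simp add: t(2))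
  have "r = t" by (rule eq[OF r t(1)]) (simp add: rs t(2), rule tz)
  moreover have "s = t" by (rule eq[OF s t(1)]) (simp add: t(2), rule tz)
  ultimately show ?thesis by simp
qed

text \<open>A norm estimate replaces the comparison of the spectra of \<open>star y * y\<close> and
  \<open>y * star y\<close>. Writing \<open>star y * y = - t k\<close>, the contraction
  \<open>1 - y * star y / t\<close> sends \<open>y\<close> to \<open>y (1 + k)\<close>, which cannot
  be longer than \<open>y\<close> unless \<open>k = 0\<close>.\<close>

lemma cstar_neg_pos_eq_0:
  assumes y: "y \<in> B" and neg: "pos (- (star y * y))" and yy: "pos (y * star y)"
  shows "y = 0"
proof -
  define t where "t = norm (y * star y) + 1"
  have tp: "0 < t" by (simp add: t_def add_nonneg_pos)
  define k where "k = (1/t) *\<^sub>R (- (star y * y))"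
  have k: "pos k" using pos_scaleR[OF neg] tp by (simp add: k_def)
  have yyk: "star y * y = - (t *\<^sub>R k)" using tp by (simp add: k_def)
  have "norm (t *\<^sub>R 1 - y * star y) \<le> t" by (rule pos_norm_diff_le[OF yy]) (simp add: t_def)
  then have "norm ((1/t) *\<^sub>R (t *\<^sub>R 1 - y * star y)) \<le> 1" using tp by (simp add: divide_le_eq)
  then have le1: "norm (((1/t) *\<^sub>R (t *\<^sub>R 1 - y * star y)) * y) \<le> norm y"
    using norm_mult_ineq[of "(1/t) *\<^sub>R (t *\<^sub>R 1 - y * star y)" y]
    by (metis mult_left_le_one_le norm_ge_zero order_trans)
  have "((1/t) *\<^sub>R (t *\<^sub>R 1 - y * star y)) * y = y * (1 + k)"
    using tp by (simp add: k_def algebra_simps)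
  with le1 have le2: "(norm (y * (1 + k)))\<^sup>2 \<le> (norm y)\<^sup>2"
    by (metis norm_ge_zero power_mono)
  have "star (y * (1 + k)) * (y * (1 + k)) = (1 + k) * (star y * y) * (1 + k)"
    using y k by (simp add: pos_B pos_star mult.assoc)
  also have "\<dots> = - (t *\<^sub>R ((1 + k) * k * (1 + k)))" by (simp add: yyk)
  finally have "t * norm ((1 + k) * k * (1 + k)) \<le> t * norm k"
    using le2 cstar_norm[of "y * (1 + k)"] cstar_norm[of y] y k tp
    by (simp add: pos_B yyk)
  then have le3: "norm (k + k * k + (k * k + k * k * k)) \<le> norm k"
    using tp by (simp add: algebra_simps)
  have kk: "pos (k * k)" using pos_square pos_sa k by blast
  have kkk: "pos (k * k * k)" by (rule pos_mult[OF kk k]) (simp add: mult.assoc)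
  have "norm (k + k * k) \<le> norm (k + k * k + (k * k + k * k * k))"
    by (rule pos_norm_mono) (use k kk kkk pos_add in auto)
  with le3 have le4: "norm (k + k * k) \<le> norm k" by simp
  \<comment> \<open>Completing the square: \<open>norm (k + k * k) \<le> norm k\<close> bounds the
    squared norm of \<open>m\<close> by \<open>norm k + 1/4\<close>, while
    \<open>norm m \<ge> norm k + 1/2\<close> as soon as \<open>norm m \<ge> 1/2\<close>. Together
    these force \<open>norm k = 0\<close>.\<close>
  define m where "m = k + (1/2) *\<^sub>R 1"
  have m: "pos m" unfolding m_def using k pos_add pos_scaleR_one by simp
  have "m * m = ((1/2) *\<^sub>R k + (1/2) *\<^sub>R k) + k * k + (1/4) *\<^sub>R 1"
    by (simp add: m_def algebra_simps)
  also have "(1/2) *\<^sub>R k + (1/2) *\<^sub>R k = k" by (simp flip: scaleR_left.add)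
  finally have "m * m = (k + k * k) + (1/4) *\<^sub>R 1" .
  then have "norm (m * m) \<le> norm (k + k * k) + norm ((1/4) *\<^sub>R (1::'b))"
    using norm_triangle_ineq by metis
  also have "\<dots> \<le> norm k + 1/4" using le4 norm_scaleR_one_le[of "1/4"] by simp
  finally have mm: "(norm m)\<^sup>2 \<le> norm k + 1/4" using norm_sa_sq[OF pos_sa[OF m]] by simp
  have km: "norm k \<le> norm m - 1/2" if "norm m \<ge> 1/2"
  proof (rule pos_norm_le[OF k])
    have "pos (norm m *\<^sub>R 1 - m)" using pos_diff_norm m pos_sa by blast
    then show "pos ((norm m - 1/2) *\<^sub>R 1 - k)" by (simp add: m_def algebra_simps)
  qed (use that in simp)
  have "k = 0"
  proof (cases "norm m \<ge> 1/2")
    case True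
    then have "(norm k + 1/2)\<^sup>2 \<le> (norm m)\<^sup>2" using km by (intro power_mono) auto
    then have "(norm k)\<^sup>2 \<le> 0" using mm by (simp add: power2_eq_square algebra_simps)
    then show ?thesis by simp
  next
    case False
    have "pos ((1/2) *\<^sub>R 1 - m)" using pos_diff_norm[of m "1/2"] m pos_sa False by simp
    then have "pos (- k)" by (simp add: m_def)
    then show ?thesis using pos_antisym k by blast
  qed
  then show ?thesis using cstar_norm[OF y] yyk by simp
qed

text \<open>With \<open>t = x* x\<close> and \<open>n = |t| - t\<close>, the element \<open>y = x n\<close> satisfies \<open>y* y = - |t| n\<^sup>2 \<le> 0\<close>,
  while \<open>y* y + y y* \<ge> 0\<close> always holds; hence \<open>y = 0\<close> and then \<open>n = 0\<close>.\<close>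

theorem pos_star_mult: assumes x: "x \<in> B" shows "pos (star x * x)"
proof -
  define t where "t = star x * x"
  have t: "sa t" using x by (simp add: t_def sa_def)
  obtain a where a: "pos a" "a * a = t * t" "\<And>z. z * (t * t) = t * t * z \<Longrightarrow> z * a = a * z"
    using pos_sqrt_ex[OF pos_square[OF t]] by metis
  have ta: "t * a = a * t" using a(3)[of t] by (simp add: mult.assoc)
  define n where "n = a - t"
  have n: "sa n" using a(1) t pos_sa by (simp add: n_def)
  have tn: "t * n = - (a * n)" using ta a(2) by (simp add: n_def algebra_simps)
  have an: "a * n = n * a" using ta by (simp add: n_def algebra_simps)
  have tn': "t * n = n * t" using ta by (simp add: n_def algebra_simps)
  define y where "y = x * n"
  have y: "y \<in> B" using x n sa_B by (simp add: y_def)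
  have sy: "star y * y = n * t * n" using x n by (simp add: y_def t_def sa_B sa_star mult.assoc)
  also have "\<dots> = - (a * (n * n))" using tn tn' by (metis mult.assoc mult_minus_left)
  finally have sy': "- (star y * y) = a * (n * n)" by simp
  have neg: "pos (- (star y * y))"
    unfolding sy' by (rule pos_mult[OF a(1) pos_square[OF n]]) (metis an mult.assoc)
  define y1 where "y1 = (1/2) *\<^sub>R (y + star y)"
  define y2 where "y2 = (1/2) *\<^sub>R (ii * (y - star y))"
  have y1: "sa y1" using y by (simp add: y1_def sa_def add.commute)
  have y2: "sa y2" using y ii_comm[of y] ii_comm[of "star y"]
    by (simp add: y2_def sa_def algebra_simps)
  have "ii * (y - star y) * (ii * (y - star y)) = ii * ii * ((y - star y) * (y - star y))"
    using ii_comm[of "y - star y"] y by (metis diff_B mult.assoc star_B)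
  also have "\<dots> = - ((y - star y) * (y - star y))" by (simp add: ii_sq)
  finally have "y2 * y2 = - ((1/4) *\<^sub>R ((y - star y) * (y - star y)))" by (simp add: y2_def)
  moreover have "y1 * y1 = (1/4) *\<^sub>R ((y + star y) * (y + star y))" by (simp add: y1_def)
  ultimately have "y1 * y1 + y2 * y2 = (1/4) *\<^sub>R ((y + star y) * (y + star y) - (y - star y) * (y - star y))"
    by (simp add: scaleR_diff_right)
  also have "(y + star y) * (y + star y) - (y - star y) * (y - star y) = 2 *\<^sub>R (star y * y + y * star y)"
    by (simp add: algebra_simps scaleR_2)
  finally have "y * star y = 2 *\<^sub>R (y1 * y1 + y2 * y2) + - (star y * y)"
    by (simp add: algebra_simps)
  then have "pos (y * star y)"
    using pos_add[OF pos_scaleR[OF pos_add[OF pos_square[OF y1] pos_square[OF y2]]] neg, of 2] by simp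
  then have "y = 0" by (rule cstar_neg_pos_eq_0[OF y neg])
  then have "a * (n * n) = 0" using sy' by simp
  then have 0: "a * n * n = 0" by (simp add: mult.assoc)
  have "n * n * n = a * n * n - t * n * n" by (simp add: n_def algebra_simps)
  also have "\<dots> = 0" using 0 tn by simp
  finally have "n = 0" by (rule sa_cube_eq_0[OF n])
  then show ?thesis using a(1) by (simp add: n_def t_def)
qed

lemma pos_sandwich: assumes "pos a" "x \<in> B" shows "pos (star x * a * x)"
proof -
  obtain r where r: "pos r" "r * r = a" using pos_sqrt_ex[OF assms(1)] by metis
  have "star (r * x) * (r * x) = star x * a * x"
    using r assms by (auto simp: pos_B pos_star mult.assoc)
  then show ?thesis using pos_star_mult[of "r * x"] assms r pos_B by simp
qed

text \<open>Divided by \<open>u = norm (a - e) + e\<close>, the element \<open>a\<close> lies at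
  distance less than 1 from the unit, so the Neumann series inverts it. The inverse is positive
  because it equals \<open>star y * a * y\<close>.\<close>

lemma pos_inverse_ex:
  assumes a: "pos a" and e: "0 < e" and b: "pos (a - e *\<^sub>R 1)"
  obtains y where "pos y" "y * a = 1" "a * y = 1" "\<And>z. z * a = a * z \<Longrightarrow> z * y = y * z"
proof -
  define t where "t = norm (a - e *\<^sub>R 1)"
  define u where "u = t + e"
  have u: "0 < u" using e by (simp add: u_def t_def add_nonneg_pos)
  define x where "x = 1 - (1/u) *\<^sub>R a"
  have x: "sa x" using a by (simp add: x_def pos_sa)
  have xe: "x = (1/u) *\<^sub>R (t *\<^sub>R 1 - (a - e *\<^sub>R 1))"
  proof -
    have "t *\<^sub>R 1 - (a - e *\<^sub>R 1) = u *\<^sub>R 1 - a" by (simp add: u_def algebra_simps)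
    then show ?thesis using u by (simp only:) (simp add: x_def scaleR_diff_right)
  qed
  have "norm (t *\<^sub>R 1 - (a - e *\<^sub>R 1)) \<le> t" by (rule pos_norm_diff_le[OF b]) (simp add: t_def)
  then have "norm x < 1" unfolding xe using u e by (simp add: divide_less_eq u_def)
  then obtain v where v: "sa v" "v * (1 - x) = 1" "(1 - x) * v = 1" "\<And>z. z * x = x * z \<Longrightarrow> z * v = v * z"
    using inverse_one_minus[OF x] by metis
  define y where "y = (1/u) *\<^sub>R v"
  have ya: "y * a = 1" "a * y = 1" using v(2,3) u by (simp_all add: y_def x_def)
  have ys: "sa y" using v by (simp add: y_def)
  have "pos (star y * a * y)" by (rule pos_sandwich[OF a sa_B[OF ys]])
  then have "pos y" using ya ys by (simp add: sa_star)
  moreover have "z * y = y * z" if "z * a = a * z" for z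
    using v(4)[of z] that by (simp add: x_def y_def algebra_simps)
  ultimately show ?thesis using that ya by blast
qed

end

section \<open>Adjointable operators\<close>

text \<open>Banach-Steinhaus through Baire's theorem; it will supply the boundedness of adjointable
  maps.\<close>

lemma uniform_boundedness:
  fixes f :: "'i \<Rightarrow> 'h::banach \<Rightarrow> 'a::real_normed_vector"
  assumes bl: "\<And>i. i \<in> I \<Longrightarrow> bounded_linear (f i)"
    and pw: "\<And>x. \<exists>M. \<forall>i\<in>I. norm (f i x) \<le> M"
  obtains M where "0 \<le> M" "\<And>i x. i \<in> I \<Longrightarrow> norm (f i x) \<le> M * norm x"
proof -
  define F where "F n = (\<Inter>i\<in>I. {x. norm (f i x) \<le> real n})" for n :: nat
  have clF: "closed (F n)" for n
    unfolding F_def using bl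
    by (intro closed_INT ballI closed_Collect_le continuous_intros)
      (auto intro: bounded_linear.continuous_on)
  have "x \<in> \<Union> (range F)" for x
  proof -
    obtain M where "\<forall>i\<in>I. norm (f i x) \<le> M" using pw by blast
    moreover obtain n :: nat where "M \<le> real n" using real_arch_simple by blast
    ultimately have "x \<in> F n" by (force simp: F_def)
    then show ?thesis by blast
  qed
  then have U: "\<Union> (range F) = UNIV" by blast
  have "\<exists>n. interior (F n) \<noteq> {}"
  proof (rule ccontr)
    assume "\<not> ?thesis"
    then have "euclidean interior_of \<Union> (range F) = {}"
      using clF by (intro Baire_category_alt) (auto simp: completely_metrizable_space_euclidean)
    then show False using U by simp
  qed
  then obtain n x0 where "x0 \<in> interior (F n)" by blast
  then obtain e where e: "0 < e" "cball x0 e \<subseteq> F n" by (meson mem_interior_cball)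
  show ?thesis
  \<comment> \<open>A vector of norm at most \<open>e\<close> is a difference of two points of the
    ball in \<open>F n\<close>, which accounts for the factor 2.\<close>
  proof (rule that[of "2 * real n / e"])
    show "0 \<le> 2 * real n / e" using e by simp
    fix i x assume i: "i \<in> I"
    interpret bounded_linear "f i" by (rule bl[OF i])
    show "norm (f i x) \<le> 2 * real n / e * norm x"
    proof (cases "x = 0")
      case False
      define y where "y = (e / norm x) *\<^sub>R x"
      have "norm y \<le> e" using False e by (simp add: y_def)
      then have "x0 + y \<in> cball x0 e" "x0 \<in> cball x0 e" using e by (auto simp: dist_norm)
      then have "x0 + y \<in> F n" "x0 \<in> F n" using e(2) by blast+
      then have "norm (f i (x0 + y)) \<le> n" "norm (f i x0) \<le> n" using i by (auto simp: F_def)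
      moreover have "f i y = f i (x0 + y) - f i x0" by (simp add: add)
      ultimately have "norm (f i y) \<le> 2 * n"
        using norm_triangle_ineq4[of "f i (x0 + y)" "f i x0"] by simp
      then show ?thesis using False e by (simp add: y_def scaleR field_simps)
    qed (simp add: zero)
  qed
qed

text \<open>The part of the structure shared by a Hilbert module and by a C*-algebra regarded as a
  module over itself. Cauchy-Schwarz is assumed, since its proof differs in the two cases;
  \<open>im\<close> and \<open>im_A\<close> are multiplication by the imaginary unit.\<close>

locale ip_space =
  fixes st :: "'a::real_normed_vector \<Rightarrow> 'a" and im_A :: "'a \<Rightarrow> 'a"
    and ip :: "'h::banach \<Rightarrow> 'h \<Rightarrow> 'a" and im :: "'h \<Rightarrow> 'h"
  assumes ip_add: "ip x (y + z) = ip x y + ip x z"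
    and ip_scaleR: "ip x (r *\<^sub>R y) = r *\<^sub>R ip x y"
    and st_ip: "st (ip x y) = ip y x"
    and st_add: "st (a + b) = st a + st b"
    and st_scaleR: "st (r *\<^sub>R a) = r *\<^sub>R st a"
    and norm_ip_self: "norm (ip x x) = (norm x)\<^sup>2"
    and norm_ip_le: "norm (ip x y) \<le> norm x * norm y"
    and ip_im: "ip x (im y) = im_A (ip x y)"
    and st_im_A: "st (im_A a) = - im_A (st a)"
    and im_A_im_A: "im_A (im_A a) = - a"
    and im_A_minus: "im_A (- a) = - im_A a"
    and im_add: "im (x + y) = im x + im y"
    and im_scaleR: "im (r *\<^sub>R x) = r *\<^sub>R im x"
    and im_im: "im (im x) = - x"
begin

lemma ip_minus: "ip x (- y) = - ip x y"
  using ip_scaleR[of x "-1" y] by simp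

lemma ip_diff: "ip x (y - z) = ip x y - ip x z"
  using ip_add[of x y "- z"] by (simp add: ip_minus)

lemma ip_zero: "ip x 0 = 0"
  using ip_scaleR[of x 0 0] by simp

lemma ip_add_left: "ip (x + y) z = ip x z + ip y z"
  by (metis ip_add st_add st_ip)

lemma ip_scaleR_left: "ip (r *\<^sub>R x) z = r *\<^sub>R ip x z"
  by (metis ip_scaleR st_scaleR st_ip)

lemma ip_minus_left: "ip (- x) z = - ip x z"
  using ip_scaleR_left[of "-1" x z] by simp

lemma ip_diff_left: "ip (x - y) z = ip x z - ip y z"
  using ip_add_left[of x "- y" z] by (simp add: ip_minus_left)

lemma ip_zero_left: "ip 0 z = 0"
  using ip_scaleR_left[of 0 0 z] by simp

lemmas ip_lin = ip_add ip_diff ip_minus ip_zero ip_scaleR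
  ip_add_left ip_diff_left ip_minus_left ip_zero_left ip_scaleR_left

lemma ip_eqI: assumes "\<And>z. ip z x = ip z y" shows "x = y"
proof -
  have "ip (x - y) (x - y) = 0" using assms by (simp add: ip_diff)
  then show ?thesis using norm_ip_self[of "x - y"] by simp
qed

lemma bounded_bilinear_ip: "bounded_bilinear ip"
  by standard (auto simp: ip_lin norm_ip_le intro!: exI[of _ 1])

lemma ip_im_left: "ip (im x) y = - im_A (ip x y)"
  by (metis ip_im st_ip st_im_A)

lemma norm_im: "norm (im x) = norm x"
proof -
  have "ip (im x) (im x) = ip x x" by (simp add: ip_im ip_im_left im_A_minus im_A_im_A)
  then have "(norm (im x))\<^sup>2 = (norm x)\<^sup>2" by (metis norm_ip_self)
  then show ?thesis by simp
qed

definition adj_pair :: "'h endo \<Rightarrow> 'h endo \<Rightarrow> bool"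
  where "adj_pair T S \<longleftrightarrow> (\<forall>x y. ip (app T x) y = ip x (app S y))"

definition LH :: "'h endo set" where "LH = {T. \<exists>S. adj_pair T S}"

definition dag :: "'h endo \<Rightarrow> 'h endo" where "dag T = (SOME S. adj_pair T S)"

lemma adj_pairD: "adj_pair T S \<Longrightarrow> ip (app T x) y = ip x (app S y)"
  by (simp add: adj_pair_def)

lemma adj_pair_sym: "adj_pair T S \<Longrightarrow> adj_pair S T"
  unfolding adj_pair_def by (metis st_ip)

lemma adj_pair_unique: "adj_pair T S \<Longrightarrow> adj_pair T S' \<Longrightarrow> S = S'"
  by (intro endo_eqI ip_eqI) (metis adj_pairD)

lemma adj_pair_dag: "T \<in> LH \<Longrightarrow> adj_pair T (dag T)"
  unfolding LH_def dag_def by (auto intro: someI_ex)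

lemma dag_eqI: "adj_pair T S \<Longrightarrow> dag T = S"
  using adj_pair_dag[of T] adj_pair_unique by (auto simp: LH_def)

lemma adj_pair_LH: "adj_pair T S \<Longrightarrow> T \<in> LH" "adj_pair T S \<Longrightarrow> S \<in> LH"
  by (auto simp: LH_def dest: adj_pair_sym)

lemma ip_dag: "T \<in> LH \<Longrightarrow> ip (app T x) y = ip x (app (dag T) y)"
  "T \<in> LH \<Longrightarrow> ip x (app T y) = ip (app (dag T) x) y"
  using adj_pair_dag adj_pairD adj_pair_sym by metis+

text \<open>Cauchy-Schwarz bounds the square of \<open>norm (app T x)\<close>, the norm of
  \<open>ip x (S T x)\<close>, by \<open>norm (S * T)\<close> times the square of
  \<open>norm x\<close>.\<close>

lemma adj_pair_norm: assumes "adj_pair T S" shows "norm (S * T) = (norm T)\<^sup>2" "norm S = norm T"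
proof -
  have le: "(norm T)\<^sup>2 \<le> norm (S * T)" if p: "adj_pair T S" for T S
  proof -
    have "norm (app T x) \<le> sqrt (norm (S * T)) * norm x" for x
    proof -
      have "(norm (app T x))\<^sup>2 = norm (ip x (app (S * T) x))"
        using adj_pairD[OF p, of x "app T x"] norm_ip_self[of "app T x"] by simp
      also have "\<dots> \<le> norm x * norm (app (S * T) x)" by (rule norm_ip_le)
      also have "\<dots> \<le> norm x * (norm (S * T) * norm x)" by (intro mult_left_mono norm_app) simp
      finally have "(norm (app T x))\<^sup>2 \<le> (sqrt (norm (S * T)) * norm x)\<^sup>2"
        by (simp add: power_mult_distrib power2_eq_square mult_ac)
      then show ?thesis by (rule power2_le_imp_le) simp
    qed
    then have "norm T \<le> sqrt (norm (S * T))" by (intro norm_endo_le) auto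
    then have "(norm T)\<^sup>2 \<le> (sqrt (norm (S * T)))\<^sup>2" by (intro power_mono) auto
    then show ?thesis by simp
  qed
  have le': "norm T \<le> norm S" if p: "adj_pair T S" for T S
  proof (cases "T = 0")
    case False
    have "norm T * norm T \<le> norm S * norm T"
      using le[OF p] norm_mult_ineq[of S T] by (simp add: power2_eq_square)
    then show ?thesis using False by simp
  qed simp
  show eq: "norm S = norm T" using le'[OF assms] le'[OF adj_pair_sym[OF assms]] by simp
  show "norm (S * T) = (norm T)\<^sup>2"
    using le[OF assms] norm_mult_ineq[of S T] eq by (simp add: power2_eq_square)
qed

lemma adj_pair_simps:
  "adj_pair 1 1" "adj_pair T S \<Longrightarrow> adj_pair T' S' \<Longrightarrow> adj_pair (T + T') (S + S')"
  "adj_pair T S \<Longrightarrow> adj_pair T' S' \<Longrightarrow> adj_pair (T - T') (S - S')"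
  "adj_pair T S \<Longrightarrow> adj_pair T' S' \<Longrightarrow> adj_pair (T * T') (S' * S)"
  "adj_pair T S \<Longrightarrow> adj_pair (r *\<^sub>R T) (r *\<^sub>R S)"
  by (auto simp: adj_pair_def ip_lin)

text \<open>Taking adjoints is isometric, so the adjoints of a convergent sequence converge as well,
  and the two limits are adjoint to each other.\<close>

lemma closed_LH: "closed LH"
  unfolding closed_sequential_limits
proof (intro allI impI, elim conjE)
  fix T l assume T: "\<forall>n. T n \<in> LH" and lim: "T \<longlonglongrightarrow> l"
  have p: "adj_pair (T n) (dag (T n))" for n using T adj_pair_dag by blast
  have nd: "norm (dag (T m) - dag (T n)) = norm (T m - T n)" for m n
    using adj_pair_norm(2)[OF adj_pair_simps(3)[OF p p]] .
  have "Cauchy T" using lim LIMSEQ_imp_Cauchy by blast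
  then have "Cauchy (\<lambda>n. dag (T n))" unfolding Cauchy_def dist_norm nd .
  then obtain m where m: "(\<lambda>n. dag (T n)) \<longlonglongrightarrow> m" using Cauchy_convergent convergent_def by blast
  have "adj_pair l m"
    unfolding adj_pair_def
  proof (intro allI)
    fix x y
    interpret ip: bounded_bilinear ip by (rule bounded_bilinear_ip)
    have "(\<lambda>n. ip (app (T n) x) y) \<longlonglongrightarrow> ip (app l x) y"
      by (intro ip.tendsto app.tendsto tendsto_const lim)
    moreover have "(\<lambda>n. ip x (app (dag (T n)) y)) \<longlonglongrightarrow> ip x (app m y)"
      by (intro ip.tendsto app.tendsto tendsto_const m)
    ultimately show "ip (app l x) y = ip x (app m y)"
      using adj_pairD[OF p] LIMSEQ_unique by simp
  qed
  then show "l \<in> LH" by (rule adj_pair_LH)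
qed

definition im_op :: "'h endo" where "im_op = (SOME T. app T = im)"

lemma app_im_op: "app im_op = im"
proof -
  have "bounded_linear im"
    by (rule bounded_linear_intro[where K=1]) (auto simp: im_add im_scaleR norm_im)
  then show ?thesis unfolding im_op_def by (rule someI_ex[OF ex_endo])
qed

lemma adj_pair_im_op: "adj_pair im_op (- im_op)"
  by (simp add: adj_pair_def app_im_op ip_im_left ip_minus ip_im)

text \<open>Operators in \<open>LH\<close> are automatically complex linear, because the inner
  product is so in its second argument.\<close>

lemma im_op_commute: assumes "T \<in> LH" shows "im_op * T = T * im_op"
proof (intro endo_eqI ip_eqI)
  fix x z
  have "ip z (app T (im x)) = im_A (ip z (app T x))"
    by (simp add: ip_dag(2)[OF assms] ip_im)
  then show "ip z (app (im_op * T) x) = ip z (app (T * im_op) x)"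
    by (simp add: app_im_op ip_im)
qed

sublocale unital_cstar LH dag im_op
proof
  show "closed LH" by (rule closed_LH)
  show "1 \<in> LH" using adj_pair_simps(1) adj_pair_LH by blast
  show "im_op \<in> LH" using adj_pair_im_op adj_pair_LH by blast
  show "im_op * im_op = - 1" by (rule endo_eqI) (simp add: app_im_op im_im)
  show "dag im_op = - im_op" by (rule dag_eqI[OF adj_pair_im_op])
  fix x y and r :: real assume x: "x \<in> LH"
  note px = adj_pair_dag[OF x]
  show "r *\<^sub>R x \<in> LH" "dag (r *\<^sub>R x) = r *\<^sub>R dag x"
    using adj_pair_simps(5)[OF px] adj_pair_LH dag_eqI by blast+
  show "dag x \<in> LH" "dag (dag x) = x"
    using adj_pair_sym[OF px] adj_pair_LH dag_eqI by blast+
  show "norm (dag x * x) = (norm x)\<^sup>2" using adj_pair_norm[OF px] by blast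
  show "im_op * x = x * im_op" by (rule im_op_commute[OF x])
  assume y: "y \<in> LH"
  note py = adj_pair_dag[OF y]
  show "x + y \<in> LH" "dag (x + y) = dag x + dag y"
    using adj_pair_simps(2)[OF px py] adj_pair_LH dag_eqI by blast+
  show "x * y \<in> LH" "dag (x * y) = dag y * dag x"
    using adj_pair_simps(4)[OF px py] adj_pair_LH dag_eqI by blast+
qed

lemma adjointable_app: "T \<in> LH \<Longrightarrow> adjointable ip (app T)"
  unfolding adjointable_def using ip_dag by blast

lemma adj_eqI: assumes "\<And>x y. ip (T x) y = ip x (S y)" shows "adj ip T = S"
proof
  fix y
  have "\<forall>x y. ip (T x) y = ip x (adj ip T y)"
    unfolding adj_def using someI[of "\<lambda>S. \<forall>x y. ip (T x) y = ip x (S y)" S] assms by blast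
  then show "adj ip T y = S y" using assms by (intro ip_eqI) metis
qed

lemma adj_app: "T \<in> LH \<Longrightarrow> adj ip (app T) = app (dag T)"
  by (rule adj_eqI) (rule ip_dag)

text \<open>The functionals \<open>ip (S y)\<close> with \<open>norm y \<le> 1\<close> are bounded
  at each \<open>x\<close> by \<open>norm (T x)\<close>; uniform boundedness then bounds
  \<open>T\<close>.\<close>

lemma adjointable_bounded_linear:
  assumes TS: "\<And>x y. ip (T x) y = ip x (S y)" shows "bounded_linear T"
proof -
  have ST: "ip y (T x) = ip (S y) x" for x y using TS st_ip by metis
  have "bounded_linear (ip z)" for z
    using bounded_bilinear.bounded_linear_right[OF bounded_bilinear_ip] .
  moreover have "\<exists>M. \<forall>z\<in>S ` {y. norm y \<le> 1}. norm (ip z x) \<le> M" for x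
  proof (intro exI ballI)
    fix z assume "z \<in> S ` {y. norm y \<le> 1}"
    then obtain y where y: "norm y \<le> 1" "z = S y" by blast
    have "norm (ip z x) = norm (ip y (T x))" by (simp add: y ST)
    also have "\<dots> \<le> norm y * norm (T x)" by (rule norm_ip_le)
    also have "\<dots> \<le> 1 * norm (T x)" by (rule mult_right_mono[OF y(1)]) simp
    finally show "norm (ip z x) \<le> 1 * norm (T x)" .
  qed
  ultimately obtain M where M: "0 \<le> M" "\<And>z x. z \<in> S ` {y. norm y \<le> 1} \<Longrightarrow> norm (ip z x) \<le> M * norm x"
    using uniform_boundedness[of "S ` {y. norm y \<le> 1}" ip] by blast
  show ?thesis
  proof (rule bounded_linear_intro[where K=M])
    show "T (x + y) = T x + T y" for x y by (rule ip_eqI) (simp add: ip_lin ST)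
    show scale: "T (r *\<^sub>R x) = r *\<^sub>R T x" for r x by (rule ip_eqI) (simp add: ip_lin ST)
    fix x
    show "norm (T x) \<le> norm x * M"
    proof (cases "T x = 0")
      case False
      define y where "y = (1 / norm (T x)) *\<^sub>R T x"
      have "norm y \<le> 1" by (simp add: y_def)
      then have "norm (ip (S y) x) \<le> M * norm x" using M(2) by blast
      then have "norm (ip y (T x)) \<le> M * norm x" by (simp add: ST)
      moreover have "ip y (T x) = (1 / norm (T x)) *\<^sub>R ip (T x) (T x)" by (simp add: y_def ip_lin)
      ultimately show ?thesis using False norm_ip_self[of "T x"]
        by (simp add: power2_eq_square mult.commute)
    qed (use M in simp)
  qed
qed

lemma adjointableE:
  assumes "adjointable ip T" obtains T' where "T' \<in> LH" "T = app T'"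
proof -
  obtain S where TS: "\<And>x y. ip (T x) y = ip x (S y)" using assms by (auto simp: adjointable_def)
  have ST: "\<And>x y. ip (S x) y = ip x (T y)" using TS st_ip by metis
  obtain T' where T': "app T' = T" using ex_endo[OF adjointable_bounded_linear[OF TS]] by blast
  obtain S' where S': "app S' = S" using ex_endo[OF adjointable_bounded_linear[OF ST]] by blast
  have "adj_pair T' S'" by (simp add: adj_pair_def T' S' TS)
  then show ?thesis using that[of T'] T' adj_pair_LH by blast
qed

end

section \<open>C*-algebras and Hilbert modules as inner product spaces\<close>

lemma cstar_norm_st:
  assumes "cstar_algebra sC st" shows "norm (st x) = norm x"
proof -
  have st_st: "st (st x) = x" and cst: "norm (st x * x) = (norm x)\<^sup>2" for x
    using assms unfolding cstar_algebra_def by metis+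
  have nle: "norm x \<le> norm (st x)" for x
  proof (cases "x = 0")
    case False
    have "norm x * norm x \<le> norm (st x) * norm x"
      using cst[of x] norm_mult_ineq[of "st x" x] by (simp add: power2_eq_square)
    then show ?thesis using False by simp
  qed simp
  show ?thesis using nle[of x] nle[of "st x"] by (simp add: st_st)
qed

text \<open>For \<open>st x * y\<close> Cauchy-Schwarz needs no positivity: it is
  submultiplicativity together with the isometry of the involution.\<close>

lemma cstar_algebra_ip_space:
  fixes sC :: "complex \<Rightarrow> 'a::{real_normed_algebra,banach} \<Rightarrow> 'a"
  assumes "cstar_algebra sC st"
  shows "ip_space st (sC \<i>) (\<lambda>x y. st x * y) (sC \<i>)"
proof -
  have sC_r: "sC (complex_of_real r) x = r *\<^sub>R x"
    and sC_add: "sC c (x + y) = sC c x + sC c y"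
    and sC_mult: "sC (c * d) x = sC c (sC d x)"
    and sC_m: "sC c (x * y) = x * sC c y"
    and st_st: "st (st x) = x"
    and st_add: "st (x + y) = st x + st y"
    and st_sC: "st (sC c x) = sC (cnj c) (st x)"
    and st_mult: "st (x * y) = st y * st x"
    and cst: "norm (st x * x) = (norm x)\<^sup>2" for r x c y d
    using assms unfolding cstar_algebra_def by metis+
  have sC_minus: "sC (- c) x = - sC c x" for c x
    using sC_mult[of "complex_of_real (-1)" c x] sC_r[of "-1" "sC c x"] by simp
  have sC_minus2: "sC c (- x) = - sC c x" for c x
    using sC_mult[of c "complex_of_real (-1)" x] sC_r[of "-1" x] sC_minus[of c x] by simp
  have sC_1: "sC 1 x = x" for x using sC_r[of 1 x] by simp
  have ii: "sC \<i> (sC \<i> x) = - x" for x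
    using sC_mult[of \<i> \<i> x] sC_minus[of 1 x] by (simp add: sC_1)
  have st_r: "st (r *\<^sub>R x) = r *\<^sub>R st x" for r x
    using st_sC[of "complex_of_real r" x] by (simp add: sC_r)
  have sC_scaleR: "sC c (r *\<^sub>R x) = r *\<^sub>R sC c x" for c r x
    by (metis sC_mult sC_r mult.commute)
  note nst = cstar_norm_st[OF assms]
  show ?thesis
  proof
    show "norm (st x * y) \<le> norm x * norm y" for x y
      using norm_mult_ineq[of "st x" y] by (simp add: nst)
  qed (simp_all add: distrib_left st_mult st_st st_add st_r cst sC_m st_sC sC_minus sC_minus2 ii sC_add sC_scaleR)
qed

lemma hilbert_module_Cauchy_Schwarz:
  assumes H: "hilbert_cstar_module sC st sH act ip"
  shows "norm (ip x y) \<le> norm x * norm y"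
proof -
  have A: "cstar_algebra sC st" using H unfolding hilbert_cstar_module_def by (elim conjE)
  have ip_add: "ip x (y + z) = ip x y + ip x z"
    and ip_act: "ip x (act y a) = ip x y * a"
    and st_ip: "st (ip x y) = ip y x"
    and ip_pos: "cpositive st (ip x x)"
    and nrm: "norm x = sqrt (norm (ip x x))"
    and sH_r: "sH (complex_of_real r) x = r *\<^sub>R x"
    and ip_sH: "ip x (sH c y) = sC c (ip x y)" for x y z a r c
    using H unfolding hilbert_cstar_module_def by metis+
  have sC_r: "sC (complex_of_real r) a = r *\<^sub>R a"
    and st_st: "st (st a) = a"
    and st_add: "st (a + b) = st a + st b"
    and st_mult: "st (a * b) = st b * st a"
    and cst: "norm (st a * a) = (norm a)\<^sup>2" for r a b
    using A unfolding cstar_algebra_def by metis+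
  note nst = cstar_norm_st[OF A]
  have ip_scaleR: "ip x (r *\<^sub>R y) = r *\<^sub>R ip x y" for x y r
    using ip_sH[of x "complex_of_real r" y] by (simp add: sH_r sC_r)
  have ip_diff: "ip x (y - z) = ip x y - ip x z" for x y z
    using ip_add[of x y "-1 *\<^sub>R z"] ip_scaleR[of x "-1" z] by simp
  interpret A: ip_space st "sC \<i>" "\<lambda>x y. st x * y" "sC \<i>"
    by (rule cstar_algebra_ip_space[OF A])
  have st_diff: "st (a - b) = st a - st b" for a b
    using A.st_add[of a "-1 *\<^sub>R b"] A.st_scaleR[of "-1" b] by simp
  have ip_diff_left: "ip (x - y) z = ip x z - ip y z" for x y z
    by (metis ip_diff st_diff st_ip)
  \<comment> \<open>Left multiplication is an isometric star-homomorphism into a unital C*-algebra,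
    where the order theory is available whether or not the scalar algebra has a unit.\<close>
  define L where "L a = (SOME T. app T = (\<lambda>x. a * x))" for a :: 'a
  have appL: "app (L a) x = a * x" for a x
    using someI_ex[OF ex_endo[OF bounded_linear_mult_right[of a]]] unfolding L_def by metis
  have Lp: "A.adj_pair (L a) (L (st a))" for a
    by (simp add: A.adj_pair_def appL st_mult mult.assoc)
  have LB: "L a \<in> A.LH" and dagL: "A.dag (L a) = L (st a)" for a
    using Lp A.adj_pair_LH A.dag_eqI by blast+
  have Lhom: "L (a * b) = L a * L b" "L (a + b) = L a + L b" "L (a - b) = L a - L b" for a b
    by (auto intro!: endo_eqI simp: appL algebra_simps)
  have Lpos: "A.pos (L a)" if "cpositive st a" for a
    using that A.pos_star_mult[OF LB] by (auto simp: cpositive_def Lhom dagL)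
  have nL: "norm (L a) = norm a" for a
  proof (rule antisym)
    show "norm (L a) \<le> norm a" by (rule norm_endo_le) (auto simp: appL norm_mult_ineq)
    have "norm a * norm a \<le> norm (L a) * norm a"
      using norm_app[of "L a" "st a"] cst[of "st a"]
      by (simp add: appL st_st nst power2_eq_square)
    then show "norm a \<le> norm (L a)" by (cases "a = 0") auto
  qed
  have CS1: "norm (ip x y) \<le> norm y" if "norm x \<le> 1" for x y
  proof -
    \<comment> \<open>The vector \<open>y - x a\<close> has a positive square. Adding
      \<open>st a * (1 - ip x x) * a\<close>, positive for \<open>norm x \<le> 1\<close>, leaves
      \<open>ip y y - st a * a\<close>.\<close>
    define a where "a = ip x y"
    have c: "ip (y - act x a) (y - act x a) = ip y y - st a * a - (st a * a - st a * ip x x * a)"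
    proof -
      have 1: "st a = ip y x" by (simp add: a_def st_ip)
      have 2: "ip (act x a) z = st a * ip x z" for z
        by (metis ip_act st_ip st_mult st_st)
      show ?thesis by (simp add: ip_diff ip_diff_left 1 2 ip_act algebra_simps flip: a_def)
    qed
    have nx: "norm (ip x x) \<le> 1" using that nrm[of x] by simp
    have Lx: "A.sa (L (ip x x))" by (simp add: A.sa_def LB dagL st_ip)
    have "A.pos (1 *\<^sub>R 1 - L (ip x x))" by (rule A.pos_diff_norm[OF Lx]) (simp add: nL nx)
    then have "A.pos (A.dag (L a) * (1 - L (ip x x)) * L a)" using A.pos_sandwich LB by simp
    moreover have "A.pos (L (ip (y - act x a) (y - act x a)))" by (rule Lpos[OF ip_pos])
    ultimately have "A.pos (L (ip (y - act x a) (y - act x a)) + A.dag (L a) * (1 - L (ip x x)) * L a)"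
      by (rule A.pos_add[rotated])
    also have "L (ip (y - act x a) (y - act x a)) + A.dag (L a) * (1 - L (ip x x)) * L a
        = L (ip y y) - L (st a * a)"
      unfolding c dagL by (simp add: Lhom algebra_simps)
    finally have "norm (L (st a * a)) \<le> norm (L (ip y y))"
      by (intro A.pos_norm_mono Lpos ip_pos) (auto simp: cpositive_def)
    then have "(norm a)\<^sup>2 \<le> (norm y)\<^sup>2" using nrm[of y] by (simp add: nL cst)
    then show ?thesis unfolding a_def by (rule power2_le_imp_le) simp
  qed
  show ?thesis
  proof (cases "x = 0")
    case True
    have "ip y 0 = 0" using ip_scaleR[of y 0 0] by simp
    then have "ip 0 y = 0" using st_ip[of y 0] A.st_scaleR[of 0 0] by simp
    then show ?thesis using True by simp
  next
    case False
    define x' where "x' = (1 / norm x) *\<^sub>R x"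
    have "norm (ip x' y) \<le> norm y" using False by (intro CS1) (simp add: x'_def)
    moreover have "ip x' y = (1 / norm x) *\<^sub>R ip x y"
      unfolding x'_def by (metis ip_scaleR st_ip A.st_scaleR)
    ultimately show ?thesis using False by (simp add: divide_le_eq mult.commute)
  qed
qed

lemma hilbert_module_ip_space:
  assumes H: "hilbert_cstar_module sC st sH act ip"
  shows "ip_space st (sC \<i>) ip (sH \<i>)"
proof -
  have A: "cstar_algebra sC st" using H unfolding hilbert_cstar_module_def by (elim conjE)
  interpret A: ip_space st "sC \<i>" "\<lambda>x y. st x * y" "sC \<i>"
    by (rule cstar_algebra_ip_space[OF A])
  have ip_add: "ip x (y + z) = ip x y + ip x z"
    and st_ip: "st (ip x y) = ip y x"
    and nrm: "norm x = sqrt (norm (ip x x))"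
    and sH_r: "sH (complex_of_real r) x = r *\<^sub>R x"
    and sH_add: "sH c (x + y) = sH c x + sH c y"
    and sH_mult: "sH (c * d) x = sH c (sH d x)"
    and ip_sH: "ip x (sH c y) = sC c (ip x y)" for x y z r c d
    using H unfolding hilbert_cstar_module_def by metis+
  have sC_r: "sC (complex_of_real r) a = r *\<^sub>R a" for r a
    using A unfolding cstar_algebra_def by metis
  show ?thesis
  proof
    show "norm (ip x x) = (norm x)\<^sup>2" for x using nrm[of x] by simp
    show "norm (ip x y) \<le> norm x * norm y" for x y by (rule hilbert_module_Cauchy_Schwarz[OF H])
    show "ip x (r *\<^sub>R y) = r *\<^sub>R ip x y" for x r y
      using ip_sH[of x "complex_of_real r" y] by (simp add: sH_r sC_r)
    show "sH \<i> (r *\<^sub>R x) = r *\<^sub>R sH \<i> x" for r x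
      by (metis sH_mult sH_r mult.commute)
    show "sH \<i> (sH \<i> x) = - x" for x
      using sH_mult[of \<i> \<i> x] sH_r[of "-1" x] by simp
  qed (simp_all add: ip_add st_ip sH_add ip_sH A.st_add A.st_scaleR A.st_im_A A.im_A_im_A A.im_A_minus)
qed

section \<open>Evaluating the operator constructions inside the algebra \<open>LH\<close>\<close>

lemma app_inject: "app S = app T \<longleftrightarrow> S = T"
  by (metis endo_eqI)

lemma app_mult: "app S \<circ> app T = app (S * T)"
  by (auto simp: fun_eq_iff)

lemma app_one: "app 1 = id"
  by (auto simp: fun_eq_iff)

context ip_space
begin

definition proj :: "'h endo \<Rightarrow> bool" where "proj E \<longleftrightarrow> sa E \<and> E * E = E"

lemma proj_LH: "proj E \<Longrightarrow> E \<in> LH" and proj_dag: "proj E \<Longrightarrow> dag E = E"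
  and proj_idem: "proj E \<Longrightarrow> E * E = E"
  by (auto simp: proj_def sa_def)

lemma proj_pos: "proj E \<Longrightarrow> pos E"
  using pos_square[of E] by (simp add: proj_def)

lemma is_projE: assumes "is_proj ip P" obtains E where "proj E" "P = app E"
proof -
  obtain E where E: "E \<in> LH" "P = app E"
    using assms by (auto simp: is_proj_def idempotent_op_def elim: adjointableE)
  then have "proj E"
    using assms by (simp add: is_proj_def idempotent_op_def proj_def sa_def adj_app app_mult app_inject)
  then show ?thesis using that E by blast
qed

lemma is_proj_app: "proj E \<Longrightarrow> is_proj ip (app E)"
  by (simp add: is_proj_def idempotent_op_def adjointable_app adj_app app_mult proj_LH proj_dag proj_idem)

lemma proj_app_range: "proj E \<Longrightarrow> x \<in> range (app E) \<longleftrightarrow> app E x = x"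
  by (metis app_simps(6) proj_idem rangeE rangeI)

text \<open>Projections with equal ranges satisfy \<open>E * F = F\<close> and
  \<open>F * E = E\<close>; taking adjoints identifies them.\<close>

lemma proj_onto_app: assumes E: "proj E" and M: "range (app E) = M" shows "proj_onto ip M = app E"
  unfolding proj_onto_def
proof (rule the_equality)
  show "is_proj ip (app E) \<and> range (app E) = M" using assms is_proj_app by simp
  fix P assume P: "is_proj ip P \<and> range P = M"
  then obtain F where F: "proj F" "P = app F" using is_projE by blast
  have r: "range (app F) = range (app E)" using P F M by simp
  have "E * F = F" using proj_app_range[OF E] r by (intro endo_eqI) auto
  moreover have "F * E = E" using proj_app_range[OF F(1)] r by (intro endo_eqI) auto
  ultimately have "F = E" using E F by (metis proj_dag proj_LH star_mult)
  then show "P = app E" using F by simp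
qed

lemma op_posE: assumes "op_pos ip S" obtains T where "pos T" "S = app T"
proof -
  obtain R where "adjointable ip R" "S = adj ip R \<circ> R" using assms by (auto simp: op_pos_def)
  moreover then obtain T where "T \<in> LH" "R = app T" by (auto elim: adjointableE)
  ultimately show ?thesis using that[of "dag T * T"] pos_star_mult by (simp add: adj_app app_mult)
qed

text \<open>The positive root of an element of the corner stays in the corner: the squared norm of
  \<open>R (1 - E)\<close> is the norm of \<open>(1 - E) T (1 - E)\<close>, which is 0.\<close>

lemma corner_pos_app:
  assumes T: "pos T" and E: "proj E" and TE: "E * T * E = T"
  shows "corner_pos ip (app E) (app T)"
proof -
  obtain R where R: "pos R" "R * R = T" using pos_sqrt_ex[OF T] by metis
  have "dag (R * E) * (R * E) = T"
    using R E TE by (auto simp: proj_LH proj_dag pos_B pos_star mult.assoc)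
  moreover have "R * E = E * (R * E) * E"
  proof -
    have "dag (R - R * E) * (R - R * E) = 0"
      using R E TE by (simp add: proj_LH proj_dag pos_B pos_star algebra_simps)
        (metis E TE mult.assoc proj_idem)
    then have RE: "R = R * E"
      using cstar_norm[of "R - R * E"] R E by (simp add: pos_B proj_LH)
    then have "R = E * R" using R E by (metis pos_B pos_star proj_LH proj_dag star_mult)
    then show ?thesis using RE by (metis mult.assoc)
  qed
  ultimately show ?thesis
    unfolding corner_pos_def using R E
    by (intro exI[of _ "app (R * E)"]) (simp add: adjointable_app adj_app app_mult pos_B proj_LH)
qed

lemma corner_posE: assumes "corner_pos ip E S" obtains T where "pos T" "S = app T"
  using assms op_posE[of S] by (auto simp: corner_pos_def op_pos_def)

lemma op_pos_app: "pos T \<Longrightarrow> op_pos ip (app T)"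
  using corner_pos_app[of T 1] unfolding corner_pos_def op_pos_def by (auto simp: proj_def)

text \<open>Corner positivity implies positivity in \<open>LH\<close>, so uniqueness is inherited
  from \<open>pos_sqrt_unique\<close>.\<close>

lemma corner_sqrt_app:
  assumes R: "pos R" and E: "proj E" and RE: "E * R * E = R" and RT: "R * R = T"
  shows "corner_sqrt ip (app E) (app T) = app R"
  unfolding corner_sqrt_def
proof (rule the_equality)
  show "adjointable ip (app R) \<and> app R = app E \<circ> app R \<circ> app E \<and> corner_pos ip (app E) (app R) \<and>
    app R \<circ> app R = app T"
    using assms corner_pos_app by (simp add: adjointable_app app_mult pos_B)
  fix S assume S: "adjointable ip S \<and> S = app E \<circ> S \<circ> app E \<and> corner_pos ip (app E) S \<and> S \<circ> S = app T"
  then obtain R' where R': "pos R'" "S = app R'" using corner_posE by blast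
  have "R' * R' = R * R" using S R' RT by (simp add: app_mult app_inject)
  then show "S = app R" using pos_sqrt_unique[OF R'(1) R] R' by simp
qed

lemma op_sqrt_app: assumes R: "pos R" and RT: "R * R = T" shows "op_sqrt ip (app T) = app R"
  unfolding op_sqrt_def
proof (rule the_equality)
  show "adjointable ip (app R) \<and> op_pos ip (app R) \<and> app R \<circ> app R = app T"
    using assms op_pos_app by (simp add: adjointable_app app_mult pos_B)
  fix S assume S: "adjointable ip S \<and> op_pos ip S \<and> S \<circ> S = app T"
  then obtain R' where R': "pos R'" "S = app R'" using op_posE by blast
  have "R' * R' = R * R" using S R' RT by (simp add: app_mult app_inject)
  then show "S = app R" using pos_sqrt_unique[OF R'(1) R] R' by simp
qed

lemma corner_inv_app:
  assumes E: "proj E" and X: "X \<in> LH" "E * X * E = X" "X * T = E" "T * X = E"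
  shows "corner_inv ip (app E) (app T) = app X"
  unfolding corner_inv_def
proof (rule the_equality)
  show "adjointable ip (app X) \<and> app X = app E \<circ> app X \<circ> app E \<and> app X \<circ> app T = app E \<and> app T \<circ> app X = app E"
    using X by (simp add: adjointable_app app_mult)
  fix S assume S: "adjointable ip S \<and> S = app E \<circ> S \<circ> app E \<and> S \<circ> app T = app E \<and> app T \<circ> S = app E"
  then obtain Y where Y: "Y \<in> LH" "S = app Y" by (auto elim: adjointableE)
  have y: "Y = E * Y * E" "Y * T = E" using S Y by (auto simp: app_mult app_inject)
  have EE: "E * E = E" by (rule proj_idem[OF E])
  have "Y * E = Y" using EE y(1) by (metis mult.assoc)
  then have "Y = Y * (T * X)" by (simp add: X(4))
  also have "\<dots> = E * X" by (simp add: y(2) flip: mult.assoc)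
  also have "E * X = X" using X(2) EE by (metis mult.assoc)
  finally show "S = app X" using Y by simp
qed

lemma op_inv_app:
  assumes X: "X \<in> LH" "X * T = 1" "T * X = 1" shows "op_inv ip (app T) = app X"
proof -
  have "op_inv ip (app T) = corner_inv ip (app 1) (app T)"
    unfolding op_inv_def corner_inv_def by (simp add: app_one)
  also have "\<dots> = app X" by (rule corner_inv_app) (use X in \<open>auto simp: proj_def\<close>)
  finally show ?thesis .
qed

text \<open>Penrose's argument: self-adjointness gives \<open>T * X = T * Y\<close> and
  \<open>X * T = Y * T\<close>, and these determine \<open>X = X * T * X\<close>.\<close>

lemma mp_inv_app:
  assumes T: "T \<in> LH" and X: "X \<in> LH" "T * X * T = T" "X * T * X = X" "sa (T * X)" "sa (X * T)"
  shows "mp_inv ip (app T) = app X"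
  unfolding mp_inv_def
proof (rule the_equality)
  show "adjointable ip (app X) \<and> app T \<circ> app X \<circ> app T = app T \<and> app X \<circ> app T \<circ> app X = app X \<and>
        adj ip (app T \<circ> app X) = app T \<circ> app X \<and> adj ip (app X \<circ> app T) = app X \<circ> app T"
    using assms by (simp add: adjointable_app app_mult adj_app sa_B sa_star del: star_mult)
  fix S assume S: "adjointable ip S \<and> app T \<circ> S \<circ> app T = app T \<and> S \<circ> app T \<circ> S = S \<and>
        adj ip (app T \<circ> S) = app T \<circ> S \<and> adj ip (S \<circ> app T) = S \<circ> app T"
  then obtain Y where Y: "Y \<in> LH" "S = app Y" by (auto elim: adjointableE)
  have y: "T * Y * T = T" "Y * T * Y = Y" "dag (T * Y) = T * Y" "dag (Y * T) = Y * T"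
    using S Y T by (auto simp: app_mult app_inject adj_app simp del: star_mult)
  have x: "dag (T * X) = T * X" "dag (X * T) = X * T" using X sa_star by blast+
  have "T * X = (T * Y) * (T * X)" using y(1) by (metis mult.assoc)
  then have "dag (T * X) = dag (T * X) * dag (T * Y)" using T X Y by (metis mult_B star_mult)
  also have "\<dots> = T * Y" using x y X(2) by (metis mult.assoc)
  finally have 1: "T * X = T * Y" using x by simp
  have "X * T = (X * T) * (Y * T)" using y(1) by (metis mult.assoc)
  then have "dag (X * T) = dag (Y * T) * dag (X * T)" using T X Y by (metis mult_B star_mult)
  also have "\<dots> = Y * T" using x y X(2) by (metis mult.assoc)
  finally have 2: "X * T = Y * T" using x by simp
  have "X = Y" using 1 2 X(3) y(2) by (metis mult.assoc)
  then show "S = app X" using Y by simp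
qed

end

section \<open>The normal form of an idempotent\<close>

text \<open>Keeps the halves outside, so that the remaining identity has integer
  coefficients.\<close>

lemma half_mult_half:
  fixes x y z :: "'b::real_normed_algebra"
  assumes "x * y = z + z" shows "(1/2) *\<^sub>R x * ((1/2) *\<^sub>R y) = (1/2) *\<^sub>R z"
  using assms by (simp flip: scaleR_2)

lemma mult_eq_assoc: "a * b = c \<Longrightarrow> a * (b * z) = c * (z :: 'b::semigroup_mult)"
  by (simp flip: mult.assoc)

lemma mult_commute_middle: "a * b = b * a \<Longrightarrow> a * b * (a * c) = a * a * (b * (c :: 'b::semigroup_mult))"
  by (metis mult.assoc)

text \<open>An idempotent \<open>q\<close> is written as \<open>(1 + h j + d) / 2\<close> with \<open>d = q - q*\<close>, \<open>h = (1 - d\<^sup>2)\<^sup>1\<^sup>/\<^sup>2\<close>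
  and the symmetry \<open>j = h\<^sup>-\<^sup>1 (q + q* - 1)\<close>; here \<open>hi = h\<^sup>-\<^sup>1\<close>, \<open>y = (h + 1)\<^sup>-\<^sup>1\<close> and
  \<open>k = |d| = (h\<^sup>2 - 1)\<^sup>1\<^sup>/\<^sup>2\<close>.\<close>

locale idempotent_form = ip_space +
  fixes h hi k y j d
  assumes pos_h: "pos h" and pos_hi: "pos hi" and pos_k: "pos k" and pos_y: "pos y"
    and pos_h1: "pos (h - 1)"
    and sa_j: "sa j" and d_LH: "d \<in> LH" and dag_d: "dag d = - d"
    and h_hi: "h * hi = 1" and hi_h: "hi * h = 1"
    and y_h: "y * h = 1 - y" and h_y: "h * y = 1 - y"
    and kk: "k * k = h * h - 1"
    and k_h: "k * h = h * k" and k_hi: "k * hi = hi * k"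
    and jj: "j * j = 1" and dj: "d * j = - (j * d)" and dd: "d * d = 1 - h * h"
    and j_h: "j * h = h * j" and j_hi: "j * hi = hi * j" and j_k: "j * k = k * j" and j_y: "j * y = y * j"
    and d_h: "d * h = h * d" and d_hi: "d * hi = hi * d" and d_k: "d * k = k * d" and d_y: "d * y = y * d"
begin

text \<open>Partial fractions for \<open>1 / (h (h + 1))\<close>.\<close>

lemma y_hi: "y * hi = hi - y" and hi_y: "hi * y = hi - y"
proof -
  have "(y * h + y) * hi = hi" "hi * (h * y + y) = hi" by (simp_all add: y_h h_y)
  moreover have "y * h * hi = y" "hi * (h * y) = y"
    by (simp add: mult.assoc h_hi, simp add: hi_h flip: mult.assoc)
  ultimately show "y * hi = hi - y" "hi * y = hi - y"
    by (simp_all only: distrib_left distrib_right eq_diff_eq add.commute)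
qed

text \<open>A rewrite system that carries the commuting functions of \<open>h\<close> to the left,
  then \<open>j\<close>, then \<open>d\<close>. Through \<open>mult_eq_assoc\<close> each rule also
  fires inside a longer product, and the polynomial identities below become normalisations.\<close>

lemmas nf0 = h_hi hi_h y_h h_y y_hi hi_y kk k_h k_hi jj dj dd j_h j_hi j_k j_y d_h d_hi d_k d_y
lemmas nf = nf0 nf0[THEN mult_eq_assoc]

lemmas LHs = pos_B[OF pos_h] pos_B[OF pos_hi] pos_B[OF pos_k] pos_B[OF pos_y] sa_B[OF sa_j] d_LH
lemmas dags = pos_star[OF pos_h] pos_star[OF pos_hi] pos_star[OF pos_k] pos_star[OF pos_y]
  sa_star[OF sa_j] dag_d

text \<open>\<open>p\<close> will be the matched projection, \<open>e\<close> and \<open>f\<close>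
  the projections onto the range and null space of \<open>q\<close>; their last term is
  \<open>d j\<close> in normal form, hence the minus sign.\<close>

definition q where "q = (1/2) *\<^sub>R (1 + h * j + d)"
definition p where "p = (1/2) *\<^sub>R (1 + j)"
definition e where "e = (1/2) *\<^sub>R (1 + hi * j - hi * (j * d))"
definition f where "f = (1/2) *\<^sub>R (1 - hi * j - hi * (j * d))"

lemma q_LH: "q \<in> LH" by (simp add: q_def LHs)

lemma dag_q: "dag q = (1/2) *\<^sub>R (1 + h * j - d)"
  by (simp add: q_def LHs dags j_h)

lemma proj_p: "proj p"
  unfolding proj_def sa_def
proof (intro conjI)
  show "p \<in> LH" by (simp add: p_def LHs)
  show "dag p = p" by (simp add: p_def LHs dags)
  show "p * p = p" unfolding p_def by (rule half_mult_half) (simp add: nf algebra_simps)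
qed

lemma proj_e: "proj e"
  unfolding proj_def sa_def
proof (intro conjI)
  show "e \<in> LH" by (simp add: e_def LHs)
  show "dag e = e" by (simp add: e_def LHs dags nf mult.assoc)
  show "e * e = e" unfolding e_def by (rule half_mult_half) (simp add: nf algebra_simps)
qed

lemma proj_f: "proj f"
  unfolding proj_def sa_def
proof (intro conjI)
  show "f \<in> LH" by (simp add: f_def LHs)
  show "dag f = f" by (simp add: f_def LHs dags nf mult.assoc)
  show "f * f = f" unfolding f_def by (rule half_mult_half) (simp add: nf algebra_simps)
qed

lemma eq: "e * q = q" and qe: "q * e = e"
  unfolding e_def q_def by (rule half_mult_half, simp add: nf algebra_simps)+

lemma one_minus_q: "1 - q = (1/2) *\<^sub>R (1 - h * j - d)"
proof -
  have "1 - q = (1/2) *\<^sub>R ((1 + 1) - (1 + h * j + d))"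
    unfolding scaleR_diff_right scaleR_half_double q_def ..
  then show ?thesis by (simp add: algebra_simps)
qed

lemma one_minus_p: "1 - p = (1/2) *\<^sub>R (1 - j)"
proof -
  have "1 - p = (1/2) *\<^sub>R ((1 + 1) - (1 + j))"
    unfolding scaleR_diff_right scaleR_half_double p_def ..
  then show ?thesis by (simp add: algebra_simps)
qed

text \<open>\<open>h j\<close> is diagonal and \<open>d\<close> off-diagonal for \<open>p\<close>,
  so only \<open>d\<close> contributes to the corners. This is why \<open>H5\<close> and
  \<open>H6\<close> are the closed ranges of \<open>p * d\<close> and \<open>d * p\<close>.\<close>

lemma corner_12: "p * q * (1 - p) = (1/2) *\<^sub>R (p * d)"
  and corner_21: "(1 - p) * q * p = (1/2) *\<^sub>R (d * p)"
proof -
  have "p * q = (1/2) *\<^sub>R ((1/2) *\<^sub>R ((1 + j) * (1 + h * j + d)))"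
    unfolding p_def q_def by simp
  then have "p * q * (1 - p) = (1/2) *\<^sub>R ((1/2) *\<^sub>R ((1/2) *\<^sub>R ((1 + j) * (1 + h * j + d) * (1 - j))))"
    unfolding one_minus_p by simp
  also have "(1 + j) * (1 + h * j + d) * (1 - j) = ((1 + j) * d) + ((1 + j) * d)"
    by (simp add: nf algebra_simps)
  finally show "p * q * (1 - p) = (1/2) *\<^sub>R (p * d)"
    unfolding scaleR_half_double by (simp add: p_def)
  have "(1 - p) * q = (1/2) *\<^sub>R ((1/2) *\<^sub>R ((1 - j) * (1 + h * j + d)))"
    unfolding one_minus_p q_def by simp
  then have "(1 - p) * q * p = (1/2) *\<^sub>R ((1/2) *\<^sub>R ((1/2) *\<^sub>R ((1 - j) * (1 + h * j + d) * (1 + j))))"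
    unfolding p_def by simp
  also have "(1 - j) * (1 + h * j + d) * (1 + j) = (d * (1 + j)) + (d * (1 + j))"
    by (simp add: nf algebra_simps)
  finally show "(1 - p) * q * p = (1/2) *\<^sub>R (d * p)"
    unfolding scaleR_half_double by (simp add: p_def)
qed

lemma f_one_minus_q: "f * (1 - q) = 1 - q" and one_minus_q_f: "(1 - q) * f = f"
  unfolding f_def one_minus_q by (rule half_mult_half, simp add: nf algebra_simps)+

lemma proj_onto_range_q: "proj_onto ip (range (app q)) = app e"
proof (rule proj_onto_app[OF proj_e])
  have "app e x = app q (app e x)" "app q x = app e (app q x)" for x
    by (simp_all add: eq qe flip: app_simps(6))
  then show "range (app e) = range (app q)" by blast
qed

lemma proj_onto_ker_q: "proj_onto ip (ker_op (app q)) = app f"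
proof (rule proj_onto_app[OF proj_f])
  have "app q (app f x) = 0" for x
    using one_minus_q_f by (simp add: left_diff_distrib flip: app_simps(6))
  moreover have "x = app f x" if "app q x = 0" for x
  proof -
    have "app (1 - q) x = x" using that by simp
    then show ?thesis using f_one_minus_q by (metis app_simps(6))
  qed
  ultimately show "range (app f) = ker_op (app q)" unfolding ker_op_def by blast
qed

lemma matched_proj_q: "matched_proj ip (app q) = app p"
proof -
  define R where "R = e * h"
  have he: "e * h = h * e" "e * hi = hi * e" "e * y = y * e"
    unfolding e_def by (simp_all add: nf algebra_simps)
  have R2: "R = (1/2) *\<^sub>R (h + j - j * d)" unfolding R_def e_def by (simp add: nf algebra_simps)
  have posR: "pos R" unfolding R_def by (rule pos_mult[OF proj_pos[OF proj_e] pos_h he(1)])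
  have "R * R = (1/2) *\<^sub>R (h * h + h * j - h * (j * d))"
    unfolding R2 by (rule half_mult_half) (simp add: nf algebra_simps)
  also have "\<dots> = q * dag q"
    unfolding dag_q unfolding q_def by (rule half_mult_half[symmetric]) (simp add: nf algebra_simps)
  finally have RR: "R * R = q * dag q" .
  have abs: "op_abs ip (adj ip (app q)) = app R"
    unfolding op_abs_def using op_sqrt_app[OF posR RR] by (simp add: adj_app q_LH app_mult)
  define X where "X = e * hi"
  have ee: "e * e = e" by (rule proj_idem[OF proj_e])
  have RX: "R * X = e" "X * R = e"
  proof -
    have "e * h * (h2 * e) = e" if "h * h2 = 1" for h h2
      using that ee by (metis mult.assoc mult.right_neutral)
    then show "R * X = e" "X * R = e" unfolding R_def X_def using he h_hi hi_h by metis+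
  qed
  have XL: "X \<in> LH" by (simp add: X_def LHs proj_LH[OF proj_e])
  have mp: "mp_inv ip (app R) = app X"
  proof (rule mp_inv_app[OF pos_B[OF posR] XL])
    have "e * R = R" "e * X = X" by (simp_all add: R_def X_def ee flip: mult.assoc)
    then show "R * X * R = R" "X * R * X = X" by (simp_all add: RX)
    show "sa (R * X)" "sa (X * R)" using proj_e by (simp_all add: RX proj_def)
  qed
  \<comment> \<open>On the range of \<open>e\<close> the operator \<open>R + 1\<close> is
    \<open>h + 1\<close>, with inverse \<open>y\<close>; on the complement it is the
    identity.\<close>
  define Z where "Z = e * y + (1 - e)"
  have ZL: "Z \<in> LH" by (simp add: Z_def LHs proj_LH[OF proj_e])
  have ey: "e * h * (e * y) = e - e * y" "e * y * (e * h) = e - e * y"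
  proof -
    have "e * a * (b * e) = e - e * y" if "a * b = 1 - y" for a b
    proof -
      have "e * a * (b * e) = e * (1 - y) * e" using that by (metis mult.assoc)
      also have "\<dots> = e - y * e" by (simp add: right_diff_distrib left_diff_distrib ee he mult.assoc)
      finally show ?thesis by (simp add: he)
    qed
    then show "e * h * (e * y) = e - e * y" "e * y * (e * h) = e - e * y" using he h_y y_h by metis+
  qed
  have eh0: "(1 - e) * (e * h) = 0" "e * h * (1 - e) = 0"
    by (simp_all add: he left_diff_distrib right_diff_distrib ee mult.assoc)
      (simp_all add: he ee flip: he mult.assoc)
  have ZR: "Z * (R + 1) = 1" "(R + 1) * Z = 1"
    unfolding Z_def R_def by (simp_all only: distrib_left distrib_right ey eh0) simp_all
  have inv: "op_inv ip (\<lambda>x. app R x + x) = app Z"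
  proof -
    have "app (R + 1) = (\<lambda>x. app R x + x)" by (auto simp: fun_eq_iff)
    then show ?thesis using op_inv_app[OF ZL ZR] by metis
  qed
  have "matched_proj ip (app q) = app ((1/2) *\<^sub>R ((R + dag q) * X * Z * (R + q)))"
    unfolding matched_proj_def Let_def abs mp inv by (auto simp: adj_app q_LH fun_eq_iff)
  also have "(1/2) *\<^sub>R ((R + dag q) * X * Z * (R + q)) = p"
  proof -
    \<comment> \<open>\<open>R\<close> and \<open>q\<close> both map into the range of
      \<open>e\<close>, where \<open>Z\<close> acts as \<open>y\<close>.\<close>
    have ZRq: "Z * (R + q) = y * (R + q)"
    proof -
      have "(1 - e) * (R + q) = 0" 
        by (simp add: R_def distrib_left left_diff_distrib eq ee flip: mult.assoc)
      moreover have "e * y * (R + q) = y * (R + q)"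
        by (simp add: R_def he(3) distrib_left mult.assoc eq) (simp add: ee flip: mult.assoc)
      ultimately show ?thesis by (simp add: Z_def distrib_right)
    qed
    have "dag q * e = dag q" using eq q_LH proj_e by (metis proj_LH proj_dag star_mult)
    then have "dag q * X = dag q * hi" unfolding X_def by (simp flip: mult.assoc)
    moreover have "R * X = R * hi" unfolding RX by (simp add: R_def mult.assoc h_hi)
    ultimately have "(R + dag q) * X * Z * (R + q) = ((R + dag q) * hi) * (y * (R + q))"
      using ZRq by (simp add: distrib_right mult.assoc)
    also have "(R + dag q) * hi = (1/2) *\<^sub>R ((h + j - j * d + 1 + h * j - d) * hi)"
      by (simp add: R2 dag_q algebra_simps)
    also have "y * (R + q) = (1/2) *\<^sub>R (y * (h + j - j * d + 1 + h * j + d))"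
      by (simp add: R2 q_def algebra_simps)
    also have "(1/2) *\<^sub>R ((h + j - j * d + 1 + h * j - d) * hi) *
        ((1/2) *\<^sub>R (y * (h + j - j * d + 1 + h * j + d))) = (1/2) *\<^sub>R ((1 + j) + (1 + j))"
      by (rule half_mult_half) (simp add: nf algebra_simps)
    finally show ?thesis unfolding p_def by (simp only: scaleR_half_double)
  qed
  finally show ?thesis .
qed

end

text \<open>Everything is generated by \<open>g = w * w\<close>, which commutes with
  \<open>Q\<close> and its adjoint. The bicommutant property of roots and inverses then yields all
  commutation relations of the locale.\<close>

lemma (in ip_space) idempotent_form_ex:
  assumes Q: "Q \<in> LH" and idem: "Q * Q = Q"
  obtains h hi k y j d where "idempotent_form st im_A ip im h hi k y j d"
    "Q = (1/2) *\<^sub>R (1 + h * j + d)"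
proof -
  define d where "d = Q - dag Q"
  define w where "w = Q + dag Q - 1"
  define g where "g = 1 - d * d"
  have idem': "dag Q * dag Q = dag Q" using idem Q by (metis star_mult)
  note Qs = idem idem' idem[THEN mult_eq_assoc] idem'[THEN mult_eq_assoc]
  have d: "d \<in> LH" "dag d = - d" using Q by (simp_all add: d_def)
  have w: "sa w" using Q by (simp add: w_def sa_def add.commute)
  have gQ: "Q * g = g * Q" "dag Q * g = g * dag Q"
    unfolding g_def d_def by (simp_all add: Qs algebra_simps)
  have wd: "d * w = - (w * d)" and ww: "w * w = g"
    unfolding g_def d_def w_def by (simp_all add: Qs algebra_simps)
  have posdd: "pos (- (d * d))" using pos_star_mult[OF d(1)] d by simp
  have g: "pos g" using pos_add[OF pos_1 posdd] by (simp add: g_def)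
  obtain h where h: "pos h" "h * h = g" "\<And>z. z * g = g * z \<Longrightarrow> z * h = h * z"
    using pos_sqrt_ex[OF g] by metis
  have "pos (g - 1 *\<^sub>R 1)" using posdd by (simp add: g_def)
  then obtain gi where gi: "pos gi" "gi * g = 1" "g * gi = 1" "\<And>z. z * g = g * z \<Longrightarrow> z * gi = gi * z"
    using pos_inverse_ex[OF g, of 1] by (metis zero_less_one)
  have "h * g = g * h" using h(2) by (metis mult.assoc)
  then have hgi: "h * gi = gi * h" by (rule gi(4))
  define hi where "hi = h * gi"
  have hi: "pos hi" unfolding hi_def by (rule pos_mult[OF h(1) gi(1) hgi])
  have hhi: "h * hi = 1" "hi * h = 1"
    unfolding hi_def using hgi h(2) gi(2,3) by (metis mult.assoc)+
  have h1: "pos (h + 1)" by (rule pos_add[OF h(1) pos_1])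
  have "pos (h + 1 - 1 *\<^sub>R 1)" using h(1) by simp
  then obtain y where y: "pos y" "y * (h + 1) = 1" "(h + 1) * y = 1"
      "\<And>z. z * (h + 1) = (h + 1) * z \<Longrightarrow> z * y = y * z"
    using pos_inverse_ex[OF h1, of 1] by (metis zero_less_one)
  have yh: "y * h = 1 - y" "h * y = 1 - y" using y(2,3) by (simp_all add: algebra_simps)
  have ddh: "d * d = 1 - h * h" by (simp add: h(2) g_def)
  \<comment> \<open>Exhibits \<open>h - 1\<close> as the product of the commuting positive elements
    \<open>- (d * d)\<close> and \<open>y\<close>.\<close>
  have "(h - 1) * (h + 1) = - (d * d)" "(h + 1) * (h - 1) = - (d * d)"
    unfolding ddh by (simp_all add: algebra_simps)
  then have "(- (d * d)) * y = h - 1" "y * (- (d * d)) = h - 1"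
    using y(2,3) by (metis mult.assoc mult.left_neutral mult.right_neutral)+
  then have posh1: "pos (h - 1)" using pos_mult[OF posdd y(1)] by simp
  obtain k where k: "pos k" "k * k = - (d * d)" "\<And>z. z * (- (d * d)) = - (d * d) * z \<Longrightarrow> z * k = k * z"
    using pos_sqrt_ex[OF posdd] by metis
  have comm: "z * h = h * z" "z * hi = hi * z" "z * k = k * z" "z * y = y * z" if z: "z * g = g * z" for z
  proof -
    show zh: "z * h = h * z" by (rule h(3)[OF z])
    show "z * hi = hi * z" unfolding hi_def using zh gi(4)[OF z] by (metis mult.assoc)
    show "z * k = k * z" by (rule k(3)) (use z in \<open>simp add: g_def algebra_simps\<close>)
    show "z * y = y * z" by (rule y(4)) (use zh in \<open>simp add: algebra_simps\<close>)
  qed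
  have gd: "d * g = g * d" and gw: "w * g = g * w"
    unfolding d_def w_def using gQ by (simp_all add: algebra_simps)
  define j where "j = hi * w"
  have hij: "hi * w = w * hi" using comm(2)[OF gw] by simp
  have gj: "j * g = g * j"
  proof -
    have "g * hi = hi * g" using h(2) hhi by (metis mult.assoc mult.left_neutral mult.right_neutral)
    then show ?thesis unfolding j_def using gw by (metis mult.assoc)
  qed
  have sj: "sa j" unfolding j_def by (rule sa_mult[OF pos_sa[OF hi] w hij])
  have "j * j = hi * (w * hi) * w" by (simp add: j_def mult.assoc)
  also have "\<dots> = hi * hi * (w * w)" by (simp add: hij[symmetric] mult.assoc)
  also have "\<dots> = hi * (hi * h) * h" by (simp add: ww h(2)[symmetric] mult.assoc)
  also have "\<dots> = 1" by (simp add: hhi)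
  finally have jj: "j * j = 1" .
  have dj: "d * j = - (j * d)"
  proof -
    have "d * (hi * w) = hi * (d * w)" using comm(2)[OF gd] by (metis mult.assoc)
    then show ?thesis by (simp add: j_def wd mult.assoc)
  qed
  have gh: "k * g = g * k" "hi * g = g * hi" "k * h = h * k" "k * hi = hi * k"
  proof -
    have "g = 1 + k * k" by (simp add: g_def k(2))
    then show kg: "k * g = g * k" by (simp add: algebra_simps)
    show "k * h = h * k" "k * hi = hi * k" by (rule comm[OF kg])+
    show "hi * g = g * hi" using h(2) hhi by (metis mult.assoc mult.left_neutral mult.right_neutral)
  qed
  show ?thesis
  proof (rule that[of h hi k y j d])
    show "idempotent_form st im_A ip im h hi k y j d"
    proof
      show "k * k = h * h - 1" by (simp add: k(2) ddh)
    qed (fact h(1) hi k(1) y(1) posh1 sj d hhi yh gh jj dj ddh comm[OF gj] comm[OF gd])+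
    have "h * j = w" unfolding j_def by (simp add: hhi flip: mult.assoc)
    moreover have "1 + w + d = Q + Q" by (simp add: w_def d_def)
    ultimately show "Q = (1/2) *\<^sub>R (1 + h * j + d)" by (simp only: scaleR_half_double)
  qed
qed

section \<open>Harmonious matched pairs\<close>

lemma closed_convergent_points:
  fixes X :: "nat \<Rightarrow> 'h::banach endo"
  assumes X: "\<And>n. norm (X n) \<le> 1"
  shows "closed {x. convergent (\<lambda>n. app (X n) x)}"
  unfolding closed_sequential_limits
proof (intro allI impI, elim conjE)
  fix s l assume s: "\<forall>m. s m \<in> {x. convergent (\<lambda>n. app (X n) x)}" and lim: "s \<longlonglongrightarrow> l"
  have "Cauchy (\<lambda>n. app (X n) l)"
  proof (rule CauchyI)
    fix \<epsilon> :: real assume e: "0 < \<epsilon>"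
    obtain m where m: "norm (l - s m) < \<epsilon> / 3"
      using LIMSEQ_D[OF lim, of "\<epsilon> / 3"] e by (metis divide_pos_pos norm_minus_commute order_refl zero_less_numeral)
    have "Cauchy (\<lambda>n. app (X n) (s m))" using s convergent_Cauchy by blast
    then obtain N where N: "\<And>a b. a \<ge> N \<Longrightarrow> b \<ge> N \<Longrightarrow> norm (app (X a) (s m) - app (X b) (s m)) < \<epsilon> / 3"
      using CauchyD[of _ "\<epsilon> / 3"] e by (metis divide_pos_pos zero_less_numeral)
    have small: "norm (app (X a) (l - s m)) < \<epsilon> / 3" for a
    proof -
      have "norm (app (X a) (l - s m)) \<le> norm (X a) * norm (l - s m)" by (rule norm_app)
      also have "\<dots> \<le> 1 * norm (l - s m)" by (rule mult_right_mono[OF X]) simp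
      finally show ?thesis using m by simp
    qed
    show "\<exists>M. \<forall>a\<ge>M. \<forall>b\<ge>M. norm (app (X a) l - app (X b) l) < \<epsilon>"
    proof (intro exI allI impI)
      fix a b assume ab: "N \<le> a" "N \<le> b"
      have "app (X a) l - app (X b) l = app (X a) (l - s m) - app (X b) (l - s m)
          + (app (X a) (s m) - app (X b) (s m))" by simp
      then have "norm (app (X a) l - app (X b) l) \<le> norm (app (X a) (l - s m)) + norm (app (X b) (l - s m))
          + norm (app (X a) (s m) - app (X b) (s m))"
        by (metis norm_triangle_mono norm_triangle_ineq4 order_refl)
      then show "norm (app (X a) l - app (X b) l) < \<epsilon>"
        using small[of a] small[of b] N[OF ab] by linarith
    qed
  qed
  then show "l \<in> {x. convergent (\<lambda>n. app (X n) x)}" using Cauchy_convergent by blast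
qed

context ip_space
begin

text \<open>Orthogonality alone gives \<open>ip (P z) w = ip (P z) (P w) = ip z (P w)\<close>, so
  any choice of components is self-adjoint, and thereby linear and bounded.\<close>

lemma orth_complemented_proj:
  assumes "orth_complemented ip M" obtains E where "proj E" "range (app E) = M"
proof -
  have "\<forall>z. \<exists>x. x \<in> M \<and> (\<forall>m\<in>M. ip m (z - x) = 0)"
  proof
    fix z
    obtain x y where "x \<in> M" "\<forall>m\<in>M. ip m y = 0" "z = x + y"
      using assms unfolding orth_complemented_def ortho_def by blast
    then show "\<exists>x. x \<in> M \<and> (\<forall>m\<in>M. ip m (z - x) = 0)" by (intro exI[of _ x]) simp
  qed
  then obtain P where P: "\<And>z. P z \<in> M" and orth: "\<And>z m. m \<in> M \<Longrightarrow> ip m (z - P z) = 0" by metis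
  have 1: "ip (P z) w = ip (P z) (P w)" for z w using orth[OF P[of z], of w] by (simp add: ip_diff)
  have 2: "ip z (P w) = ip (P z) (P w)" for z w
    using 1[of w z] by (metis st_ip)
  have "adjointable ip P" unfolding adjointable_def using 1 2 by metis
  then obtain E where E: "E \<in> LH" "P = app E" by (rule adjointableE)
  have dE: "dag E = E" by (rule dag_eqI) (use 1 2 E in \<open>simp add: adj_pair_def\<close>)
  have "E * E = E"
  proof (intro endo_eqI ip_eqI)
    fix z w
    show "ip z (app (E * E) w) = ip z (app E w)"
      using ip_dag(2)[OF E(1), of z "app E w"] dE 2[of z w] E by simp
  qed
  with E dE have "proj E" by (simp add: proj_def sa_def)
  moreover have "x = P x" if "x \<in> M" for x
  proof -
    have "ip (x - P x) (x - P x) = 0" using orth[OF that, of x] orth[OF P, of x x] by (simp add: ip_diff_left)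
    then show ?thesis using norm_ip_self[of "x - P x"] by simp
  qed
  then have "range P = M" using P by blast
  ultimately show ?thesis using that E by blast
qed

lemma app_eq_closed: "closed {x. app X x = app Y x}"
  by (intro closed_Collect_eq continuous_intros linear_continuous_on app.bounded_linear_right)

text \<open>Extends an operator identity by continuity from the range of \<open>T\<close> to its
  closure.\<close>

lemma mult_eq_if_closure_range:
  assumes "range (app E) \<subseteq> closure (range (app T))" "X * T = Y * T" shows "X * E = Y * E"
proof (rule endo_eqI)
  fix x
  have "range (app T) \<subseteq> {x. app X x = app Y x}" using assms(2) by (auto simp flip: app_simps(6))
  then have "closure (range (app T)) \<subseteq> {x. app X x = app Y x}" using app_eq_closed by (rule closure_minimal)
  then show "app (X * E) x = app (Y * E) x" using assms(1) by auto
qed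

lemma proj_mult_eq: "proj E \<Longrightarrow> range (app T) \<subseteq> range (app E) \<Longrightarrow> E * T = T"
  by (intro endo_eqI) (use proj_app_range in auto)

text \<open>The range of \<open>T\<close> is invariant under \<open>c\<close>, so
  \<open>E * c * E = c * E\<close>; self-adjointness of \<open>c\<close> makes the complement
  invariant too.\<close>

lemma proj_commute:
  assumes E: "proj E" "range (app E) = closure (range (app T))" and c: "sa c" "c * T = T * c"
  shows "c * E = E * c"
proof -
  have ET: "E * T = T" by (rule proj_mult_eq[OF E(1)]) (simp add: E(2) closure_subset)
  have "E * c * T = E * T * c" by (simp add: mult.assoc c(2))
  then have "E * c * T = c * T" by (simp add: ET c(2))
  then have 1: "E * c * E = c * E" by (rule mult_eq_if_closure_range[rotated]) (simp add: E(2))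
  have "E * c * E = dag (E * c * E)"
    using E(1) c(1) by (simp add: proj_LH proj_dag sa_B sa_star mult.assoc)
  also have "\<dots> = E * c" unfolding 1 using E(1) c(1) by (simp add: proj_LH proj_dag sa_B sa_star)
  finally have "E * c * E = E * c" .
  with 1 show ?thesis by simp
qed

lemma proj_app_eq_0:
  assumes "proj E" "range (app E) = closure (range (app T))" "T \<in> LH" "app (dag T) x = 0"
  shows "app E x = 0"
proof (rule ip_eqI)
  fix z
  interpret ipb: bounded_bilinear ip by (rule bounded_bilinear_ip)
  have "closed {y. ip y x = 0}"
    by (intro closed_Collect_eq continuous_intros linear_continuous_on ipb.bounded_linear_left)
  moreover have "range (app T) \<subseteq> {y. ip y x = 0}" using assms by (auto simp: ip_dag(1) ip_zero)
  ultimately have "closure (range (app T)) \<subseteq> {y. ip y x = 0}" by (intro closure_minimal)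
  then have "ip (app E z) x = 0" using assms(2) by auto
  then show "ip z (app E x) = ip z 0" using assms(1) by (simp add: ip_dag(1) proj_LH proj_dag ip_zero)
qed

text \<open>A strong limit need not have an adjoint on a Hilbert module. Skewness supplies one,
  namely the negative of the limit.\<close>

lemma strong_limit_skew:
  assumes X: "\<And>n. X n \<in> LH" "\<And>n. dag (X n) = - X n" and conv: "\<And>x. convergent (\<lambda>n. app (X n) x)"
  obtains u where "u \<in> LH" "dag u = - u" "\<And>x. (\<lambda>n. app (X n) x) \<longlonglongrightarrow> app u x"
proof -
  define U where "U x = lim (\<lambda>n. app (X n) x)" for x
  have lim: "(\<lambda>n. app (X n) x) \<longlonglongrightarrow> U x" for x
    unfolding U_def using conv convergent_LIMSEQ_iff by blast
  interpret ipb: bounded_bilinear ip by (rule bounded_bilinear_ip)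
  have skew: "ip (U x) y = ip x (- U y)" for x y
  proof -
    have "(\<lambda>n. ip (app (X n) x) y) \<longlonglongrightarrow> ip (U x) y" by (intro ipb.tendsto lim tendsto_const)
    moreover have "(\<lambda>n. ip x (- app (X n) y)) \<longlonglongrightarrow> ip x (- U y)"
      by (intro ipb.tendsto lim tendsto_const tendsto_minus)
    moreover have "ip (app (X n) x) y = ip x (- app (X n) y)" for n
      by (simp add: ip_dag(1)[OF X(1)] X(2))
    ultimately show ?thesis using LIMSEQ_unique by simp
  qed
  then have "adjointable ip U" unfolding adjointable_def by (intro exI[of _ "\<lambda>y. - U y"]) simp
  then obtain u where u: "u \<in> LH" "U = app u" by (rule adjointableE)
  moreover have "dag u = - u" by (rule dag_eqI) (use skew u in \<open>simp add: adj_pair_def\<close>)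
  ultimately show ?thesis using that lim by simp
qed

end

section \<open>The four orthogonal submodules and the polar decomposition of
  \<open>d\<close>\<close>

locale harmonious_form = idempotent_form +
  fixes E5 E6
  assumes E5: "proj E5" and rE5: "range (app E5) = closure (range (app (p * d)))"
    and E6: "proj E6" and rE6: "range (app E6) = closure (range (app (d * p)))"
begin

text \<open>\<open>d\<close> anticommutes with the symmetry \<open>2 p - 1\<close>, so it exchanges
  the ranges of \<open>p\<close> and \<open>1 - p\<close>.\<close>

lemma dp: "d * p = d - p * d" and pd: "p * d + d * p = d"
proof -
  have "(d + d) = (1 + j) * d + d * (1 + j)" by (simp add: nf algebra_simps)
  then have "(1/2) *\<^sub>R (d + d) = (1/2) *\<^sub>R ((1 + j) * d + d * (1 + j))" by (rule arg_cong)
  then show "p * d + d * p = d" by (simp only: scaleR_half_double) (simp add: p_def algebra_simps)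
  then show "d * p = d - p * d" by (simp add: algebra_simps)
qed

lemma pp: "p * p = p" by (rule proj_idem[OF proj_p])

lemma p_central: "p * h = h * p" "p * hi = hi * p" "p * k = k * p" "p * y = y * p"
  by (simp_all add: p_def nf algebra_simps)

lemma E5_pd: "E5 * (p * d) = p * d" and E6_dp: "E6 * (d * p) = d * p"
  by (rule proj_mult_eq[OF E5] proj_mult_eq[OF E6]; simp only: rE5 rE6 closure_subset)+

lemma p_dp: "p * (d * p) = 0"
  by (simp add: dp right_diff_distrib pp flip: mult.assoc)

lemma p_E5: "p * E5 = E5" and p_E6: "p * E6 = 0"
proof -
  have "p * E5 = 1 * E5"
    by (rule mult_eq_if_closure_range[of _ "p * d"]) (use rE5 in \<open>simp_all add: pp flip: mult.assoc\<close>)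
  then show "p * E5 = E5" by simp
  have "p * E6 = 0 * E6"
    by (rule mult_eq_if_closure_range[of _ "d * p"]) (use rE6 p_dp in \<open>simp_all\<close>)
  then show "p * E6 = 0" by simp
qed

lemma E5_p: "E5 * p = E5" and E6_p: "E6 * p = 0"
  using arg_cong[OF p_E5, of dag] arg_cong[OF p_E6, of dag] proj_p E5 E6
  by (simp_all add: proj_LH proj_dag)

lemma E5_E6: "E5 * E6 = 0" and E6_E5: "E6 * E5 = 0"
proof -
  have "E5 * E6 = E5 * (p * E6)" by (simp add: E5_p flip: mult.assoc)
  then show "E5 * E6 = 0" by (simp add: p_E6)
  have "E6 * E5 = E6 * (p * E5)" by (simp add: p_E5)
  then show "E6 * E5 = 0" by (simp add: E6_p flip: mult.assoc)
qed

lemma E55: "E5 * E5 = E5" and E66: "E6 * E6 = E6"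
  using E5 E6 proj_idem by blast+

lemma E5_d: "E5 * d = p * d" and E6_d: "E6 * d = d * p"
proof -
  have "E5 * d = E5 * p * d" by (simp add: E5_p)
  then show "E5 * d = p * d" by (simp add: mult.assoc E5_pd)
  have "E6 * d = E6 * (p * d) + E6 * (d * p)" by (simp flip: distrib_left add: pd)
  moreover have "E6 * (p * d) = 0" by (simp add: E6_p flip: mult.assoc)
  ultimately show "E6 * d = d * p" by (simp add: E6_dp)
qed

lemma d_E5: "d * E5 = d * p" and d_E6: "d * E6 = p * d"
  using arg_cong[OF E5_d, of dag] arg_cong[OF E6_d, of dag] proj_p E5 E6
  by (simp_all add: proj_LH proj_dag d_LH dag_d)

lemma E_commute:
  assumes "sa c" "c * p = p * c" "c * d = d * c"
  shows "c * E5 = E5 * c" "c * E6 = E6 * c"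
proof -
  have "c * (p * d) = p * d * c" "c * (d * p) = d * p * c"
    using assms(2,3) by (metis mult.assoc)+
  then show "c * E5 = E5 * c" "c * E6 = E6 * c"
    using proj_commute[OF E5 rE5 assms(1)] proj_commute[OF E6 rE6 assms(1)] by blast+
qed

lemma E5_central: "E5 * h = h * E5" "E5 * hi = hi * E5" "E5 * k = k * E5" "E5 * y = y * E5"
  and E6_central: "E6 * h = h * E6" "E6 * hi = hi * E6" "E6 * k = k * E6" "E6 * y = y * E6"
  by (rule E_commute[symmetric]; simp add: pos_sa pos_h pos_hi pos_k pos_y p_central nf)+

text \<open>These turn out to be the projections onto \<open>H1\<close> and \<open>H4\<close>, where
  \<open>d\<close> vanishes.\<close>

definition n1 where "n1 = p - E5"
definition n4 where "n4 = 1 - p - E6"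

lemma proj_n1: "proj n1" and proj_n4: "proj n4"
  unfolding n1_def n4_def proj_def sa_def
  by (simp_all add: proj_LH proj_dag E5 E6 proj_p algebra_simps pp E55 E66 p_E5 E5_p p_E6 E6_p)

lemma d_n1: "d * n1 = 0" and d_n4: "d * n4 = 0"
  by (simp_all add: n1_def n4_def algebra_simps d_E5 d_E6 pd dp)

text \<open>\<open>h * h - 1 = - (d * d)\<close> kills \<open>n\<close>, and the factor
  \<open>h + 1\<close> is invertible.\<close>

lemma h_fix: assumes "d * n = 0" shows "h * n = n" "hi * n = n"
proof -
  have "(h + 1) * ((h - 1) * n) = - (d * (d * n))" by (simp add: nf algebra_simps)
  then have "y * ((h + 1) * ((h - 1) * n)) = 0" using assms by simp
  moreover have "y * (h + 1) = 1" by (simp add: distrib_left y_h)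
  ultimately have "(h - 1) * n = 0" using mult_eq_assoc[of y "h + 1" 1] by simp
  then show hn: "h * n = n" by (simp add: left_diff_distrib)
  have "hi * n = hi * (h * n)" by (simp add: hn)
  then show "hi * n = n" by (simp add: hi_h flip: mult.assoc)
qed

lemma p_add_p: "p + p = 1 + j"
  unfolding p_def by (simp flip: scaleR_2)

lemma j_mult: "j * z = p * z + p * z - z"
  using arg_cong[OF p_add_p, of "\<lambda>t. t * z"] by (simp add: distrib_right)

lemma app_j: "app j x = app p x + app p x - x"
  using arg_cong[OF p_add_p, of "\<lambda>t. app t x"] by simp

lemma j_E5: "j * E5 = E5" and j_E6: "j * E6 = - E6" and j_n1: "j * n1 = n1" and j_n4: "j * n4 = - n4"
  by (simp_all add: j_mult n1_def n4_def algebra_simps p_E5 p_E6 pp p_add_p)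

lemma q_n1: "q * n1 = n1" and q_n4: "q * n4 = 0"
  unfolding q_def
  by (simp_all add: distrib_right mult.assoc j_n1 j_n4 d_n1 d_n4 h_fix[OF d_n1] h_fix[OF d_n4] scaleR_half_double)

lemma p_n1: "p * n1 = n1" and p_n4: "p * n4 = 0"
  by (simp_all add: n1_def n4_def right_diff_distrib pp p_E5 p_E6)

lemma app_q: "app q x = (1/2) *\<^sub>R (x + app h (app j x) + app d x)"
  by (simp add: q_def)

text \<open>A vector fixed by \<open>p\<close> and \<open>q\<close> satisfies
  \<open>h x + d x = x\<close> with \<open>h x\<close> in the range of \<open>p\<close> and
  \<open>d x\<close> in that of \<open>1 - p\<close>. Hence \<open>d x = 0\<close>, and
  \<open>x\<close> is orthogonal to \<open>H5\<close>.\<close>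

lemma range_n1: "range (app n1) = range (app p) \<inter> range (app q)"
proof -
  have "app n1 z \<in> range (app p) \<inter> range (app q)" for z
    using p_n1 q_n1 by (metis IntI app_simps(6) rangeI)
  moreover have "x = app n1 x" if x: "x \<in> range (app p)" "x \<in> range (app q)" for x
  proof -
    have px: "app p x = x" using proj_app_range[OF proj_p] x by blast
    have qx: "app q x = x"
    proof -
      obtain z where "x = app q z" using x(2) by blast
      then show ?thesis using qe eq by (metis app_simps(6))
    qed
    have jx: "app j x = x" by (simp add: app_j px)
    have "x + app h x + app d x = 2 *\<^sub>R app q x" by (simp add: app_q jx)
    then have hd: "app h x + app d x = x" by (simp add: qx scaleR_2 add.assoc)
    have ph: "app p (app h x) = app h x" using p_central(1) px by (metis app_simps(6))
    have "app (p * d) x = app d x - app d (app p x)" using dp by (metis app_simps(4,6) diff_diff_eq2 add_diff_cancel_left')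
    then have pdx: "app p (app d x) = 0" by (simp add: px)
    have "app p (app h x + app d x) = x" by (simp add: hd px)
    then have "app h x = x" by (simp add: ph pdx)
    then have "app d x = 0" using hd by simp
    then have "app E5 x = 0"
      by (intro proj_app_eq_0[OF E5 rE5]) (simp_all add: proj_LH[OF proj_p] proj_dag[OF proj_p] d_LH dag_d px)
    then show ?thesis by (simp add: n1_def px)
  qed
  ultimately show ?thesis by blast
qed

lemma proj_onto_H1: "proj_onto ip (range (app p) \<inter> range (app q)) = app n1"
  by (rule proj_onto_app[OF proj_n1 range_n1])

lemma range_n4: "range (app n4) = ker_op (app p) \<inter> ker_op (app q)"
proof -
  have "app n4 z \<in> ker_op (app p) \<inter> ker_op (app q)" for z
    unfolding ker_op_def using p_n4 q_n4 by (simp flip: app_simps(6))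
  moreover have "x = app n4 x" if x: "app p x = 0" "app q x = 0" for x
  proof -
    have jx: "app j x = - x" by (simp add: app_j x)
    have "x - app h x + app d x = 2 *\<^sub>R app q x" by (simp add: app_q jx)
    then have hd: "x - app h x + app d x = 0" by (simp add: x)
    have ph: "app p (app h x) = 0" using p_central(1) x by (metis app_simps(6) app.zero_right)
    have "app (p * d) x = app d x - app d (app p x)" using dp by (metis app_simps(4,6) diff_diff_eq2 add_diff_cancel_left')
    then have pdx: "app p (app d x) = app d x" by (simp add: x)
    have "app p (x - app h x + app d x) = 0" by (simp add: hd)
    then have "app d x = 0" by (simp add: ph pdx x)
    then have "app E6 x = 0"
      by (intro proj_app_eq_0[OF E6 rE6]) (simp_all add: proj_LH[OF proj_p] proj_dag[OF proj_p] d_LH dag_d)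
    then show ?thesis by (simp add: n4_def x)
  qed
  ultimately show ?thesis unfolding ker_op_def by blast
qed

lemma proj_onto_H4: "proj_onto ip (ker_op (app p) \<inter> ker_op (app q)) = app n4"
  by (rule proj_onto_app[OF proj_n4 range_n4])

text \<open>The polar decomposition \<open>d = u k\<close>; the hypothesis that the closed ranges are complemented
  makes the operators \<open>d (k + \<epsilon>)\<^sup>-\<^sup>1\<close> converge strongly as \<open>\<epsilon>\<close> tends to 0.\<close>

lemma polar_decomposition:
  obtains u where "u \<in> LH" "dag u = - u" "u * k = d" "u * d = - k" "j * u = - (u * j)"
    "u * h = h * u" "u * hi = hi * u" "u * n1 = 0" "u * n4 = 0"
proof -
  define \<epsilon> where "\<epsilon> n = inverse (real (Suc n))" for n
  have e0: "0 < \<epsilon> n" for n by (simp add: \<epsilon>_def)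
  have "\<exists>v. pos v \<and> v * (k + \<epsilon> n *\<^sub>R 1) = 1 \<and> (k + \<epsilon> n *\<^sub>R 1) * v = 1 \<and>
      (\<forall>z. z * (k + \<epsilon> n *\<^sub>R 1) = (k + \<epsilon> n *\<^sub>R 1) * z \<longrightarrow> z * v = v * z)" for n
  proof -
    have "pos (k + \<epsilon> n *\<^sub>R 1)" using pos_add[OF pos_k pos_scaleR_one] e0[of n] by simp
    moreover have "pos (k + \<epsilon> n *\<^sub>R 1 - \<epsilon> n *\<^sub>R 1)" using pos_k by simp
    ultimately show ?thesis using pos_inverse_ex[OF _ e0[of n]] by metis
  qed
  then obtain v where pv: "\<And>n. pos (v n)" and vk': "\<And>n. v n * (k + \<epsilon> n *\<^sub>R 1) = 1"
      "\<And>n. (k + \<epsilon> n *\<^sub>R 1) * v n = 1"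
      and vc': "\<And>n z. z * (k + \<epsilon> n *\<^sub>R 1) = (k + \<epsilon> n *\<^sub>R 1) * z \<Longrightarrow> z * v n = v n * z"
    by metis
  have vk: "v n * k = 1 - \<epsilon> n *\<^sub>R v n" "k * v n = 1 - \<epsilon> n *\<^sub>R v n" for n
    using vk'[of n] by (simp_all add: algebra_simps)
  have vc: "z * v n = v n * z" if "z * k = k * z" for n z
    by (rule vc') (simp add: algebra_simps that)
  define X where "X n = d * v n" for n
  have XL: "X n \<in> LH" for n by (simp add: X_def d_LH pos_B[OF pv])
  have dv: "d * v n = v n * d" for n by (rule vc[OF d_k])
  have dagX: "dag (X n) = - X n" for n
    by (simp add: X_def d_LH dag_d pos_B[OF pv] pos_star[OF pv] dv)
  \<comment> \<open>\<open>k (k + \<epsilon>)^(-1)\<close> lies between 0 and 1. Its square is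
    \<open>dag (X n) * X n\<close>, so the \<open>X n\<close> are contractions.\<close>
  have nkv: "norm (k * v n) \<le> 1" for n
  proof (rule pos_norm_le)
    show "pos (k * v n)" by (rule pos_mult[OF pos_k pv]) (simp add: vk)
    show "pos (1 *\<^sub>R 1 - k * v n)" using pos_scaleR[OF pv, of "\<epsilon> n"] e0[of n] by (simp add: vk)
  qed simp
  have nX: "norm (X n) \<le> 1" for n
  proof -
    have "dag (X n) * X n = - (d * (v n * d) * v n)" by (simp add: dagX) (simp add: X_def mult.assoc)
    also have "\<dots> = - (d * d * v n * v n)" by (simp add: dv[symmetric] mult.assoc)
    also have "\<dots> = k * k * v n * v n" by (simp add: dd kk left_diff_distrib)
    also have "\<dots> = k * (k * v n) * v n" by (simp add: mult.assoc)
    also have "\<dots> = (k * v n) * (k * v n)" 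
    proof -
      have "k * v n = v n * k" by (simp add: vk)
      then show ?thesis by (metis mult.assoc)
    qed
    finally have "(norm (X n))\<^sup>2 \<le> norm (k * v n) * norm (k * v n)"
      using cstar_norm[OF XL, of n] norm_mult_ineq[of "k * v n" "k * v n"] by simp
    also have "\<dots> \<le> 1" using nkv[of n] by (simp add: mult_le_one)
    finally show ?thesis by (simp add: power_le_one_iff)
  qed
  have lim_e: "\<epsilon> \<longlonglongrightarrow> 0" unfolding \<epsilon>_def by (rule LIMSEQ_inverse_real_of_nat)
  have Xk: "(\<lambda>n. X n * k) \<longlonglongrightarrow> d"
  proof (rule LIM_zero_cancel[OF Lim_null_comparison[OF _ lim_e]], rule eventuallyI)
    fix n
    have "X n * k - d = - (\<epsilon> n *\<^sub>R X n)" by (simp add: X_def mult.assoc vk right_diff_distrib)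
    then show "norm (X n * k - d) \<le> \<epsilon> n" using nX[of n] e0[of n] by (simp add: mult_left_le)
  qed
  have Xd: "(\<lambda>n. X n * d) \<longlonglongrightarrow> - k"
  proof (rule LIM_zero_cancel[OF Lim_null_comparison[OF _ lim_e]], rule eventuallyI)
    fix n
    have "X n * d = d * d * v n" by (simp add: X_def mult.assoc flip: dv)
    also have "\<dots> = - (k * (k * v n))" by (simp add: nf left_diff_distrib right_diff_distrib flip: mult.assoc)
    also have "\<dots> = - k + \<epsilon> n *\<^sub>R (k * v n)" by (simp add: vk(2) right_diff_distrib)
    finally show "norm (X n * d - - k) \<le> \<epsilon> n" using nkv[of n] e0[of n] by (simp add: mult_left_le)
  qed
  \<comment> \<open>\<open>z'\<close> is what \<open>z\<close> becomes on passing \<open>d\<close>: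
    \<open>j\<close> turns into \<open>- j\<close>, and \<open>1 - p\<close> into
    \<open>p\<close>.\<close>
  have X_comm: "z * X n = X n * z'" if "z * k = k * z" "z * d = d * z'" "z' * k = k * z'" for n z z'
    unfolding X_def using that vc[OF that(3), of n] by (metis mult.assoc)
  have Xn: "X n * n' = 0" if "d * n' = 0" for n n'
    unfolding X_def dv by (simp add: mult.assoc that)
  have conv: "convergent (\<lambda>n. app (X n) x)" for x
  proof -
    let ?S = "{x. convergent (\<lambda>n. app (X n) x)}"
    have convd: "(\<lambda>n. app (X n) (app d z)) \<longlonglongrightarrow> app (- k) z" for z
      using app.tendsto[OF Xd tendsto_const, of z] by simp
    have cl: "closed ?S" by (rule closed_convergent_points[OF nX])
    have "app (p * d) z \<in> ?S" for z
    proof -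
      \<comment> \<open>Convergence is known on the range of \<open>d\<close>. Moving
        \<open>p\<close> across \<open>X n\<close> carries it over to the range of
        \<open>p * d\<close>.\<close>
      have "(1 - p) * X n = X n * p" for n
        by (rule X_comm) (simp_all add: left_diff_distrib right_diff_distrib p_central dp)
      then have "app (X n) (app p w) = app (1 - p) (app (X n) w)" for n w by (metis app_simps(6))
      then have "(\<lambda>n. app (X n) (app (p * d) z)) = (\<lambda>n. app (1 - p) (app (X n) (app d z)))"
        by (simp only: app_simps(6))
      moreover have "(\<lambda>n. app (1 - p) (app (X n) (app d z))) \<longlonglongrightarrow> app (1 - p) (app (- k) z)"
        by (intro app.tendsto tendsto_const convd)
      ultimately show ?thesis by (auto simp: convergent_def)
    qed
    then have "closure (range (app (p * d))) \<subseteq> ?S" by (intro closure_minimal[OF _ cl]) blast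
    then have 5: "app E5 x \<in> ?S" using rE5 by blast
    have "app (d * p) z \<in> ?S" for z using convd[of "app p z"] by (auto simp: convergent_def)
    then have "closure (range (app (d * p))) \<subseteq> ?S" by (intro closure_minimal[OF _ cl]) blast
    then have 6: "app E6 x \<in> ?S" using rE6 by blast
    have n: "app n1 x \<in> ?S" "app n4 x \<in> ?S"
      using Xn[OF d_n1] Xn[OF d_n4] by (simp_all add: convergent_const flip: app_simps(6))
    have "x = app E5 x + app E6 x + app n1 x + app n4 x" by (simp add: n1_def n4_def)
    then have "app (X n) x = app (X n) (app E5 x) + app (X n) (app E6 x) + app (X n) (app n1 x) + app (X n) (app n4 x)" for n
      by (metis app.add_right)
    then show ?thesis using 5 6 n by (simp add: convergent_add)
  qed
  obtain u where u: "u \<in> LH" "dag u = - u" "\<And>x. (\<lambda>n. app (X n) x) \<longlonglongrightarrow> app u x"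
    using strong_limit_skew[OF XL dagX conv] by blast
  have ulim: "u * a = b" if "(\<lambda>n. X n * a) \<longlonglongrightarrow> b" for a b
  proof (rule endo_eqI)
    fix x
    have "(\<lambda>n. app (X n * a) x) \<longlonglongrightarrow> app b x" by (intro app.tendsto that tendsto_const)
    then show "app (u * a) x = app b x" using LIMSEQ_unique[OF u(3)[of "app a x"]] by simp
  qed
  have ucomm: "z * u = u * z'" if zz: "\<And>n. z * X n = X n * z'" for z z'
  proof (rule endo_eqI)
    fix x
    have "(\<lambda>n. app z (app (X n) x)) \<longlonglongrightarrow> app z (app u x)" by (intro app.tendsto tendsto_const u(3))
    moreover have "app z (app (X n) x) = app (X n) (app z' x)" for n using zz by (metis app_simps(6))
    ultimately have "(\<lambda>n. app (X n) (app z' x)) \<longlonglongrightarrow> app z (app u x)" by simp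
    then show "app (z * u) x = app (u * z') x" using LIMSEQ_unique[OF u(3)[of "app z' x"]] by simp
  qed
  show ?thesis
  proof (rule that[OF u(1,2)])
    show "u * k = d" "u * d = - k" by (rule ulim[OF Xk], rule ulim[OF Xd])
    show "u * n1 = 0" "u * n4 = 0" using ulim[of n1 0] ulim[of n4 0] Xn[OF d_n1] Xn[OF d_n4] by simp_all
    have "j * u = u * (- j)" by (rule ucomm, rule X_comm) (simp_all add: nf)
    then show "j * u = - (u * j)" by simp
    show "u * h = h * u" "u * hi = hi * u" by (rule ucomm[symmetric], rule X_comm; simp add: nf)+
  qed
qed

text \<open>\<open>Aop\<close> is the compression of \<open>q\<close> to \<open>H5\<close>, and
  \<open>Bop\<close> is \<open>Aop\<close> times the corner inverse of \<open>2 Aop - E5\<close>,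
  which is \<open>h\<close> on \<open>H5\<close>. \<open>Cop\<close> is the product of the roots of
  \<open>Bop\<close> and \<open>IBop\<close>, since \<open>(1 - hi * hi) / 4\<close> is the square
  of \<open>k * hi / 2\<close>.\<close>

definition Aop where "Aop = (1/2) *\<^sub>R (E5 * (h + 1))"
definition Bop where "Bop = (1/2) *\<^sub>R (E5 * (1 + hi))"
definition IBop where "IBop = (1/2) *\<^sub>R (E5 * (1 - hi))"
definition Cop where "Cop = (1/2) *\<^sub>R (E5 * (k * hi))"

lemma E5_LH: "E5 \<in> LH" and dag_E5: "dag E5 = E5"
  using E5 by (simp_all add: proj_LH proj_dag)

lemma Aop_LH: "Aop \<in> LH"
  by (simp add: Aop_def E5_LH LHs)

lemma E5_sandwich: assumes "E5 * c = c * E5" shows "E5 * (E5 * c) * E5 = E5 * c"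
  using assms E55 by (metis mult.assoc)

lemma E5_comm_plus: "E5 * (h + 1) = (h + 1) * E5" "E5 * (1 + hi) = (1 + hi) * E5"
  "E5 * (1 - hi) = (1 - hi) * E5" "E5 * (h - 1) = (h - 1) * E5"
  by (simp_all add: algebra_simps E5_central)

lemma Aop_corner: "E5 * Aop * E5 = Aop"
  unfolding Aop_def using E5_sandwich[OF E5_comm_plus(1)] by simp

lemma Aop_minus: "Aop - E5 = (1/2) *\<^sub>R (E5 * (h - 1))"
proof -
  have "Aop - E5 = (1/2) *\<^sub>R (E5 * (h + 1) - (E5 + E5))"
    unfolding Aop_def scaleR_diff_right scaleR_half_double ..
  then show ?thesis by (simp add: algebra_simps)
qed

lemma pos_Aop_minus: "pos (Aop - E5)"
  unfolding Aop_minus by (intro pos_scaleR pos_mult[OF proj_pos[OF E5] pos_h1] E5_comm_plus) simp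

lemma corner_pos_Aop_minus: "corner_pos ip (app E5) (app (Aop - E5))"
  by (rule corner_pos_app[OF pos_Aop_minus E5])
    (use E5_sandwich[OF E5_comm_plus(4)] in \<open>simp add: Aop_minus\<close>)

text \<open>\<open>p d d p\<close> factors through \<open>Aop - E5\<close>, because
  \<open>h - 1\<close> vanishes on \<open>H1\<close>. Density then comes from
  \<open>p d = p d E6\<close>: the range of \<open>d p\<close> is dense in \<open>H6\<close>, so
  \<open>p d d p\<close> has dense range in \<open>H5\<close>.\<close>

lemma closure_range_Aop_minus: "closure (range (app (Aop - E5))) = range (app E5)"
proof
  have cl: "closed (range (app E5))" by (simp add: rE5)
  have "Aop - E5 = E5 * ((1/2) *\<^sub>R (h - 1))" by (simp add: Aop_minus)
  then have "range (app (Aop - E5)) \<subseteq> range (app E5)" by (metis app_simps(6) image_subsetI rangeI)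
  then show "closure (range (app (Aop - E5))) \<subseteq> range (app E5)" by (rule closure_minimal[OF _ cl])
  have fac: "p * d * (d * p) = (Aop - E5) * (- 2 *\<^sub>R (h + 1))"
  proof -
    have "(h - 1) * n1 = 0" by (simp add: left_diff_distrib h_fix[OF d_n1])
    then have "(h + 1) * ((h - 1) * n1) = 0" by simp
    then have n: "(h + 1) * ((h - 1) * p) = (h + 1) * ((h - 1) * E5)" by (simp add: n1_def right_diff_distrib)
    have "p * d * (d * p) = p * (d * d) * p" by (simp add: mult.assoc)
    also have "\<dots> = - ((h + 1) * ((h - 1) * p))"
      by (simp add: dd left_diff_distrib right_diff_distrib distrib_right mult.assoc p_central p_central[THEN mult_eq_assoc] pp)
    also have "\<dots> = - (E5 * (h - 1) * (h + 1))"
      unfolding n by (simp add: algebra_simps E5_central E5_central[THEN mult_eq_assoc])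
    finally show ?thesis by (simp add: Aop_minus)
  qed
  have "app (p * d) z \<in> closure (range (app (Aop - E5)))" for z
  proof -
    have "p * d * E6 = p * d" by (simp add: mult.assoc d_E6) (simp add: pp flip: mult.assoc)
    then have "app (p * d) z = app (p * d) (app E6 z)" by (metis app_simps(6))
    moreover have "app E6 z \<in> closure (range (app (d * p)))" using rE6 by blast
    ultimately have "app (p * d) z \<in> app (p * d) ` closure (range (app (d * p)))" by blast
    also have "\<dots> \<subseteq> closure (app (p * d) ` range (app (d * p)))"
      by (intro image_closure_subset linear_continuous_on app.bounded_linear_right closed_closure closure_subset)
    finally have "app (p * d) z \<in> closure (app (p * d) ` range (app (d * p)))" .
    moreover have "app (p * d) ` range (app (d * p)) \<subseteq> range (app (Aop - E5))"
    proof clarify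
      fix w
      have "app (p * d) (app (d * p) w) = app (Aop - E5) (app (- 2 *\<^sub>R (h + 1)) w)"
        using fac by (metis app_simps(6))
      then show "app (p * d) (app (d * p) w) \<in> range (app (Aop - E5))" by blast
    qed
    ultimately show ?thesis using closure_mono by blast
  qed
  then show "range (app E5) \<subseteq> closure (range (app (Aop - E5)))"
    unfolding rE5 by (intro closure_minimal) auto
qed

lemma two_Aop_minus: "2 *\<^sub>R Aop - E5 = E5 * h"
  by (simp add: Aop_def distrib_left)

lemma corner_inv_E5_h: "corner_inv ip (app E5) (app (E5 * h)) = app (E5 * hi)"
proof (rule corner_inv_app[OF E5])
  show "E5 * hi \<in> LH" by (simp add: E5_LH LHs)
  show "E5 * (E5 * hi) * E5 = E5 * hi" by (rule E5_sandwich[OF E5_central(2)])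
  show "E5 * hi * (E5 * h) = E5" "E5 * h * (E5 * hi) = E5"
    by (simp_all add: mult.assoc E5_central E55 nf E55[THEN mult_eq_assoc] E5_central[THEN mult_eq_assoc])
qed

lemma Aop_inv: "Aop * (E5 * hi) = Bop"
  unfolding Aop_def Bop_def
  by (simp add: algebra_simps E5_central E55 nf E5_central[THEN mult_eq_assoc])

lemma E5_minus_Bop: "E5 - Bop = IBop"
proof -
  have "E5 - Bop = (1/2) *\<^sub>R ((E5 + E5) - E5 * (1 + hi))"
    unfolding Bop_def scaleR_diff_right scaleR_half_double ..
  then show ?thesis by (simp add: IBop_def algebra_simps)
qed

lemma E5_mult_ops: "E5 * Bop = Bop" "E5 * IBop = IBop" "E5 * Cop = Cop"
  by (simp_all add: Bop_def IBop_def Cop_def E55[THEN mult_eq_assoc])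

lemma pos_one_minus_hi: "pos (1 - hi)"
proof -
  have "pos (hi * (h - 1))" by (rule pos_mult[OF pos_hi pos_h1]) (simp add: algebra_simps nf)
  then show ?thesis by (simp add: right_diff_distrib hi_h)
qed

text \<open>The roots are taken in \<open>LH\<close> and cut down by \<open>E5\<close>, which
  commutes with them. Their product is identified by uniqueness of positive roots.\<close>

lemma corner_sqrts: "corner_sqrt ip (app E5) (app Bop) \<circ> corner_sqrt ip (app E5) (app IBop) = app Cop"
proof -
  have pp1: "pos ((1/2) *\<^sub>R (1 + hi))" using pos_add[OF pos_1 pos_hi] pos_scaleR by simp
  have pp2: "pos ((1/2) *\<^sub>R (1 - hi))" using pos_one_minus_hi pos_scaleR by simp
  obtain s1 where s1: "pos s1" "s1 * s1 = (1/2) *\<^sub>R (1 + hi)"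
      "\<And>z. z * ((1/2) *\<^sub>R (1 + hi)) = ((1/2) *\<^sub>R (1 + hi)) * z \<Longrightarrow> z * s1 = s1 * z"
    using pos_sqrt_ex[OF pp1] by metis
  obtain s2 where s2: "pos s2" "s2 * s2 = (1/2) *\<^sub>R (1 - hi)"
      "\<And>z. z * ((1/2) *\<^sub>R (1 - hi)) = ((1/2) *\<^sub>R (1 - hi)) * z \<Longrightarrow> z * s2 = s2 * z"
    using pos_sqrt_ex[OF pp2] by metis
  have E1: "E5 * s1 = s1 * E5" by (rule s1(3)) (simp add: E5_comm_plus)
  have E2: "E5 * s2 = s2 * E5" by (rule s2(3)) (simp add: E5_comm_plus)
  have "hi * s1 = s1 * hi" by (rule s1(3)) (simp add: algebra_simps)
  then have s12: "s1 * s2 = s2 * s1" by - (rule s2(3), simp add: algebra_simps)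
  have sq1: "corner_sqrt ip (app E5) (app Bop) = app (E5 * s1)"
  proof (rule corner_sqrt_app[OF pos_mult[OF proj_pos[OF E5] s1(1) E1] E5 E5_sandwich[OF E1]])
    show "E5 * s1 * (E5 * s1) = Bop" by (simp add: mult_commute_middle[OF E1] s1(2) Bop_def E55)
  qed
  have sq2: "corner_sqrt ip (app E5) (app IBop) = app (E5 * s2)"
  proof (rule corner_sqrt_app[OF pos_mult[OF proj_pos[OF E5] s2(1) E2] E5 E5_sandwich[OF E2]])
    show "E5 * s2 * (E5 * s2) = IBop" by (simp add: mult_commute_middle[OF E2] s2(2) IBop_def E55)
  qed
  have "s1 * s2 = (1/2) *\<^sub>R (k * hi)"
  proof (rule pos_sqrt_unique)
    show "pos (s1 * s2)" by (rule pos_mult[OF s1(1) s2(1) s12])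
    show "pos ((1/2) *\<^sub>R (k * hi))" by (intro pos_scaleR pos_mult[OF pos_k pos_hi k_hi]) simp
    have "s1 * s2 * (s1 * s2) = s1 * s1 * (s2 * s2)" by (rule mult_commute_middle[OF s12])
    also have "\<dots> = (1/4) *\<^sub>R ((1 + hi) * (1 - hi))" by (simp add: s1(2) s2(2))
    also have "(1 + hi) * (1 - hi) = k * hi * (k * hi)" by (simp add: algebra_simps nf)
    finally show "s1 * s2 * (s1 * s2) = (1/2) *\<^sub>R (k * hi) * ((1/2) *\<^sub>R (k * hi))" by simp
  qed
  moreover have "E5 * s1 * (E5 * s2) = E5 * (s1 * s2)" by (simp add: mult_commute_middle[OF E1] E55)
  ultimately show ?thesis by (simp add: sq1 sq2 app_mult Cop_def)
qed

lemma e_n1: "e * n1 = n1" and e_n4: "e * n4 = 0" and f_n1: "f * n1 = 0" and f_n4: "f * n4 = n4"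
  unfolding e_def f_def
  by (simp_all add: distrib_right left_diff_distrib mult.assoc j_n1 j_n4 d_n1 d_n4 h_fix[OF d_n1] h_fix[OF d_n4]
      scaleR_half_double)

text \<open>The columns of the block matrices; \<open>d * (hi * E5) / 2\<close> is the entry that
  \<open>block_operators\<close> recognises as \<open>U * Cop\<close>.\<close>

lemma e_E5: "e * E5 = Bop + (1/2) *\<^sub>R (d * (hi * E5))"
  and e_E6: "e * E6 = (1/2) *\<^sub>R ((1 - hi) * E6) - (1/2) *\<^sub>R (d * (hi * E6))"
  and f_E5: "f * E5 = IBop + (1/2) *\<^sub>R (d * (hi * E5))"
  and f_E6: "f * E6 = (1/2) *\<^sub>R ((1 + hi) * E6) - (1/2) *\<^sub>R (d * (hi * E6))"
proof -
  have jd: "j * d = - (d * j)" by (simp add: dj)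
  have jd5: "j * (d * E5) = - (d * E5)" and jd6: "j * (d * E6) = d * E6"
    by (simp_all add: jd[THEN mult_eq_assoc] mult.assoc j_E5 j_E6)
  show "e * E5 = Bop + (1/2) *\<^sub>R (d * (hi * E5))"
    unfolding e_def Bop_def E5_comm_plus
    by (simp add: algebra_simps j_E5 jd5 d_hi d_hi[THEN mult_eq_assoc])
  show "f * E5 = IBop + (1/2) *\<^sub>R (d * (hi * E5))"
    unfolding f_def IBop_def E5_comm_plus
    by (simp add: algebra_simps j_E5 jd5 d_hi d_hi[THEN mult_eq_assoc])
  show "e * E6 = (1/2) *\<^sub>R ((1 - hi) * E6) - (1/2) *\<^sub>R (d * (hi * E6))"
    unfolding e_def by (simp add: algebra_simps j_E6 jd6 d_hi d_hi[THEN mult_eq_assoc])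
  show "f * E6 = (1/2) *\<^sub>R ((1 + hi) * E6) - (1/2) *\<^sub>R (d * (hi * E6))"
    unfolding f_def by (simp add: algebra_simps j_E6 jd6 d_hi d_hi[THEN mult_eq_assoc])
qed

lemma components:
  assumes "app n1 z1 = z1" "app n4 z4 = z4" "app E5 z5 = z5" "app E6 z6 = z6"
  shows "(app n1 (z1 + z4 + z5 + z6), app n4 (z1 + z4 + z5 + z6),
    app E5 (z1 + z4 + z5 + z6), app E6 (z1 + z4 + z5 + z6)) = (z1, z4, z5, z6)"
proof -
  have orth: "n1 * n4 = 0" "n1 * E5 = 0" "n1 * E6 = 0" "n4 * n1 = 0" "n4 * E5 = 0" "n4 * E6 = 0"
    "E5 * n1 = 0" "E5 * n4 = 0" "E6 * n1 = 0" "E6 * n4 = 0"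
    by (simp_all add: n1_def n4_def algebra_simps pp E55 E66 p_E5 E5_p p_E6 E6_p E5_E6 E6_E5)
  have zero: "app S z = 0" if "S * T = 0" "app T z = z" for S T and z
    using that by (metis app_simps(1,6))
  note zeros = orth[THEN zero] E5_E6[THEN zero] E6_E5[THEN zero]
  have "app n1 z4 = 0" "app n1 z5 = 0" "app n1 z6 = 0" "app n4 z1 = 0" "app n4 z5 = 0" "app n4 z6 = 0"
    "app E5 z1 = 0" "app E5 z4 = 0" "app E5 z6 = 0" "app E6 z1 = 0" "app E6 z4 = 0" "app E6 z5 = 0"
    by (rule zeros, rule assms)+
  then show ?thesis by (simp add: assms)
qed

lemma block_operators:
  obtains U where "U \<in> LH" "E6 * U * E5 = U" "dag U * U = E5" "U * dag U = E6"
    "\<And>y1 y4 y5 y6. app n1 y1 = y1 \<Longrightarrow> app n4 y4 = y4 \<Longrightarrow> app E5 y5 = y5 \<Longrightarrow> app E6 y6 = y6 \<Longrightarrow>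
      app e (y1 + y4 + y5 + y6) = y1 + 0 + (app Bop y5 + app Cop (app (dag U) y6))
        + (app U (app Cop y5) + app U (app IBop (app (dag U) y6)))"
    "\<And>y1 y4 y5 y6. app n1 y1 = y1 \<Longrightarrow> app n4 y4 = y4 \<Longrightarrow> app E5 y5 = y5 \<Longrightarrow> app E6 y6 = y6 \<Longrightarrow>
      app f (y1 + y4 + y5 + y6) = 0 + y4 + (app IBop y5 + app Cop (app (dag U) y6))
        + (app U (app Cop y5) + app U (app Bop (app (dag U) y6)))"
proof -
  obtain u where u: "u \<in> LH" "dag u = - u" "u * k = d" "u * d = - k" "j * u = - (u * j)"
    "u * h = h * u" "u * hi = hi * u" "u * n1 = 0" "u * n4 = 0" by (rule polar_decomposition)
  have n_u: "n1 * u = 0" "n4 * u = 0"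
    using arg_cong[OF u(8), of dag] arg_cong[OF u(9), of dag] u(1,2) proj_n1 proj_n4
    by (simp_all add: proj_LH proj_dag)
  have ku: "k * u = d"
    using arg_cong[OF u(3), of dag] u(1,2) by (simp add: LHs dags)
  have up: "u * p + p * u = u"
  proof -
    have "(p + p) * u + u * (p + p) = u + u" unfolding p_add_p by (simp add: algebra_simps u(5))
    then have "(1/2) *\<^sub>R ((p * u + p * u) + (u * p + u * p)) = (1/2) *\<^sub>R (u + u)"
      by (simp add: algebra_simps)
    then have "p * u + u * p = u" by (simp only: scaleR_right_distrib[of _ "_ + _"] scaleR_half_double)
    then show ?thesis by (simp add: add.commute)
  qed
  have uE5: "u * E5 = u * p" and E6u: "E6 * u = u * p" and E5u: "E5 * u = p * u" and uE6: "u * E6 = p * u"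
  proof -
    show "u * E5 = u * p" using u(8) by (simp add: n1_def right_diff_distrib)
    show "E5 * u = p * u" using n_u(1) by (simp add: n1_def left_diff_distrib)
    have "E6 * u = u - p * u" using n_u(2) by (simp add: n4_def left_diff_distrib)
    then show "E6 * u = u * p" using up by (metis add_diff_cancel_right')
    have "u * E6 = u - u * p" using u(9) by (simp add: n4_def right_diff_distrib)
    then show "u * E6 = p * u" using up by (metis add_diff_cancel_left')
  qed
  have uud: "u * u * d = - d" by (simp add: mult.assoc u(3,4))
  \<comment> \<open>\<open>u * u = - 1\<close> is known on the range of \<open>d\<close>. It must
    commute with \<open>p\<close> for the identity to reach the range of \<open>p * d\<close> and,
    by closure, \<open>H5\<close>.\<close>
  have "p * (u * u) = u * E6 * u" by (simp add: uE6 mult.assoc)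
  also have "\<dots> = u * u * p" by (simp add: E6u mult.assoc)
  finally have puu: "p * (u * u) = u * u * p" .
  have "u * u * (p * d) = p * (u * u) * d" by (simp add: puu mult.assoc)
  also have "\<dots> = p * (u * u * d)" by (simp add: mult.assoc)
  finally have "u * u * (p * d) = - (p * d)" by (simp add: uud)
  then have "u * u * E5 = (- 1) * E5" by (intro mult_eq_if_closure_range[of E5 "p * d"]) (simp_all add: rE5)
  then have uu5: "u * u * E5 = - E5" by simp
  have "u * u * (d * p) = u * u * d * p" by (simp add: mult.assoc)
  then have "u * u * (d * p) = - (d * p)" by (simp add: uud)
  then have "u * u * E6 = (- 1) * E6" by (intro mult_eq_if_closure_range[of E6 "d * p"]) (simp_all add: rE6)
  then have uu6: "u * u * E6 = - E6" by simp
  define U where "U = u * E5"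
  have UL: "U \<in> LH" by (simp add: U_def u E5_LH)
  have dU: "dag U = - (E5 * u)" by (simp add: U_def u E5_LH dag_E5)
  have U6: "U = E6 * u" by (simp add: U_def uE5 E6u)
  have dU6: "dag U = - (u * E6)" by (simp add: dU E5u uE6)
  have UC: "U * Cop = (1/2) *\<^sub>R (d * (hi * E5))"
  proof -
    have "U * Cop = (1/2) *\<^sub>R (u * (E5 * E5) * (k * hi))" by (simp add: U_def Cop_def mult.assoc)
    also have "u * (E5 * E5) * (k * hi) = u * k * (hi * E5)"
      by (simp add: E55 mult.assoc E5_central E5_central[THEN mult_eq_assoc])
    finally show ?thesis by (simp add: u(3))
  qed
  have CU: "Cop * dag U = - ((1/2) *\<^sub>R (d * (hi * E6)))"
  proof -
    have "Cop * dag U = - ((1/2) *\<^sub>R (E5 * (k * hi) * (E5 * u)))" by (simp add: dU Cop_def)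
    also have "E5 * (k * hi) * (E5 * u) = (k * hi) * (E5 * (E5 * u))"
      by (simp add: mult.assoc E5_central E5_central[THEN mult_eq_assoc])
    also have "\<dots> = (k * hi) * (u * E6)" by (simp add: E5_p[THEN mult_eq_assoc] E5u uE6)
    also have "\<dots> = (k * u) * (hi * E6)" by (simp add: mult.assoc u(7)[THEN mult_eq_assoc])
    finally show ?thesis by (simp add: ku)
  qed
  \<comment> \<open>Conjugation by \<open>U\<close> moves a function of \<open>h\<close> from
    \<open>H5\<close> to \<open>H6\<close> unchanged; the sign of \<open>dag U\<close> cancels that
    of \<open>u * u\<close>.\<close>
  have UXU: "U * ((1/2) *\<^sub>R (E5 * c)) * dag U = (1/2) *\<^sub>R (c * E6)"
    if c: "E5 * c = c * E5" "E6 * c = c * E6" "u * c = c * u" for c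
  proof -
    have "U * ((1/2) *\<^sub>R (E5 * c)) * dag U = - ((1/2) *\<^sub>R (u * (E5 * (E5 * c)) * (u * E6)))"
      by (simp add: dU6) (simp add: U_def mult.assoc)
    also have "u * (E5 * (E5 * c)) = u * (c * E5)" by (simp add: c(1) c(1)[THEN mult_eq_assoc] E55 mult.assoc)
    also have "u * (c * E5) = c * (u * E5)" by (simp add: c(3)[THEN mult_eq_assoc] mult.assoc)
    also have "c * (u * E5) * (u * E6) = c * (u * (E5 * u) * E6)" by (simp add: mult.assoc)
    also have "E5 * u = u * E6" by (simp add: E5u uE6)
    also have "c * (u * (u * E6) * E6) = c * (u * u * E6)" by (simp add: mult.assoc E66)
    finally show ?thesis by (simp add: uu6)
  qed
  have UBU: "U * Bop * dag U = (1/2) *\<^sub>R ((1 + hi) * E6)"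
    unfolding Bop_def by (rule UXU) (simp_all add: algebra_simps E5_central E6_central u(7))
  have UIU: "U * IBop * dag U = (1/2) *\<^sub>R ((1 - hi) * E6)"
    unfolding IBop_def by (rule UXU) (simp_all add: algebra_simps E5_central E6_central u(7))
  have eE: "e * E5 = Bop + U * Cop" "e * E6 = Cop * dag U + U * IBop * dag U"
    "f * E5 = IBop + U * Cop" "f * E6 = Cop * dag U + U * Bop * dag U"
    by (simp_all add: e_E5 e_E6 f_E5 f_E6 UC CU UBU UIU)
  show ?thesis
  proof (rule that[OF UL])
    have "E6 * U = U" unfolding U6 by (rule mult_eq_assoc[OF E66])
    moreover have "U * E5 = U" by (simp add: U_def mult.assoc E55)
    ultimately show "E6 * U * E5 = U" by simp
    show "dag U * U = E5" by (simp add: dU) (simp add: U_def mult.assoc uu5[unfolded mult.assoc] E55)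
    have "U * dag U = - (u * (E5 * u) * E6)" by (simp add: dU6) (simp add: U_def mult.assoc)
    also have "E5 * u = u * E6" by (simp add: E5u uE6)
    finally show "U * dag U = E6" by (simp add: mult.assoc E66 uu6[unfolded mult.assoc])
    fix y1 y4 y5 y6 assume y: "app n1 y1 = y1" "app n4 y4 = y4" "app E5 y5 = y5" "app E6 y6 = y6"
    have "app e y1 = y1" "app e y4 = 0" "app f y1 = 0" "app f y4 = y4"
      using e_n1 e_n4 f_n1 f_n4 y by (metis app_simps(1,6))+
    moreover have "app e y5 = app Bop y5 + app U (app Cop y5)" "app f y5 = app IBop y5 + app U (app Cop y5)"
      "app e y6 = app Cop (app (dag U) y6) + app U (app IBop (app (dag U) y6))"
      "app f y6 = app Cop (app (dag U) y6) + app U (app Bop (app (dag U) y6))"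
      using eE y by (metis app_simps(3,6))+
    ultimately show "app e (y1 + y4 + y5 + y6) = y1 + 0 + (app Bop y5 + app Cop (app (dag U) y6))
        + (app U (app Cop y5) + app U (app IBop (app (dag U) y6)))"
      "app f (y1 + y4 + y5 + y6) = 0 + y4 + (app IBop y5 + app Cop (app (dag U) y6))
        + (app U (app Cop y5) + app U (app Bop (app (dag U) y6)))"
      by (simp_all add: algebra_simps)
  qed
qed

end

text \<open>Operators between submodules are encoded as corners of L(H): \<open>U = P6 U P5\<close>
  with \<open>P5\<close> and \<open>P6\<close> as its two products with the adjoint expresses a
  unitary from \<open>H5\<close> onto \<open>H6\<close>. The block identities are tested on all
  tuples.\<close>

theorem theorem4p4:
  fixes sC :: "complex \<Rightarrow> 'a::{real_normed_algebra,banach} \<Rightarrow> 'a"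
    and st :: "'a \<Rightarrow> 'a"
    and sH :: "complex \<Rightarrow> 'h::banach \<Rightarrow> 'h"
    and act :: "'h \<Rightarrow> 'a \<Rightarrow> 'h"
    and ip :: "'h \<Rightarrow> 'h \<Rightarrow> 'a"
    and Q :: "'h \<Rightarrow> 'h"
  assumes H: "hilbert_cstar_module sC st sH act ip"
    and Q_idem: "idempotent_op ip Q"
    and Q_nonproj: "\<not> is_proj ip Q"
    and harm: "harmonious ip (matched_proj ip Q) Q"
  shows
    "let P = matched_proj ip Q;
         H1 = range P \<inter> range Q;
         H4 = ker_op P \<inter> ker_op Q;
         H5 = closure (range (P \<circ> Q \<circ> (\<lambda>x. x - P x)));
         H6 = closure (range ((\<lambda>x. x - P x) \<circ> Q \<circ> P));
         P1 = proj_onto ip H1; P4 = proj_onto ip H4;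
         P5 = proj_onto ip H5; P6 = proj_onto ip H6;
         Um = (\<lambda>x. (P1 x, P4 x, P5 x, P6 x));
         Um_adj = (\<lambda>(y1, y4, y5, y6). y1 + y4 + y5 + y6);
         PR = proj_onto ip (range Q);
         PN = proj_onto ip (ker_op Q)
     in \<exists>U A.
          adjointable ip U \<and> U = P6 \<circ> U \<circ> P5 \<and>
          adj ip U \<circ> U = P5 \<and> U \<circ> adj ip U = P6 \<and>
          adjointable ip A \<and> A = P5 \<circ> A \<circ> P5 \<and>
          corner_pos ip P5 (\<lambda>x. A x - P5 x) \<and>
          closure (range (\<lambda>x. A x - P5 x)) = H5 \<and>
          (let B = A \<circ> corner_inv ip P5 (\<lambda>x. 2 *\<^sub>R A x - P5 x);
               IB = (\<lambda>x. P5 x - B x);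
               C = corner_sqrt ip P5 B \<circ> corner_sqrt ip P5 IB
           in \<forall>y1\<in>H1. \<forall>y4\<in>H4. \<forall>y5\<in>H5. \<forall>y6\<in>H6.
                Um (PR (Um_adj (y1, y4, y5, y6))) =
                  (y1, 0, B y5 + C (adj ip U y6), U (C y5) + U (IB (adj ip U y6))) \<and>
                Um (PN (Um_adj (y1, y4, y5, y6))) =
                  (0, y4, IB y5 + C (adj ip U y6), U (C y5) + U (B (adj ip U y6))))"
proof -
  interpret H: ip_space st "sC \<i>" ip "sH \<i>" by (rule hilbert_module_ip_space[OF H])
  obtain q where q: "q \<in> H.LH" "Q = app q"
    using Q_idem by (auto simp: idempotent_op_def elim: H.adjointableE)
  have "q * q = q" using Q_idem q by (simp add: idempotent_op_def app_mult app_inject)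
  then obtain h hi k y j d where form: "idempotent_form st (sC \<i>) ip (sH \<i>) h hi k y j d"
    and q_eq: "q = (1/2) *\<^sub>R (1 + h * j + d)" using H.idempotent_form_ex[OF q(1)] by blast
  interpret F: idempotent_form st "sC \<i>" ip "sH \<i>" h hi k y j d by (rule form)
  have Q: "Q = app F.q" by (simp add: q q_eq F.q_def)
  let ?p = F.p
  have P: "matched_proj ip Q = app ?p" by (simp add: Q F.matched_proj_q)
  have one_minus: "(\<lambda>x. x - app T x) = app (1 - T)" for T :: "'h endo" by (auto simp: fun_eq_iff)
  \<comment> \<open>Disposes of the factor 1/2 that separates the corners of \<open>q\<close> from
    those of \<open>d\<close>.\<close>
  have range_scale: "range (app ((1/2) *\<^sub>R T)) = range (app T)" for T :: "'h endo"
  proof -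
    have "app T x = app ((1/2) *\<^sub>R T) (2 *\<^sub>R x)" "app ((1/2) *\<^sub>R T) x = app T ((1/2) *\<^sub>R x)" for x by simp_all
    then show ?thesis by blast
  qed
  have r5: "app ?p \<circ> Q \<circ> (\<lambda>x. x - app ?p x) = app ((1/2) *\<^sub>R (?p * d))"
    unfolding Q one_minus app_mult F.corner_12 ..
  have r6: "(\<lambda>x. x - app ?p x) \<circ> Q \<circ> app ?p = app ((1/2) *\<^sub>R (d * ?p))"
    unfolding Q one_minus app_mult F.corner_21 ..
  have h5: "closure (range (app ?p \<circ> Q \<circ> (\<lambda>x. x - app ?p x))) = closure (range (app (?p * d)))"
    unfolding r5 range_scale ..
  have h6: "closure (range ((\<lambda>x. x - app ?p x) \<circ> Q \<circ> app ?p)) = closure (range (app (d * ?p)))"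
    unfolding r6 range_scale ..
  obtain E5 where E5: "H.proj E5" "range (app E5) = closure (range (app (?p * d)))"
    using harm H.orth_complemented_proj unfolding harmonious_def P h5 by blast
  obtain E6 where E6: "H.proj E6" "range (app E6) = closure (range (app (d * ?p)))"
    using harm H.orth_complemented_proj unfolding harmonious_def P h6 by blast
  interpret G: harmonious_form st "sC \<i>" ip "sH \<i>" h hi k y j d E5 E6
    by unfold_locales (fact E5 E6)+
  obtain U where U: "U \<in> H.LH" "E6 * U * E5 = U" "H.dag U * U = E5" "U * H.dag U = E6"
    and PR: "\<And>y1 y4 y5 y6. app G.n1 y1 = y1 \<Longrightarrow> app G.n4 y4 = y4 \<Longrightarrow> app E5 y5 = y5 \<Longrightarrow> app E6 y6 = y6 \<Longrightarrow>
      app F.e (y1 + y4 + y5 + y6) = y1 + 0 + (app G.Bop y5 + app G.Cop (app (H.dag U) y6))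
        + (app U (app G.Cop y5) + app U (app G.IBop (app (H.dag U) y6)))"
    and PN: "\<And>y1 y4 y5 y6. app G.n1 y1 = y1 \<Longrightarrow> app G.n4 y4 = y4 \<Longrightarrow> app E5 y5 = y5 \<Longrightarrow> app E6 y6 = y6 \<Longrightarrow>
      app F.f (y1 + y4 + y5 + y6) = 0 + y4 + (app G.IBop y5 + app G.Cop (app (H.dag U) y6))
        + (app U (app G.Cop y5) + app U (app G.Bop (app (H.dag U) y6)))"
    by (rule G.block_operators) (rule that; blast)
  have p5: "proj_onto ip (closure (range (app (?p * d)))) = app E5" by (rule H.proj_onto_app[OF E5])
  have p6: "proj_onto ip (closure (range (app (d * ?p)))) = app E6" by (rule H.proj_onto_app[OF E6])
  have A1: "(\<lambda>x. app G.Aop x - app E5 x) = app (G.Aop - E5)" by (auto simp: fun_eq_iff)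
  have A2: "(\<lambda>x. 2 *\<^sub>R app G.Aop x - app E5 x) = app (E5 * h)"
    using G.two_Aop_minus by (auto simp: fun_eq_iff simp flip: app_simps)
  have B1: "app G.Aop \<circ> app (E5 * hi) = app G.Bop" by (simp add: app_mult G.Aop_inv)
  have B2: "app E5 x - app G.Bop x = app G.IBop x" for x
    by (simp flip: G.E5_minus_Bop)
  \<comment> \<open>Converts a vector given as a sum of four orthogonal pieces into its tuple of
    components.\<close>
  have block: "(app G.n1 z, app G.n4 z, app E5 z, app E6 z) = (z1, z4, z5, z6)"
    if "z = z1 + z4 + z5 + z6" "app G.n1 z1 = z1" "app G.n4 z4 = z4" "app E5 z5 = z5" "app E6 z6 = z6"
    for z z1 z4 z5 z6
    using G.components[OF that(2-5)] unfolding that(1) .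
  have n1: "app G.n1 y = y" if "y \<in> range (app ?p) \<inter> range (app F.q)" for y
    using that G.range_n1 H.proj_app_range[OF G.proj_n1] by simp
  have n4: "app G.n4 y = y" if "y \<in> ker_op (app ?p) \<inter> ker_op (app F.q)" for y
    using that G.range_n4 H.proj_app_range[OF G.proj_n4] by simp
  have e5: "app E5 y = y" if "y \<in> closure (range (app (?p * d)))" for y
    using that H.proj_app_range[OF E5(1)] by (simp add: E5(2))
  have e6: "app E6 y = y" if "y \<in> closure (range (app (d * ?p)))" for y
    using that H.proj_app_range[OF E6(1)] by (simp add: E6(2))
  have in5: "app E5 (app T x) = app T x" if "T \<in> {G.Bop, G.IBop, G.Cop}" for T x
    using that G.E5_mult_ops by (auto simp flip: app_simps(6))
  have in6: "app E6 (app U x) = app U x" for x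
    using U(2) H.proj_idem[OF E6(1)] by (metis app_simps(6) mult.assoc)
  have blocks:
    "(app G.n1 (app F.e (y1 + y4 + y5 + y6)), app G.n4 (app F.e (y1 + y4 + y5 + y6)),
      app E5 (app F.e (y1 + y4 + y5 + y6)), app E6 (app F.e (y1 + y4 + y5 + y6))) =
      (y1, 0, app G.Bop y5 + app G.Cop (app (H.dag U) y6), app U (app G.Cop y5) + app U (app G.IBop (app (H.dag U) y6)))"
    "(app G.n1 (app F.f (y1 + y4 + y5 + y6)), app G.n4 (app F.f (y1 + y4 + y5 + y6)),
      app E5 (app F.f (y1 + y4 + y5 + y6)), app E6 (app F.f (y1 + y4 + y5 + y6))) =
      (0, y4, app G.IBop y5 + app G.Cop (app (H.dag U) y6), app U (app G.Cop y5) + app U (app G.Bop (app (H.dag U) y6)))"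
    if "app G.n1 y1 = y1" "app G.n4 y4 = y4" "app E5 y5 = y5" "app E6 y6 = y6" for y1 y4 y5 y6
    by (rule block[OF PR[OF that]] block[OF PN[OF that]]; simp add: that in5 in6)+
  show ?thesis
    unfolding Let_def P h5 h6 p5 p6
    unfolding Q F.proj_onto_range_q F.proj_onto_ker_q G.proj_onto_H1 G.proj_onto_H4
  proof (rule exI[of _ "app U"], rule exI[of _ "app G.Aop"], intro conjI)
    show "adjointable ip (app U)" "adjointable ip (app G.Aop)"
      using U(1) G.Aop_LH by (auto intro: H.adjointable_app)
    show "app U = app E6 \<circ> app U \<circ> app E5" by (simp add: app_mult U)
    show "adj ip (app U) \<circ> app U = app E5" "app U \<circ> adj ip (app U) = app E6"
      by (simp_all add: H.adj_app U app_mult)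
    show "app G.Aop = app E5 \<circ> app G.Aop \<circ> app E5" by (simp add: app_mult G.Aop_corner)
    show "corner_pos ip (app E5) (\<lambda>x. app G.Aop x - app E5 x)"
      unfolding A1 by (rule G.corner_pos_Aop_minus)
    show "closure (range (\<lambda>x. app G.Aop x - app E5 x)) = closure (range (app (?p * d)))"
      unfolding A1 G.closure_range_Aop_minus E5(2) ..
  qed (unfold A2 G.corner_inv_E5_h B1 B2 G.corner_sqrts H.adj_app[OF U(1)] prod.case,
      (intro ballI conjI; rule blocks; (rule n1 n4 e5 e6, assumption)))
qed

end
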